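(* Let $1\le p_1,p_2,q_1,q_2\le\infty$, $s_1,s_2,t_1,t_2\in\mathbb{R}$, $\tau\in(0,1)$. Then $$(\ast)\qquad\forall\sigma\in W(\mathscr{F}L^1,L^\infty)(\mathbb{R}^{2d})\Longrightarrow OP_\tau(\sigma):\mathcal{M}^{p_1,q_1}_{v_{s_1,t_1}}(\mathbb{R}^d)\longrightarrow M^{p_2,q_2}_{v_{s_2,t_2}}(\mathbb{R}^d)$$ if and only if $$\begin{cases}s_2\le0\le s_1,\\ 1<\frac1{p_1}+\frac{s_1}d\ \text{ or }\ (p_1,s_1)=(1,0),\\ \frac1{p_2}+\frac{s_2}d<0\ \text{ or }\ (p_2,s_2)=(\infty,0),\end{cases}\qquad\text{and}\qquad\begin{cases}t_2\le0\le t_1,\\ 1<\frac1{q_1}+\frac{t_1}d\ \text{ or }\ (q_1,t_1)=(1,0),\\ \frac1{q_2}+\frac{t_2}d<0\ \text{ or }\ (q_2,t_2)=(\infty,0).\end{cases}$$ In particular, when $s_i=t_i=0$, $i=1,2$, $(\ast)$ holds if and only if $p_1=q_1=1$ and $p_2=q_2=\infty$.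
   Context: $1/\infty=0$. $\langle\cdot,\cdot\rangle$ extends $\langle f,g\rangle=\int f\bar g$ to $\mathcal{S}'\times\mathcal{S}$. $\langle x\rangle=(1+|x|^2)^{1/2}$ and $v_{s,t}(z)=\langle z_1\rangle^s\langle z_2\rangle^t$ for $z=(z_1,z_2)\in\mathbb{R}^{2d}$. $\tau$-Wigner distribution: $W_\tau(f_1,f_2)(x,\xi)=\int_{\mathbb{R}^d}f_1(x+\tau t)\overline{f_2(x-(1-\tau)t)}e^{-2\pi i\xi\cdot t}\,dt$. $\tau$-pseudodifferential operator with symbol $\sigma\in\mathcal{S}'(\mathbb{R}^{2d})$: $\langle OP_\tau(\sigma)f,g\rangle=\langle\sigma,W_\tau(g,f)\rangle$ for $f,g\in\mathcal{S}(\mathbb{R}^d)$. Function spaces: for $f\in\mathcal{S}'(\mathbb{R}^n)$ and a fixed nonzero $\phi\in\mathcal{S}(\mathbb{R}^n)$, $V_\phi f(x,\xi)=\langle f,M_\xi T_x\phi\rangle$ with $T_xg(t)=g(t-x)$, $M_\xi g(t)=e^{2\pi it\cdot\xi}g(t)$. $M^{p,q}_m(\mathbb{R}^n)$ is the set of $f\in\mathcal{S}'(\mathbb{R}^n)$ with $\|f\|_{M^{p,q}_m}=\big(\int(\int|V_\phi f(x,\xi)|^pm(x,\xi)^pdx)^{q/p}d\xi\big)^{1/q}<\infty$ (usual modification if $p$ or $q$ is $\infty$; different $\phi$ give equivalent norms). $\mathcal{M}^{p,q}_m(\mathbb{R}^n)$ is the closure of $\mathcal{S}(\mathbb{R}^n)$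 in $M^{p,q}_m(\mathbb{R}^n)$. The Wiener amalgam space $W(\mathscr{F}L^p,L^q)(\mathbb{R}^{2d})=\mathscr{F}M^{p,q}(\mathbb{R}^{2d})$ is the set of $F\in\mathcal{S}'(\mathbb{R}^{2d})$ with (up to equivalence) $\|F\|=\big(\int_{\mathbb{R}^{2d}}(\int_{\mathbb{R}^{2d}}|V_\Phi F(\zeta,-z)|^pdz)^{q/p}d\zeta\big)^{1/q}<\infty$ for a nonzero $\Phi\in\mathcal{S}(\mathbb{R}^{2d})$ (usual modifications). The notation "$\forall\sigma\in X\Longrightarrow OP_\tau(\sigma):\mathcal{M}^{p_1,q_1}_{m_1}\to M^{p_2,q_2}_{m_2}$" means that for every $\sigma\in X$ there is $C_\sigma$ with $\|OP_\tau(\sigma)f\|_{M^{p_2,q_2}_{m_2}}\le C_\sigma\|f\|_{M^{p_1,q_1}_{m_1}}$ for all $f\in\mathcal{S}(\mathbb{R}^d)$. *)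

theory Defs
  imports "HOL-Analysis.Analysis" "HOL-Probability.Essential_Supremum"
begin

section \<open>Schwartz functions and tempered distributions\<close>

definition jbracket :: "'a::real_normed_vector \<Rightarrow> real" where
  "jbracket x = sqrt (1 + (norm x)\<^sup>2)"

text \<open>Multi-indices are encoded as lists of basis vectors: \<open>iter_deriv bs f\<close> differentiates \<open>f\<close>
  successively in the directions listed in \<open>bs\<close> (last entry first).\<close>

primrec iter_deriv :: "'a::euclidean_space list \<Rightarrow> ('a \<Rightarrow> complex) \<Rightarrow> 'a \<Rightarrow> complex" where
  "iter_deriv [] f = f"
| "iter_deriv (b # bs) f = (\<lambda>x. frechet_derivative (iter_deriv bs f) (at x) b)"

text \<open>Differentiability of every iterated partial derivative is smoothness.\<close>

definition schwartz :: "('a::euclidean_space \<Rightarrow> complex) set" where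
  "schwartz = {f. \<forall>bs. set bs \<subseteq> Basis \<longrightarrow>
     (\<forall>x. iter_deriv bs f differentiable (at x)) \<and>
     (\<forall>N::nat. bdd_above (range (\<lambda>x. jbracket x ^ N * cmod (iter_deriv bs f x))))}"

definition schwartz_seminorm :: "nat \<Rightarrow> ('a::euclidean_space \<Rightarrow> complex) \<Rightarrow> real" where
  "schwartz_seminorm N f =
     (\<Sum>bs | set bs \<subseteq> Basis \<and> length bs \<le> N. SUP x. jbracket x ^ N * cmod (iter_deriv bs f x))"

text \<open>Continuous complex-linear functionals on the Schwartz space. The value \<open>0\<close> outside
  \<open>schwartz\<close> makes a distribution determined by its values on test functions.\<close>

definition tempered_distributions :: "(('a::euclidean_space \<Rightarrow> complex) \<Rightarrow> complex) set" where
  "tempered_distributions = {u.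
     (\<forall>f\<in>schwartz. \<forall>g\<in>schwartz. u (\<lambda>x. f x + g x) = u f + u g) \<and>
     (\<forall>f\<in>schwartz. \<forall>c. u (\<lambda>x. c * f x) = c * u f) \<and>
     (\<exists>N C. \<forall>f\<in>schwartz. cmod (u f) \<le> C * schwartz_seminorm N f) \<and>
     (\<forall>f. f \<notin> schwartz \<longrightarrow> u f = 0)}"

text \<open>The pairing of \<open>u\<close> with \<open>g\<close> is antilinear in \<open>g\<close>; it extends \<open>\<integral> f * cnj g\<close>.\<close>

definition dpair :: "(('a::euclidean_space \<Rightarrow> complex) \<Rightarrow> complex) \<Rightarrow> ('a \<Rightarrow> complex) \<Rightarrow> complex" where
  "dpair u g = u (\<lambda>x. cnj (g x))"

definition dist_of :: "('a::euclidean_space \<Rightarrow> complex) \<Rightarrow> ('a \<Rightarrow> complex) \<Rightarrow> complex" where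
  "dist_of f = (\<lambda>g. if g \<in> schwartz then (\<integral>x. f x * g x \<partial>lborel) else 0)"


section \<open>Time-frequency analysis\<close>

definition tf_shift :: "'a::euclidean_space \<Rightarrow> 'a \<Rightarrow> ('a \<Rightarrow> complex) \<Rightarrow> 'a \<Rightarrow> complex" where
  "tf_shift x \<xi> g = (\<lambda>t. cis (2 * pi * (t \<bullet> \<xi>)) * g (t - x))"

definition stft ::
  "('a::euclidean_space \<Rightarrow> complex) \<Rightarrow> (('a \<Rightarrow> complex) \<Rightarrow> complex) \<Rightarrow> 'a \<Rightarrow> 'a \<Rightarrow> complex" where
  "stft \<phi> u x \<xi> = dpair u (tf_shift x \<xi> \<phi>)"

definition tau_wigner :: "real \<Rightarrow> ('a::euclidean_space \<Rightarrow> complex) \<Rightarrow> ('a \<Rightarrow> complex) \<Rightarrow> 'a \<times> 'a \<Rightarrow> complex" where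
  "tau_wigner \<tau> f1 f2 = (\<lambda>(x, \<xi>). \<integral>t. f1 (x + \<tau> *\<^sub>R t) * cnj (f2 (x - (1 - \<tau>) *\<^sub>R t))
     * cis (- 2 * pi * (\<xi> \<bullet> t)) \<partial>lborel)"

text \<open>The conjugate on \<open>g\<close> undoes the one in \<open>dpair\<close>; see \<open>dpair_OP_tau\<close> below.\<close>

definition OP_tau :: "real \<Rightarrow> (('a::euclidean_space \<times> 'a \<Rightarrow> complex) \<Rightarrow> complex) \<Rightarrow> ('a \<Rightarrow> complex)
    \<Rightarrow> ('a \<Rightarrow> complex) \<Rightarrow> complex" where
  "OP_tau \<tau> \<sigma> f = (\<lambda>g. if g \<in> schwartz then dpair \<sigma> (tau_wigner \<tau> (\<lambda>x. cnj (g x)) f) else 0)"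


section \<open>Modulation and Wiener amalgam spaces\<close>

definition ennreal_powr :: "ennreal \<Rightarrow> real \<Rightarrow> ennreal" where
  "ennreal_powr x r = (if x = \<infinity> then \<infinity> else ennreal (enn2real x powr r))"

text \<open>Intended for exponents \<open>1 \<le> p \<le> \<infinity>\<close>.\<close>

definition Lp_norm :: "ereal \<Rightarrow> ('a::euclidean_space \<Rightarrow> ennreal) \<Rightarrow> ennreal" where
  "Lp_norm p F =
     (if p = \<infinity> then esssup lborel F
      else ennreal_powr (\<integral>\<^sup>+x. ennreal_powr (F x) (real_of_ereal p) \<partial>lborel) (1 / real_of_ereal p))"

definition modulation_norm :: "('a::euclidean_space \<Rightarrow> complex) \<Rightarrow> ereal \<Rightarrow> ereal \<Rightarrow> ('a \<times> 'a \<Rightarrow> real)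
    \<Rightarrow> (('a \<Rightarrow> complex) \<Rightarrow> complex) \<Rightarrow> ennreal" where
  "modulation_norm \<phi> p q m u =
     Lp_norm q (\<lambda>\<xi>. Lp_norm p (\<lambda>x. ennreal (cmod (stft \<phi> u x \<xi>) * m (x, \<xi>))))"

definition v_weight :: "real \<Rightarrow> real \<Rightarrow> 'a::euclidean_space \<times> 'a \<Rightarrow> real" where
  "v_weight s t = (\<lambda>(z1, z2). jbracket z1 powr s * jbracket z2 powr t)"

definition wiener_amalgam_norm :: "('a::euclidean_space \<Rightarrow> complex) \<Rightarrow> ereal \<Rightarrow> ereal
    \<Rightarrow> (('a \<Rightarrow> complex) \<Rightarrow> complex) \<Rightarrow> ennreal" where
  "wiener_amalgam_norm \<Phi> p q u =
     Lp_norm q (\<lambda>\<zeta>. Lp_norm p (\<lambda>z. ennreal (cmod (stft \<Phi> u \<zeta> (- z)))))"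

definition wiener_amalgam :: "('a::euclidean_space \<Rightarrow> complex) \<Rightarrow> ereal \<Rightarrow> ereal
    \<Rightarrow> (('a \<Rightarrow> complex) \<Rightarrow> complex) set" where
  "wiener_amalgam \<Phi> p q = {u \<in> tempered_distributions. wiener_amalgam_norm \<Phi> p q u < \<infinity>}"

text \<open>Every symbol in \<open>X\<close> gives an operator on Schwartz functions satisfying
  \<open>\<parallel>OP_tau \<tau> \<sigma> f\<parallel> \<le> C \<parallel>f\<parallel>\<close>, with source norm of parameters \<open>p1 q1 m1\<close> and target norm of parameters
  \<open>p2 q2 m2\<close>. The constant may depend on the symbol.\<close>

definition OP_tau_maps :: "('a::euclidean_space \<Rightarrow> complex) \<Rightarrow> real
    \<Rightarrow> (('a \<times> 'a \<Rightarrow> complex) \<Rightarrow> complex) set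
    \<Rightarrow> ereal \<Rightarrow> ereal \<Rightarrow> ('a \<times> 'a \<Rightarrow> real) \<Rightarrow> ereal \<Rightarrow> ereal \<Rightarrow> ('a \<times> 'a \<Rightarrow> real) \<Rightarrow> bool" where
  "OP_tau_maps \<phi> \<tau> X p1 q1 m1 p2 q2 m2 \<longleftrightarrow>
     (\<forall>\<sigma>\<in>X. \<exists>C::real. \<forall>f\<in>schwartz.
        modulation_norm \<phi> p2 q2 m2 (OP_tau \<tau> \<sigma> f) \<le> ennreal C * modulation_norm \<phi> p1 q1 m1 (dist_of f))"


section \<open>The pairing conventions agree with the defining identities\<close>

lemma iter_deriv_cnj:
  assumes "\<And>bs x. set bs \<subseteq> Basis \<Longrightarrow> iter_deriv bs f differentiable (at x)"
    and "set bs \<subseteq> Basis"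
  shows "iter_deriv bs (\<lambda>x. cnj (f x)) = (\<lambda>x. cnj (iter_deriv bs f x))"
  using assms(2)
proof (induction bs)
  case (Cons b bs)
  have "frechet_derivative (\<lambda>x. cnj (iter_deriv bs f x)) (at x)
      = (\<lambda>h. cnj (frechet_derivative (iter_deriv bs f) (at x) h))" for x
  proof -
    have "(iter_deriv bs f has_derivative frechet_derivative (iter_deriv bs f) (at x)) (at x)"
      using assms(1)[of bs x] Cons.prems by (simp add: frechet_derivative_works)
    then show ?thesis
      using frechet_derivative_at has_derivative_cnj by metis
  qed
  with Cons show ?case by simp
qed simp

lemma schwartz_cnj:
  assumes "f \<in> schwartz"
  shows "(\<lambda>x. cnj (f x)) \<in> schwartz"
proof -
  have d: "iter_deriv bs f differentiable (at x)" if "set bs \<subseteq> Basis" for bs x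
    using assms that by (simp add: schwartz_def)
  have "(\<lambda>x. cnj (iter_deriv bs f x)) differentiable (at x)" if "set bs \<subseteq> Basis" for bs x
    using d[OF that, of x] has_derivative_cnj unfolding differentiable_def by blast
  then show ?thesis
    using assms iter_deriv_cnj[OF d] by (simp add: schwartz_def)
qed

lemma dpair_dist_of: "g \<in> schwartz \<Longrightarrow> dpair (dist_of f) g = (\<integral>x. f x * cnj (g x) \<partial>lborel)"
  by (simp add: dpair_def dist_of_def schwartz_cnj)

lemma dpair_OP_tau: "g \<in> schwartz \<Longrightarrow> dpair (OP_tau \<tau> \<sigma> f) g = dpair \<sigma> (tau_wigner \<tau> g f)"
  by (simp add: dpair_def OP_tau_def schwartz_cnj)

end

theory Submission
  imports Defs
begin

text \<open>Necessity needs only two symbols. For \<open>c = 1 / \<tau>\<close> and \<open>c = - 1 / (1 - \<tau>)\<close> the chirp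
  \<open>cis (2 \<pi> c x \<bullet> \<xi>)\<close> lies in \<open>W(FL^1, L^\<infinity>)\<close>, and by Fourier inversion its operator has rank one:
  up to constants it maps \<open>f\<close> to \<open>(\<integral> f) \<delta>_0\<close>, respectively to the constant function \<open>f(0)\<close>.
  Boundedness therefore splits into the membership of \<open>\<delta>_0\<close> and \<open>1\<close> in the target space, which are the
  conditions on \<open>(q2, t2)\<close> and \<open>(p2, s2)\<close>, and the boundedness of the functionals \<open>\<integral> f\<close> and \<open>f(0)\<close> on the
  source space, which yields those on \<open>(p1, s1)\<close> and \<open>(q1, t1)\<close>.

  Conversely, the conditions embed the source space into \<open>M^{1,1}\<close> and \<open>M^{\<infinity>,\<infinity>}\<close> into the target space,
  so it suffices to bound \<open>\<langle>\<sigma>, W_\<tau>(\<pi>(w) \<phi>, f)\<rangle>\<close> uniformly in \<open>w\<close> by \<open>\<parallel>f\<parallel>_{M^{1,1}}\<close>. A symbol in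
  \<open>W(FL^1, L^\<infinity>)\<close> acts on Schwartz functions like a bounded function, and the \<open>L^1\<close> norm of the
  \<open>\<tau>\<close>-Wigner distribution is controlled through the reproducing formula for \<open>f\<close> and covariance.\<close>

section \<open>The Japanese bracket\<close>

text \<open>With the chirp of parameter \<open>c\<close> as symbol, the operator paired with
  \<open>g\<close> is, up to a constant, the integral of \<open>cnj (g ((1 - \<tau> * c) *\<^sub>R
  x)) * f ((1 + (1 - \<tau>) * c) *\<^sub>R x)\<close>. The two values of \<open>c\<close> are those
  at which one dilation collapses to 0; they exist because \<open>\<tau>\<close> is neither 0 nor 1.
  Every exponent condition places a power of the bracket in a Lebesgue space: on the target side the
  weight itself in L^p, on the source side the inverse weight in the dual space. The equality cases
  are the endpoints of these ranges. The obstacle in the sufficiency part is that a symbol is only a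
  functional on Schwartz functions. Expanding its argument by the reproducing formula requires
  moving it under an integral, and handling the target norm requires the transform of the output to
  be measurable. Both rest on estimates for slices of jointly Schwartz functions that are uniform
  over the derivatives involved. Constants are not tracked, so Fourier inversion is used with an
  unspecified nonzero factor.\<close>

lemma jbracket_ge_1: "1 \<le> jbracket x"
  by (simp add: jbracket_def)

lemma jbracket_pos [simp]: "0 < jbracket x"
  using jbracket_ge_1[of x] by linarith

lemma jbracket_nonneg [simp]: "0 \<le> jbracket x"
  using jbracket_pos[of x] by linarith

lemma jbracket_neq_0 [simp]: "jbracket x \<noteq> 0"
  using jbracket_pos[of x] by linarith

lemma jbracket_sq: "(jbracket x)\<^sup>2 = 1 + (norm x)\<^sup>2"
  by (simp add: jbracket_def)

lemma norm_le_jbracket: "norm x \<le> jbracket x"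
  by (rule power2_le_imp_le) (simp_all add: jbracket_sq)

lemma jbracket_le: "jbracket x \<le> 1 + norm x"
  by (rule power2_le_imp_le) (simp_all add: jbracket_sq power2_sum)

lemma jbracket_mono: "norm x \<le> norm y \<Longrightarrow> jbracket x \<le> jbracket y"
  by (simp add: jbracket_def)

lemma jbracket_minus [simp]: "jbracket (- x) = jbracket x"
  by (simp add: jbracket_def)

lemma jbracket_scale:
  assumes "norm x \<le> C * norm y" "1 \<le> C"
  shows "jbracket x \<le> C * jbracket y"
proof (rule power2_le_imp_le)
  have "(norm x)\<^sup>2 \<le> (C * norm y)\<^sup>2"
    using assms by (intro power_mono) auto
  moreover have "1 \<le> C\<^sup>2"
    using assms by (simp add: one_le_power)
  ultimately show "(jbracket x)\<^sup>2 \<le> (C * jbracket y)\<^sup>2"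
    by (simp add: jbracket_sq power_mult_distrib algebra_simps)
qed (use assms in simp)

lemma jbracket_add: "jbracket (x + y) \<le> 2 * jbracket x * jbracket y"
proof (rule power2_le_imp_le)
  have "(norm (x + y))\<^sup>2 \<le> (norm x + norm y)\<^sup>2"
    by (intro power_mono norm_triangle_ineq) auto
  also have "\<dots> \<le> 2 * (norm x)\<^sup>2 + 2 * (norm y)\<^sup>2"
    using sum_squares_bound[of "norm x" "norm y"] by (simp add: power2_sum)
  finally have "(norm (x + y))\<^sup>2 \<le> 2 * (norm x)\<^sup>2 + 2 * (norm y)\<^sup>2" .
  moreover have "0 \<le> (norm x)\<^sup>2 * (norm y)\<^sup>2" "0 \<le> (norm x)\<^sup>2" "0 \<le> (norm y)\<^sup>2" by simp_all
  moreover have "4 * ((1 + (norm x)\<^sup>2) * (1 + (norm y)\<^sup>2))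
      = 4 + 4 * (norm x)\<^sup>2 + 4 * (norm y)\<^sup>2 + 4 * ((norm x)\<^sup>2 * (norm y)\<^sup>2)"
    by (simp add: algebra_simps)
  ultimately have "1 + (norm (x + y))\<^sup>2 \<le> 4 * ((1 + (norm x)\<^sup>2) * (1 + (norm y)\<^sup>2))"
    by linarith
  then show "(jbracket (x + y))\<^sup>2 \<le> (2 * jbracket x * jbracket y)\<^sup>2"
    by (simp add: jbracket_sq power_mult_distrib mult.assoc)
qed simp

text \<open>Peetre's inequality: powers of the bracket are moderate weights. It follows from
  submultiplicativity, and for negative \<open>s\<close> from the same bound with \<open>x\<close>
  and \<open>y\<close> exchanged.\<close>

lemma jbracket_powr_le:
  "jbracket x powr s \<le> 2 powr \<bar>s\<bar> * jbracket (x - y) powr \<bar>s\<bar> * jbracket y powr s"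
proof (cases "s \<ge> 0")
  case True
  have "jbracket x \<le> 2 * jbracket (x - y) * jbracket y"
    using jbracket_add[of "x - y" y] by simp
  then have "jbracket x powr s \<le> (2 * jbracket (x - y) * jbracket y) powr s"
    using True by (intro powr_mono2) auto
  then show ?thesis using True by (simp add: powr_mult)
next
  case False
  have "jbracket y \<le> 2 * jbracket (x - y) * jbracket x"
    using jbracket_add[of "y - x" x] by (metis diff_add_cancel jbracket_minus minus_diff_eq)
  then have "jbracket y powr \<bar>s\<bar> \<le> (2 * jbracket (x - y) * jbracket x) powr \<bar>s\<bar>"
    by (intro powr_mono2) auto
  then have "jbracket y powr - s \<le> 2 powr \<bar>s\<bar> * jbracket (x - y) powr \<bar>s\<bar> * jbracket x powr - s"
    using False by (simp add: powr_mult)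
  then show ?thesis
    by (simp add: powr_minus field_simps)
qed

lemma continuous_on_jbracket [continuous_intros]:
  "continuous_on S f \<Longrightarrow> continuous_on S (\<lambda>x. jbracket (f x))"
  unfolding jbracket_def by (intro continuous_intros)

lemma measurable_jbracket [measurable]:
  "(jbracket :: 'a::euclidean_space \<Rightarrow> real) \<in> borel_measurable borel"
  by (intro borel_measurable_continuous_onI continuous_intros)

lemma jbracket_fst_le: "jbracket (fst z) \<le> jbracket z"
  by (cases z) (simp add: jbracket_mono norm_fst_le)

lemma jbracket_snd_le: "jbracket (snd z) \<le> jbracket z"
  by (cases z) (simp add: jbracket_mono norm_snd_le)

lemma jbracket_Pair_le: "jbracket (x, y) \<le> jbracket x * jbracket y"
  by (rule power2_le_imp_le)
     (simp_all add: jbracket_sq power_mult_distrib norm_Pair algebra_simps)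

text \<open>Dyadic balls replace polar coordinates. A point is charged to the first ball of radius
  \<open>2 ^ j\<close> that contains it, where the integrand is of order
  \<open>2 powr - (a * real j)\<close>; against the volume of that ball this leaves a geometric
  series of ratio \<open>r\<close>.\<close>

lemma nn_integral_jbracket_finite:
  assumes a: "a > real DIM('a)"
  shows "(\<integral>\<^sup>+x. ennreal (jbracket (x::'a::euclidean_space) powr - a) \<partial>lborel) < \<infinity>"
proof -
  define V where "V = unit_ball_vol (real DIM('a))"
  have V: "V \<ge> 0" by (simp add: V_def)
  define r where "r = 2 powr (real DIM('a) - a)"
  have r: "0 < r" "r < 1"
    using a by (auto simp: r_def powr_less_one)
  have "(\<integral>\<^sup>+x. ennreal (jbracket (x::'a) powr - a) \<partial>lborel)
      \<le> (\<integral>\<^sup>+x. (\<Sum>j. ennreal (2 powr a * 2 powr - (a * real j)) * indicator (ball 0 (2 ^ j)) (x::'a)) \<partial>lborel)"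
  proof (intro nn_integral_mono)
    fix x :: 'a
    define j where "j = (LEAST j. norm x < 2 ^ j)"
    have ex: "norm x < 2 ^ j"
      unfolding j_def by (rule LeastI_ex) (rule real_arch_pow, simp)
    \<comment> \<open>Minimality of \<open>j\<close> only bounds the norm below by
      \<open>2 ^ (j - 1)\<close>; the factor \<open>2 powr a\<close> pays for this shift, and it
      also covers \<open>j = 0\<close>, where minimality says nothing.\<close>
    have "jbracket x powr - a \<le> 2 powr a * 2 powr - (a * real j)"
    proof (cases j)
      case 0
      have "jbracket x powr - a \<le> 1 powr - a"
        using jbracket_ge_1[of x] a by (intro powr_mono2') auto
      also have "\<dots> \<le> 2 powr a" using a by (simp add: ge_one_powr_ge_zero)
      finally show ?thesis using 0 by simp
    next
      case (Suc i)
      have "\<not> norm x < 2 ^ i"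
        using not_less_Least[of i "\<lambda>j. norm x < 2 ^ j"] Suc unfolding j_def by simp
      then have "2 powr real i \<le> jbracket x"
        using norm_le_jbracket[of x] by (simp add: powr_realpow)
      then have "jbracket x powr - a \<le> (2 powr real i) powr - a"
        using a by (intro powr_mono2') auto
      also have "\<dots> = 2 powr a * 2 powr - (a * real j)"
        by (simp add: powr_powr powr_add[symmetric] Suc algebra_simps)
      finally show ?thesis .
    qed
    then have "ennreal (jbracket x powr - a)
        \<le> ennreal (2 powr a * 2 powr - (a * real j)) * indicator (ball 0 (2 ^ j)) x"
      using ex by (simp add: ennreal_leI)
    also have "\<dots> \<le> (\<Sum>j. ennreal (2 powr a * 2 powr - (a * real j)) * indicator (ball 0 (2 ^ j)) x)"
    proof -
      have "g j \<le> suminf g" for g :: "nat \<Rightarrow> ennreal"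
        using sum_le_suminf[of g "{j}"] by simp
      then show ?thesis .
    qed
    finally show "ennreal (jbracket x powr - a)
        \<le> (\<Sum>j. ennreal (2 powr a * 2 powr - (a * real j)) * indicator (ball 0 (2 ^ j)) x)" .
  qed
  also have "\<dots> = (\<Sum>j. ennreal (2 powr a * 2 powr - (a * real j)) * emeasure lborel (ball (0::'a) (2 ^ j)))"
  proof -
    have "(\<integral>\<^sup>+x. (\<Sum>j. c j * indicator (ball 0 (2 ^ j)) (x::'a)) \<partial>lborel)
        = (\<Sum>j. c j * emeasure lborel (ball (0::'a) (2 ^ j)))" for c :: "nat \<Rightarrow> ennreal"
      by (subst nn_integral_suminf) (measurable, auto simp: nn_integral_cmult_indicator)
    then show ?thesis .
  qed
  also have "\<dots> = (\<Sum>j. ennreal (2 powr a * V * r ^ j))"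
  proof (intro suminf_cong)
    fix j :: nat
    have "2 powr - (a * real j) * (2 ^ j) ^ DIM('a) = r ^ j"
    proof -
      have "(2 ^ j) ^ DIM('a) = 2 powr (real j * real DIM('a))"
        by (simp add: powr_realpow flip: power_mult of_nat_mult)
      moreover have "r ^ j = 2 powr ((real DIM('a) - a) * real j)"
        unfolding r_def by (simp add: powr_powr flip: powr_realpow)
      ultimately show ?thesis
        by (simp add: algebra_simps flip: powr_add)
    qed
    then show "ennreal (2 powr a * 2 powr - (a * real j)) * emeasure lborel (ball (0::'a) (2 ^ j))
        = ennreal (2 powr a * V * r ^ j)"
      using V by (simp add: emeasure_ball V_def[symmetric] ennreal_mult'[symmetric] algebra_simps)
  qed
  also have "\<dots> < \<infinity>"
  proof -
    have "summable (\<lambda>j. 2 powr a * V * r ^ j)"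
      using r by (intro summable_mult summable_geometric) simp
    then have "(\<Sum>j. ennreal (2 powr a * V * r ^ j)) = ennreal (\<Sum>j. 2 powr a * V * r ^ j)"
      using r V by (intro suminf_ennreal2) auto
    then show ?thesis by simp
  qed
  finally show ?thesis .
qed

text \<open>The critical power \<open>a = n\<close> is the decisive case. There every dyadic shell
  \<open>A j\<close> contributes at least \<open>V / 4 ^ n\<close>: its volume is at least
  \<open>V * (2 ^ j) ^ n\<close>, and the bracket is at most \<open>4 * 2 ^ j\<close> on it.\<close>

lemma nn_integral_jbracket_infinite:
  assumes a: "a \<le> real DIM('a)"
  shows "(\<integral>\<^sup>+x. ennreal (jbracket (x::'a::euclidean_space) powr - a) \<partial>lborel) = \<infinity>"
proof -
  define V where "V = unit_ball_vol (real DIM('a))"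
  have V: "V > 0" by (simp add: V_def)
  define n where "n = DIM('a)"
  have n: "n \<ge> 1" by (simp add: n_def Suc_leI)
  define A :: "nat \<Rightarrow> 'a set" where "A j = ball 0 (2 ^ Suc j) - ball 0 (2 ^ j)" for j
  have [measurable]: "A j \<in> sets borel" for j by (simp add: A_def)
  define f :: "'a \<Rightarrow> ennreal" where "f x = ennreal (jbracket x powr - real n)" for x
  have [measurable]: "f \<in> borel_measurable borel" unfolding f_def by measurable
  have disj: "disjoint_family A"
  proof -
    have "A i \<inter> A j = {}" if "i < j" for i j
    proof -
      have "(2::real) ^ Suc i \<le> 2 ^ j" using that by (intro power_increasing) auto
      then show ?thesis by (auto simp: A_def)
    qed
    then show ?thesis unfolding disjoint_family_on_def by (metis Int_commute linorder_neqE_nat)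
  qed
  have lower: "ennreal (V / 4 ^ n) \<le> emeasure (density lborel f) (A j)" for j
  proof -
    have "emeasure lborel (A j) = ennreal (V * (2 ^ Suc j) ^ n) - ennreal (V * (2 ^ j) ^ n)"
      unfolding A_def V_def n_def
      by (subst emeasure_Diff) (auto simp: emeasure_ball intro!: less_le_trans[of _ "2 ^ j" "2 * 2 ^ j"])
    also have "\<dots> = ennreal (V * (2 ^ Suc j) ^ n - V * (2 ^ j) ^ n)"
      using V by (intro ennreal_minus) auto
    finally have mA: "emeasure lborel (A j) = ennreal (V * (2 ^ Suc j) ^ n - V * (2 ^ j) ^ n)" .
    have "(2::real) ^ 1 \<le> 2 ^ n" using n by (intro power_increasing) auto
    then have "2 * (2 ^ j) ^ n \<le> ((2::real) ^ Suc j) ^ n"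
      by (simp add: power_mult_distrib)
    then have "V * (2 * (2 ^ j) ^ n) \<le> V * ((2::real) ^ Suc j) ^ n"
      using V by (intro mult_left_mono) auto
    then have mA2: "ennreal (V * (2 ^ j) ^ n) \<le> emeasure lborel (A j)"
      unfolding mA by (intro ennreal_leI) auto
    have fA: "ennreal (1 / (4 * 2 ^ j) ^ n) \<le> f x" if "x \<in> A j" for x
    proof -
      have "norm x < 2 ^ Suc j" using that by (simp add: A_def)
      moreover have "(1::real) \<le> 2 ^ Suc j" by (rule one_le_power) simp
      ultimately have "jbracket x \<le> 4 * 2 ^ j" using jbracket_le[of x] by simp
      then have "jbracket x ^ n \<le> (4 * 2 ^ j) ^ n" by (intro power_mono) auto
      then have "1 / (4 * 2 ^ j) ^ n \<le> 1 / jbracket x ^ n"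
        by (intro divide_left_mono) auto
      also have "\<dots> = jbracket x powr - real n"
        by (simp add: powr_minus powr_realpow divide_inverse)
      finally show ?thesis unfolding f_def by (intro ennreal_leI)
    qed
    have "ennreal (V / 4 ^ n) = ennreal (1 / (4 * 2 ^ j) ^ n) * ennreal (V * (2 ^ j) ^ n)"
      using V by (simp add: ennreal_mult'[symmetric] power_mult_distrib)
    also have "\<dots> \<le> ennreal (1 / (4 * 2 ^ j) ^ n) * emeasure lborel (A j)"
      by (intro mult_left_mono mA2) auto
    also have "\<dots> = (\<integral>\<^sup>+x. ennreal (1 / (4 * 2 ^ j) ^ n) * indicator (A j) x \<partial>lborel)"
      by (simp add: nn_integral_cmult)
    also have "\<dots> \<le> (\<integral>\<^sup>+x. f x * indicator (A j) x \<partial>lborel)"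
      by (intro nn_integral_mono) (use fA in \<open>auto split: split_indicator\<close>)
    also have "\<dots> = emeasure (density lborel f) (A j)"
      by (simp add: emeasure_density)
    finally show ?thesis .
  qed
  have "(\<Sum>j::nat. ennreal (V / 4 ^ n)) = \<infinity>"
  proof (rule ccontr)
    assume "(\<Sum>j::nat. ennreal (V / 4 ^ n)) \<noteq> \<infinity>"
    then have "summable (\<lambda>j::nat. V / 4 ^ n)"
      using V by (intro summable_suminf_not_top) auto
    then have "(\<lambda>j::nat. V / 4 ^ n) \<longlonglongrightarrow> 0" by (rule summable_LIMSEQ_zero)
    then have "V / 4 ^ n = 0" by (simp add: LIMSEQ_const_iff)
    with V show False by simp
  qed
  then have "\<infinity> \<le> (\<Sum>j. emeasure (density lborel f) (A j))"
    by (metis lower suminf_le summableI)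
  also have "\<dots> = emeasure (density lborel f) (\<Union>j. A j)"
    using disj by (intro suminf_emeasure) auto
  also have "\<dots> \<le> emeasure (density lborel f) UNIV"
    by (intro emeasure_mono) auto
  also have "\<dots> = (\<integral>\<^sup>+x. f x \<partial>lborel)" by (simp add: emeasure_density)
  also have "\<dots> \<le> (\<integral>\<^sup>+x. ennreal (jbracket (x::'a) powr - a) \<partial>lborel)"
    unfolding f_def using a jbracket_ge_1
    by (intro nn_integral_mono ennreal_leI powr_mono) (auto simp: n_def)
  finally show ?thesis by (simp add: top_unique)
qed

lemma integrable_jbracket_powr:
  "a > real DIM('a) \<Longrightarrow> integrable lborel (\<lambda>x::'a::euclidean_space. jbracket x powr - a)"
  using nn_integral_jbracket_finite[of a, where 'a='a]
  by (intro integrableI_nonneg) auto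

lemma integrable_inverse_jbracket:
  assumes "N > DIM('a)"
  shows "integrable lborel (\<lambda>x::'a::euclidean_space. 1 / jbracket x ^ N)"
proof -
  have "(\<lambda>x::'a. 1 / jbracket x ^ N) = (\<lambda>x. jbracket x powr - real N)"
    by (simp add: powr_minus powr_realpow divide_inverse)
  then show ?thesis using integrable_jbracket_powr[of "real N", where 'a='a] assms by simp
qed

section \<open>Closure properties of the Schwartz space\<close>

definition dir_deriv :: "'a::euclidean_space \<Rightarrow> ('a \<Rightarrow> complex) \<Rightarrow> 'a \<Rightarrow> complex" where
  "dir_deriv v f = (\<lambda>x. frechet_derivative f (at x) v)"

definition rapid :: "('a::euclidean_space \<Rightarrow> complex) \<Rightarrow> bool" where
  "rapid f \<longleftrightarrow> (\<forall>N::nat. \<exists>C. \<forall>x. jbracket x ^ N * cmod (f x) \<le> C)"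

lemma dir_deriv_eq:
  "(\<And>x. (f has_derivative f' x) (at x)) \<Longrightarrow> dir_deriv v f = (\<lambda>x. f' x v)"
  unfolding dir_deriv_def using frechet_derivative_at by metis

lemma iter_deriv_append: "iter_deriv (bs @ cs) f = iter_deriv bs (iter_deriv cs f)"
  by (induction bs) auto

lemma schwartz_rapid: "f \<in> schwartz \<Longrightarrow> rapid f"
  unfolding rapid_def schwartz_def bdd_above_def
  by (auto dest!: spec[of _ "[]"])

lemma rapidE:
  assumes "rapid f"
  obtains C where "0 \<le> C" "\<And>x. jbracket x ^ N * cmod (f x) \<le> C"
proof -
  obtain C where C: "\<And>x. jbracket x ^ N * cmod (f x) \<le> C"
    using assms unfolding rapid_def by blast
  have "0 \<le> C" by (rule order_trans[OF _ C[of undefined]]) simp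
  then show thesis using C that by blast
qed

lemma schwartz_has_derivative:
  assumes "f \<in> schwartz"
  shows "(f has_derivative (\<lambda>h. dir_deriv h f x)) (at x)"
proof -
  have "f differentiable (at x)"
    using assms unfolding schwartz_def by (auto dest!: spec[of _ "[]"])
  then show ?thesis unfolding dir_deriv_def frechet_derivative_works by simp
qed

lemma schwartz_iter_deriv:
  assumes "f \<in> schwartz" "set bs \<subseteq> Basis"
  shows "iter_deriv bs f \<in> schwartz"
proof -
  have "iter_deriv cs (iter_deriv bs f) = iter_deriv (cs @ bs) f" for cs
    by (simp add: iter_deriv_append)
  then show ?thesis using assms unfolding schwartz_def
    by (auto simp del: iter_deriv.simps)
qed

lemma schwartz_dir_deriv_Basis:
  "f \<in> schwartz \<Longrightarrow> b \<in> Basis \<Longrightarrow> dir_deriv b f \<in> schwartz"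
  using schwartz_iter_deriv[of f "[b]"] by (simp add: dir_deriv_def)

text \<open>The Schwartz space is the largest class of rapidly decreasing differentiable functions that is
  closed under partial derivatives; this replaces every explicit Leibniz formula below.\<close>

lemma schwartz_coinduct:
  assumes "f \<in> \<C>"
    and diff: "\<And>f x. f \<in> \<C> \<Longrightarrow> f differentiable (at x)"
    and rap: "\<And>f. f \<in> \<C> \<Longrightarrow> rapid f"
    and dir: "\<And>f b. f \<in> \<C> \<Longrightarrow> b \<in> Basis \<Longrightarrow> dir_deriv b f \<in> \<C>"
  shows "f \<in> schwartz"
proof -
  have iter: "iter_deriv bs f \<in> \<C>" if "set bs \<subseteq> Basis" for bs
    using that by (induction bs) (auto simp: assms(1) dir simp flip: dir_deriv_def)
  show ?thesis
    unfolding schwartz_def bdd_above_def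
    using iter diff rap unfolding rapid_def by fastforce
qed

lemma rapid_add:
  assumes "rapid f" "rapid g"
  shows "rapid (\<lambda>x. f x + g x)"
  unfolding rapid_def
proof
  fix N
  obtain C D where C: "\<And>x. jbracket x ^ N * cmod (f x) \<le> C"
    and D: "\<And>x. jbracket x ^ N * cmod (g x) \<le> D"
    using assms unfolding rapid_def by metis
  have "jbracket x ^ N * cmod (f x + g x) \<le> jbracket x ^ N * (cmod (f x) + cmod (g x))" for x
    by (intro mult_left_mono norm_triangle_ineq) auto
  then have "jbracket x ^ N * cmod (f x + g x) \<le> C + D" for x
    using C[of x] D[of x] by (smt (verit) distrib_left)
  then show "\<exists>C. \<forall>x. jbracket x ^ N * cmod (f x + g x) \<le> C" by blast
qed

lemma rapid_bound:
  assumes "rapid f" "\<And>x. cmod (g x) \<le> C * jbracket x ^ K * cmod (f x)"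
  shows "rapid g"
  unfolding rapid_def
proof
  fix N
  obtain D where D: "\<And>x. jbracket x ^ (N + K) * cmod (f x) \<le> D"
    using assms(1) unfolding rapid_def by blast
  have "jbracket x ^ N * cmod (g x) \<le> \<bar>C\<bar> * D" for x
  proof -
    have "jbracket x ^ N * cmod (g x) \<le> jbracket x ^ N * (C * jbracket x ^ K * cmod (f x))"
      by (intro mult_left_mono assms(2)) auto
    also have "\<dots> = C * (jbracket x ^ (N + K) * cmod (f x))"
      by (simp add: power_add)
    also have "\<dots> \<le> \<bar>C\<bar> * (jbracket x ^ (N + K) * cmod (f x))"
      by (intro mult_right_mono) auto
    also have "\<dots> \<le> \<bar>C\<bar> * D" by (intro mult_left_mono D) auto
    finally show ?thesis .
  qed
  then show "\<exists>C. \<forall>x. jbracket x ^ N * cmod (g x) \<le> C" by blast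
qed

section \<open>Linear operations, multipliers, tensor products and affine substitutions\<close>

lemma schwartz_zero: "(\<lambda>x. 0) \<in> schwartz"
proof (rule schwartz_coinduct[of _ "{\<lambda>x. 0}"])
  show "rapid f" if "f \<in> {\<lambda>x. 0}" for f
    using that by (auto simp: rapid_def)
  show "dir_deriv b f \<in> {\<lambda>x. 0}" if "f \<in> {\<lambda>x. 0}" for f :: "'a \<Rightarrow> complex" and b
    using that dir_deriv_eq[of f "\<lambda>x h. 0" b] by auto
qed auto

lemma schwartz_add:
  assumes "f \<in> schwartz" "g \<in> schwartz"
  shows "(\<lambda>x. f x + g x) \<in> schwartz"
proof (rule schwartz_coinduct[of _ "{\<lambda>x. f x + g x |f g. f \<in> schwartz \<and> g \<in> schwartz}"])
  fix h :: "'a \<Rightarrow> complex"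
  assume "h \<in> {\<lambda>x. f x + g x |f g. f \<in> schwartz \<and> g \<in> schwartz}"
  then obtain f g where h: "h = (\<lambda>x. f x + g x)" and S: "f \<in> schwartz" "g \<in> schwartz" by blast
  have D: "(h has_derivative (\<lambda>v. dir_deriv v f x + dir_deriv v g x)) (at x)" for x
    unfolding h by (intro has_derivative_add schwartz_has_derivative S)
  show "h differentiable (at x)" for x using D unfolding differentiable_def by blast
  show "rapid h" unfolding h by (intro rapid_add schwartz_rapid S)
  show "dir_deriv b h \<in> {\<lambda>x. f x + g x |f g. f \<in> schwartz \<and> g \<in> schwartz}" if "b \<in> Basis" for b
    unfolding dir_deriv_eq[OF D] using schwartz_dir_deriv_Basis[OF _ that] S by blast
qed (use assms in blast)

lemma schwartz_cmult:
  assumes "f \<in> schwartz"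
  shows "(\<lambda>x. c * f x) \<in> schwartz"
proof (rule schwartz_coinduct[of _ "{\<lambda>x. c * f x |f. f \<in> schwartz}"])
  fix h :: "'a \<Rightarrow> complex"
  assume "h \<in> {\<lambda>x. c * f x |f. f \<in> schwartz}"
  then obtain f where h: "h = (\<lambda>x. c * f x)" and S: "f \<in> schwartz" by blast
  have D: "(h has_derivative (\<lambda>v. c * dir_deriv v f x)) (at x)" for x
    unfolding h by (intro has_derivative_mult_right schwartz_has_derivative S)
  show "h differentiable (at x)" for x using D unfolding differentiable_def by blast
  show "rapid h" unfolding h
    by (rule rapid_bound[OF schwartz_rapid[OF S], of _ "cmod c" 0]) (simp add: norm_mult)
  show "dir_deriv b h \<in> {\<lambda>x. c * f x |f. f \<in> schwartz}" if "b \<in> Basis" for b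
    unfolding dir_deriv_eq[OF D] using schwartz_dir_deriv_Basis[OF _ that] S by blast
qed (use assms in blast)

lemma schwartz_sum:
  "(\<And>i. i \<in> I \<Longrightarrow> f i \<in> schwartz) \<Longrightarrow> (\<lambda>x. \<Sum>i\<in>I. f i x) \<in> schwartz"
  by (induction I rule: infinite_finite_induct) (auto simp: schwartz_zero schwartz_add)

lemma schwartz_diff:
  assumes "f \<in> schwartz" "g \<in> schwartz"
  shows "(\<lambda>x. f x - g x) \<in> schwartz"
  using schwartz_add[OF assms(1) schwartz_cmult[OF assms(2), of "-1"]] by simp

lemma dir_deriv_linear:
  assumes "f \<in> schwartz"
  shows "linear (\<lambda>h. dir_deriv h f x)"
  using has_derivative_linear[OF schwartz_has_derivative[OF assms]] .

lemma dir_deriv_Basis_sum: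
  assumes "f \<in> schwartz"
  shows "dir_deriv h f x = (\<Sum>b\<in>Basis. of_real (h \<bullet> b) * dir_deriv b f x)"
proof -
  interpret linear "\<lambda>h. dir_deriv h f x" by (rule dir_deriv_linear[OF assms])
  have "dir_deriv h f x = dir_deriv (\<Sum>b\<in>Basis. (h \<bullet> b) *\<^sub>R b) f x"
    by (simp add: euclidean_representation)
  also have "\<dots> = (\<Sum>b\<in>Basis. (h \<bullet> b) *\<^sub>R dir_deriv b f x)"
    by (simp add: sum scaleR)
  finally show ?thesis by (simp add: scaleR_conv_of_real)
qed

lemma schwartz_dir_deriv:
  assumes "f \<in> schwartz"
  shows "dir_deriv v f \<in> schwartz"
proof -
  have "dir_deriv v f = (\<lambda>x. \<Sum>b\<in>Basis. of_real (v \<bullet> b) * dir_deriv b f x)"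
    by (intro ext dir_deriv_Basis_sum assms)
  also have "\<dots> \<in> schwartz"
    by (intro schwartz_sum schwartz_cmult schwartz_dir_deriv_Basis assms)
  finally show ?thesis .
qed

lemma dir_deriv_cmod_le:
  assumes "f \<in> schwartz"
  shows "cmod (dir_deriv h f x) \<le> norm h * (\<Sum>b\<in>Basis. cmod (dir_deriv b f x))"
proof -
  have "cmod (dir_deriv h f x) \<le> (\<Sum>b\<in>Basis. cmod (of_real (h \<bullet> b) * dir_deriv b f x))"
    unfolding dir_deriv_Basis_sum[OF assms, of h] by (rule norm_sum)
  also have "\<dots> \<le> (\<Sum>b\<in>Basis. norm h * cmod (dir_deriv b f x))"
    by (intro sum_mono) (simp add: norm_mult Basis_le_norm mult_right_mono)
  finally show ?thesis by (simp add: sum_distrib_left)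
qed

lemma schwartz_mult_inner:
  assumes "f \<in> schwartz"
  shows "(\<lambda>x. of_real (x \<bullet> w) * f x) \<in> schwartz"
proof -
  \<comment> \<open>The products alone are not closed under differentiation, since the derivative of
    the linear factor leaves a bare Schwartz function. The free summand \<open>g\<close> absorbs it,
    and \<open>g = 0\<close> gives the claim.\<close>
  let ?C = "{\<lambda>x::'a. of_real (x \<bullet> w) * f x + g x |f g. f \<in> schwartz \<and> g \<in> schwartz}"
  have "(\<lambda>x. of_real (x \<bullet> w) * f x + 0) \<in> schwartz"
  proof (rule schwartz_coinduct[of _ ?C])
    fix h :: "'a \<Rightarrow> complex"
    assume "h \<in> ?C"
    then obtain f g where h: "h = (\<lambda>x. of_real (x \<bullet> w) * f x + g x)"
      and S: "f \<in> schwartz" "g \<in> schwartz" by blast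
    have D: "(h has_derivative (\<lambda>v. of_real (x \<bullet> w) * dir_deriv v f x
        + (of_real (v \<bullet> w) * f x + dir_deriv v g x))) (at x)" for x
    proof -
      have "((\<lambda>x. of_real (x \<bullet> w) :: complex) has_derivative (\<lambda>v. of_real (v \<bullet> w))) (at x)"
        by (intro has_derivative_of_real bounded_linear_imp_has_derivative bounded_linear_inner_left)
      from has_derivative_add[OF has_derivative_mult[OF this schwartz_has_derivative[OF S(1)]]
          schwartz_has_derivative[OF S(2)]]
      show ?thesis unfolding h by (simp add: algebra_simps)
    qed
    show "h differentiable (at x)" for x using D unfolding differentiable_def by blast
    have "rapid (\<lambda>x. of_real (x \<bullet> w) * f x)"
    proof (rule rapid_bound[OF schwartz_rapid[OF S(1)], of _ "norm w" 1])
      fix x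
      have "\<bar>x \<bullet> w\<bar> \<le> norm w * jbracket x"
        using Cauchy_Schwarz_ineq2[of x w] norm_le_jbracket[of x]
        by (smt (verit) mult.commute mult_right_mono norm_ge_zero)
      then show "cmod (of_real (x \<bullet> w) * f x) \<le> norm w * jbracket x ^ 1 * cmod (f x)"
        by (simp add: norm_mult mult_right_mono)
    qed
    then show "rapid h" unfolding h by (intro rapid_add schwartz_rapid[OF S(2)])
    show "dir_deriv b h \<in> ?C" if "b \<in> Basis" for b
    proof -
      have "(\<lambda>x. of_real (b \<bullet> w) * f x + dir_deriv b g x) \<in> schwartz"
        by (intro schwartz_add schwartz_cmult schwartz_dir_deriv S)
      then show ?thesis unfolding dir_deriv_eq[OF D] using schwartz_dir_deriv[OF S(1), of b]
        by (intro CollectI exI conjI) (rule refl)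
    qed
  next
    show "(\<lambda>x. of_real (x \<bullet> w) * f x + 0) \<in> ?C"
      by (intro CollectI exI[of _ f] exI[of _ "\<lambda>x. 0"]) (use assms schwartz_zero in auto)
  qed
  then show ?thesis by simp
qed

text \<open>The hypothesis \<open>affine\<close> makes \<open>q\<close> a polynomial of degree at
  most two. Differentiating \<open>cis (q x) * f x\<close> multiplies \<open>f\<close> by an affine
  function, which keeps it Schwartz, so the class of these products is invariant. Modulations and
  chirps are both instances.\<close>

lemma schwartz_mult_phase:
  assumes "f \<in> schwartz"
    and q: "\<And>x. (q has_derivative q' x) (at x)"
    and affine: "\<And>b. b \<in> Basis \<Longrightarrow> \<exists>w c. \<forall>x. q' x b = x \<bullet> w + c"
  shows "(\<lambda>x. cis (q x) * f x) \<in> schwartz"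
proof (rule schwartz_coinduct[of _ "{\<lambda>x. cis (q x) * f x |f. f \<in> schwartz}"])
  fix h :: "'a \<Rightarrow> complex"
  assume "h \<in> {\<lambda>x. cis (q x) * f x |f. f \<in> schwartz}"
  then obtain f where h: "h = (\<lambda>x. cis (q x) * f x)" and S: "f \<in> schwartz" by blast
  have D: "(h has_derivative (\<lambda>v. cis (q x) * (dir_deriv v f x + \<i> * (of_real (q' x v) * f x)))) (at x)" for x
    using has_derivative_mult[OF has_derivative_cis[OF q] schwartz_has_derivative[OF S], of x]
    unfolding h by (simp add: algebra_simps scaleR_conv_of_real)
  show "h differentiable (at x)" for x using D unfolding differentiable_def by blast
  show "rapid h" unfolding h
    by (rule rapid_bound[OF schwartz_rapid[OF S], of _ 1 0]) (simp add: norm_mult)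
  show "dir_deriv b h \<in> {\<lambda>x. cis (q x) * f x |f. f \<in> schwartz}" if b: "b \<in> Basis" for b
  proof -
    obtain w c where wc: "\<And>x. q' x b = x \<bullet> w + c" using affine[OF b] by blast
    define g where "g = (\<lambda>x. dir_deriv b f x + \<i> * (of_real (x \<bullet> w) * f x + of_real c * f x))"
    have "g \<in> schwartz" unfolding g_def
      by (intro schwartz_add schwartz_cmult schwartz_mult_inner schwartz_dir_deriv S)
    moreover have "dir_deriv b h = (\<lambda>x. cis (q x) * g x)"
      unfolding dir_deriv_eq[OF D] wc g_def by (simp add: algebra_simps)
    ultimately show ?thesis by blast
  qed
qed (use assms in blast)

lemma schwartz_modulate:
  assumes "f \<in> schwartz"
  shows "(\<lambda>x. cis (x \<bullet> w) * f x) \<in> schwartz"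
proof (rule schwartz_mult_phase[OF assms])
  show "((\<lambda>x. x \<bullet> w) has_derivative (\<lambda>h. h \<bullet> w)) (at x)" for x :: 'a
    by (auto intro!: derivative_eq_intros)
  show "\<exists>v c. \<forall>x::'a. b \<bullet> w = x \<bullet> v + c" for b
    by (rule exI[of _ 0]) auto
qed

lemma schwartz_tensor:
  assumes "f \<in> schwartz" "g \<in> schwartz"
  shows "(\<lambda>z. f (fst z) * g (snd z)) \<in> schwartz"
proof -
  let ?C = "{\<lambda>z. f (fst z) * g (snd z) |f g. f \<in> schwartz \<and> g \<in> schwartz}
      :: ('a \<times> 'b \<Rightarrow> complex) set"
  show ?thesis
  proof (rule schwartz_coinduct[of _ ?C])
    fix h :: "'a \<times> 'b \<Rightarrow> complex"
    assume "h \<in> ?C"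
    then obtain f g where h: "h = (\<lambda>z. f (fst z) * g (snd z))"
      and S: "f \<in> schwartz" "g \<in> schwartz" by blast
    have D: "(h has_derivative (\<lambda>v. f (fst z) * dir_deriv (snd v) g (snd z)
          + dir_deriv (fst v) f (fst z) * g (snd z))) (at z)" for z
      unfolding h
      by (intro has_derivative_mult has_derivative_compose[OF has_derivative_fst[OF has_derivative_ident]]
          has_derivative_compose[OF has_derivative_snd[OF has_derivative_ident]] schwartz_has_derivative S)
    show "h differentiable (at z)" for z using D unfolding differentiable_def by blast
    show "rapid h"
      unfolding rapid_def
    proof
      fix N
      obtain A where A: "0 \<le> A" "\<And>x. jbracket x ^ N * cmod (f x) \<le> A"
        using rapidE[OF schwartz_rapid[OF S(1)]] by blast
      obtain B where B: "0 \<le> B" "\<And>x. jbracket x ^ N * cmod (g x) \<le> B"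
        using rapidE[OF schwartz_rapid[OF S(2)]] by blast
      have "jbracket z ^ N * cmod (h z) \<le> A * B" for z
      proof -
        have "jbracket z ^ N \<le> (jbracket (fst z) * jbracket (snd z)) ^ N"
          using jbracket_Pair_le[of "fst z" "snd z"] by (intro power_mono) auto
        then have "jbracket z ^ N * cmod (h z)
            \<le> (jbracket (fst z) * jbracket (snd z)) ^ N * cmod (h z)"
          by (intro mult_right_mono) auto
        also have "\<dots> = (jbracket (fst z) ^ N * cmod (f (fst z))) * (jbracket (snd z) ^ N * cmod (g (snd z)))"
          by (simp add: h norm_mult power_mult_distrib)
        also have "\<dots> \<le> A * B" by (intro mult_mono A B) auto
        finally show ?thesis .
      qed
      then show "\<exists>C. \<forall>z. jbracket z ^ N * cmod (h z) \<le> C" by blast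
    qed
    show "dir_deriv b h \<in> ?C" if "b \<in> Basis" for b
    proof -
      \<comment> \<open>A basis vector of the product space moves one factor only; the other
        derivative in the product rule is taken in direction 0 and disappears.\<close>
      have z: "dir_deriv 0 f x = 0" "dir_deriv 0 g y = 0" for x y
        using S linear_0[OF dir_deriv_linear] by blast+
      from that consider i where "b = (i, 0)" | i where "b = (0, i)"
        unfolding Basis_prod_def by auto
      then show ?thesis
      proof cases
        case 1
        have "dir_deriv b h = (\<lambda>z. dir_deriv i f (fst z) * g (snd z))"
          unfolding dir_deriv_eq[OF D] by (simp add: 1 z)
        then show ?thesis using S schwartz_dir_deriv by blast
      next
        case 2
        have "dir_deriv b h = (\<lambda>z. f (fst z) * dir_deriv i g (snd z))"
          unfolding dir_deriv_eq[OF D] by (simp add: 2 z)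
        then show ?thesis using S schwartz_dir_deriv by blast
      qed
    qed
  qed (use assms in blast)
qed

text \<open>An injective linear map is bounded below, so \<open>jbracket x\<close> is controlled by
  \<open>jbracket (L x + a)\<close> and the decay of \<open>f\<close> carries over. The target of
  \<open>L\<close> may be larger than its source: coordinate embeddings give slices, and the
  diagonal embedding gives pointwise products.\<close>

lemma schwartz_compose_affine:
  fixes L :: "'b::euclidean_space \<Rightarrow> 'a::euclidean_space"
  assumes "f \<in> schwartz" and L: "linear L" "inj L"
  shows "(\<lambda>x. f (L x + a)) \<in> schwartz"
proof (rule schwartz_coinduct[of _ "{\<lambda>x. f (L x + a) |f. f \<in> schwartz}"])
  fix h :: "'b \<Rightarrow> complex"
  assume "h \<in> {\<lambda>x. f (L x + a) |f. f \<in> schwartz}"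
  then obtain f where h: "h = (\<lambda>x. f (L x + a))" and S: "f \<in> schwartz" by blast
  have D: "(h has_derivative (\<lambda>v. dir_deriv (L v) f (L x + a))) (at x)" for x
  proof -
    have "((\<lambda>x. L x + a) has_derivative L) (at x)"
      using has_derivative_add[OF linear_imp_has_derivative[OF L(1)] has_derivative_const[of a]] by simp
    from has_derivative_compose[OF this schwartz_has_derivative[OF S]]
    show ?thesis unfolding h .
  qed
  show "h differentiable (at x)" for x using D unfolding differentiable_def by blast
  show "rapid h"
    unfolding rapid_def
  proof
    fix N
    obtain A where A: "0 \<le> A" "\<And>x. jbracket x ^ N * cmod (f x) \<le> A"
      using rapidE[OF schwartz_rapid[OF S]] by blast
    obtain B where B: "B > 0" "\<And>x. B * norm x \<le> norm (L x)"
      using linear_inj_bounded_below_pos[OF L] by blast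
    define K where "K = max 1 (1 / B) * (2 * jbracket (- a))"
    have K: "0 \<le> K" by (simp add: K_def)
    have bd: "jbracket x \<le> K * jbracket (L x + a)" for x
    proof -
      have "norm x \<le> (1 / B) * norm (L x)"
        using B by (simp add: field_simps)
      also have "\<dots> \<le> max 1 (1 / B) * norm (L x)" by (intro mult_right_mono) auto
      finally have "jbracket x \<le> max 1 (1 / B) * jbracket (L x)"
        by (intro jbracket_scale) auto
      also have "\<dots> \<le> max 1 (1 / B) * (2 * jbracket (L x + a) * jbracket (- a))"
        using jbracket_add[of "L x + a" "- a"] by (intro mult_left_mono) auto
      finally show ?thesis by (simp add: K_def algebra_simps)
    qed
    have "jbracket x ^ N * cmod (h x) \<le> K ^ N * A" for x
    proof -
      have "jbracket x ^ N * cmod (h x) \<le> (K * jbracket (L x + a)) ^ N * cmod (h x)"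
        by (intro mult_right_mono power_mono bd) auto
      also have "\<dots> = K ^ N * (jbracket (L x + a) ^ N * cmod (f (L x + a)))"
        by (simp add: h power_mult_distrib)
      also have "\<dots> \<le> K ^ N * A" by (intro mult_left_mono A) (use K in simp)
      finally show ?thesis .
    qed
    then show "\<exists>C. \<forall>x. jbracket x ^ N * cmod (h x) \<le> C" by blast
  qed
  show "dir_deriv b h \<in> {\<lambda>x. f (L x + a) |f. f \<in> schwartz}" if "b \<in> Basis" for b
    unfolding dir_deriv_eq[OF D] using schwartz_dir_deriv[OF S] by blast
qed (use assms in blast)

lemma schwartz_translate:
  "f \<in> schwartz \<Longrightarrow> (\<lambda>x. f (x - a)) \<in> schwartz"
  using schwartz_compose_affine[of f "\<lambda>x. x" "- a"] by (simp add: inj_def linear_iff)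

lemma schwartz_mult:
  assumes "f \<in> schwartz" "g \<in> schwartz"
  shows "(\<lambda>x. f x * g x) \<in> schwartz"
  using schwartz_compose_affine[OF schwartz_tensor[OF assms], of "\<lambda>x. (x, x)" 0]
  by (simp add: inj_def linear_iff)

lemma schwartz_slice_snd:
  assumes "F \<in> schwartz"
  shows "(\<lambda>y. F (x, y)) \<in> schwartz"
  using schwartz_compose_affine[OF assms, of "\<lambda>y. (0, y)" "(x, 0)"]
  by (simp add: inj_def linear_iff)

lemma schwartz_slice_fst:
  assumes "F \<in> schwartz"
  shows "(\<lambda>x. F (x, y)) \<in> schwartz"
  using schwartz_compose_affine[OF assms, of "\<lambda>x. (x, 0)" "(0, y)"]
  by (simp add: inj_def linear_iff)

lemma schwartz_tf_shift:
  "f \<in> schwartz \<Longrightarrow> tf_shift x \<xi> f \<in> schwartz"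
  using schwartz_modulate[OF schwartz_translate, of f "(2 * pi) *\<^sub>R \<xi>" x]
  by (simp add: tf_shift_def mult.assoc)

section \<open>Continuity, measurability and integrability of Schwartz functions\<close>

lemma schwartz_continuous_on:
  assumes "f \<in> schwartz" "continuous_on S g"
  shows "continuous_on S (\<lambda>x. f (g x))"
proof -
  have "continuous_on UNIV f"
    using schwartz_has_derivative[OF assms(1)]
    by (auto simp: continuous_on_eq_continuous_within intro: has_derivative_continuous)
  then show ?thesis using assms(2) continuous_on_compose2 by blast
qed

lemma schwartz_measurable:
  assumes "f \<in> schwartz" shows "f \<in> borel_measurable borel"
  by (intro borel_measurable_continuous_onI schwartz_continuous_on[OF assms] continuous_on_id)

lemma schwartz_bounded:
  assumes "f \<in> schwartz"
  obtains C where "0 \<le> C" "\<And>x. cmod (f x) \<le> C / jbracket x ^ N"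
proof -
  obtain C where "0 \<le> C" "\<And>x. jbracket x ^ N * cmod (f x) \<le> C"
    using rapidE[OF schwartz_rapid[OF assms]] by blast
  then show thesis using that[of C] by (simp add: field_simps)
qed

lemma schwartz_integrable:
  assumes "f \<in> schwartz"
  shows "integrable lborel f"
proof -
  obtain C where C: "0 \<le> C" "\<And>x. cmod (f x) \<le> C / jbracket x ^ Suc DIM('a)"
    using schwartz_bounded[OF assms] by blast
  have "integrable lborel (\<lambda>x::'a. C * (1 / jbracket x ^ Suc DIM('a)))"
    by (intro integrable_mult_right integrable_inverse_jbracket) auto
  then show ?thesis
    by (rule Bochner_Integration.integrable_bound)
       (use schwartz_measurable[OF assms] C in auto)
qed

section \<open>Partial Fourier transforms\<close>

lemma nn_integral_lborel_translate:
  fixes f :: "'a::euclidean_space \<Rightarrow> ennreal"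
  assumes [measurable]: "f \<in> borel_measurable borel"
  shows "(\<integral>\<^sup>+x. f (a + x) \<partial>lborel) = (\<integral>\<^sup>+x. f x \<partial>lborel)"
  by (subst lborel_distr_plus[of a, symmetric], subst nn_integral_distr) simp_all

lemma integral_lborel_translate:
  fixes f :: "'a::euclidean_space \<Rightarrow> 'b::{banach, second_countable_topology}"
  assumes [measurable]: "f \<in> borel_measurable borel"
  shows "(\<integral>x. f (a + x) \<partial>lborel) = (\<integral>x. f x \<partial>lborel)"
  by (subst lborel_distr_plus[of a, symmetric], subst integral_distr) simp_all

lemma integral_lborel_scale:
  fixes f :: "'a::euclidean_space \<Rightarrow> 'b::{banach, second_countable_topology}"
  assumes [measurable]: "f \<in> borel_measurable borel" and c: "c \<noteq> 0"
  shows "(\<integral>x. f x \<partial>lborel) = \<bar>c\<bar> ^ DIM('a) *\<^sub>R (\<integral>x. f (c *\<^sub>R x) \<partial>lborel)"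
proof -
  have "(\<integral>x. f x \<partial>lborel)
      = (\<integral>x. f x \<partial>density (distr lborel borel (\<lambda>x. 0 + c *\<^sub>R x)) (\<lambda>_. \<bar>c\<bar> ^ DIM('a)))"
    using lborel_affine[OF c, where t="0::'a"] by simp
  also have "\<dots> = (\<integral>x. \<bar>c\<bar> ^ DIM('a) *\<^sub>R f (c *\<^sub>R x) \<partial>lborel)"
    by (subst integral_density) (simp_all add: integral_distr)
  finally show ?thesis by simp
qed

text \<open>Domination is asked for near \<open>z0\<close> only, because translates of a decaying
  function have a common integrable majorant only for bounded shifts. The mean value inequality
  turns the bound on the derivatives into one on the increments, so the normalised remainder is
  dominated by \<open>2 * K\<close> and dominated convergence applies along sequences.\<close>

lemma has_derivative_integral_local:
  fixes G :: "'z::euclidean_space \<Rightarrow> 't::euclidean_space \<Rightarrow> complex"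
  assumes int: "\<And>z. integrable lborel (G z)"
    and deriv: "\<And>z t. ((\<lambda>z. G z t) has_derivative D z t) (at z)"
    and meas: "\<And>h. (\<lambda>t. D z0 t h) \<in> borel_measurable borel"
    and bound: "\<And>z t h. z \<in> ball z0 1 \<Longrightarrow> cmod (D z t h) \<le> K t * norm h"
    and K: "integrable lborel K" "\<And>t. 0 \<le> K t"
  shows "((\<lambda>z. \<integral>t. G z t \<partial>lborel) has_derivative (\<lambda>h. \<integral>t. D z0 t h \<partial>lborel)) (at z0)"
proof -
  have z0: "z0 \<in> ball z0 1" by simp
  have Dint: "integrable lborel (\<lambda>t. D z0 t h)" for h
    by (rule Bochner_Integration.integrable_bound[of _ "\<lambda>t. K t * norm h"])
       (use K meas bound[OF z0] in \<open>auto intro!: integrable_mult_left\<close>)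
  have lin: "linear (D z0 t)" for t
    using deriv has_derivative_linear by blast
  have bl: "bounded_linear (\<lambda>h. \<integral>t. D z0 t h \<partial>lborel)"
  proof (rule bounded_linear_intro[where K="\<integral>t. K t \<partial>lborel"])
    show "(\<integral>t. D z0 t (x + y) \<partial>lborel) = (\<integral>t. D z0 t x \<partial>lborel) + (\<integral>t. D z0 t y \<partial>lborel)" for x y
      by (simp add: linear_add[OF lin] Dint)
    show "(\<integral>t. D z0 t (r *\<^sub>R x) \<partial>lborel) = r *\<^sub>R (\<integral>t. D z0 t x \<partial>lborel)" for r x
      by (simp add: linear_scale[OF lin])
    show "cmod (\<integral>t. D z0 t x \<partial>lborel) \<le> norm x * (\<integral>t. K t \<partial>lborel)" for x
    proof -
      have "cmod (\<integral>t. D z0 t x \<partial>lborel) \<le> (\<integral>t. K t * norm x \<partial>lborel)"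
        by (rule Bochner_Integration.integral_norm_bound_integral) (use K Dint bound[OF z0] in \<open>auto intro!: integrable_mult_left\<close>)
      then show ?thesis by (simp add: mult.commute)
    qed
  qed
  have mvt: "cmod (G y t - G z0 t) \<le> K t * norm (y - z0)" if "y \<in> ball z0 1" for y t
  proof (rule differentiable_bound[OF convex_ball, of z0 1 "\<lambda>z. G z t" "\<lambda>z. D z t"])
    show "((\<lambda>z. G z t) has_derivative D z t) (at z within ball z0 1)" for z
      using deriv has_derivative_at_withinI by blast
    show "onorm (D z t) \<le> K t" if "z \<in> ball z0 1" for z
      using bound[OF that] K by (intro onorm_bound) auto
  qed (use that in auto)
  have "((\<lambda>z. \<integral>t. G z t \<partial>lborel) has_derivative (\<lambda>h. \<integral>t. D z0 t h \<partial>lborel)) (at z0 within ball z0 1)"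
    unfolding has_derivative_iff_norm tendsto_at_iff_sequentially o_def
  proof (intro conjI bl allI impI)
    fix X :: "nat \<Rightarrow> 'z" assume X: "\<forall>i. X i \<in> ball z0 1 - {z0}" "X \<longlonglongrightarrow> z0"
    define r where "r i t = G (X i) t - G z0 t - D z0 t (X i - z0)" for i t
    have rint: "integrable lborel (r i)" for i
      unfolding r_def by (intro Bochner_Integration.integrable_diff int Dint)
    have "(\<lambda>i. \<integral>t. cmod (r i t) / norm (X i - z0) \<partial>lborel) \<longlonglongrightarrow> (\<integral>t. 0 \<partial>(lborel::'t measure))"
    proof (rule integral_dominated_convergence[where w="\<lambda>t. 2 * K t"])
      show "AE t in lborel. (\<lambda>i. cmod (r i t) / norm (X i - z0)) \<longlonglongrightarrow> 0"
      proof (intro AE_I2)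
        fix t
        have "((\<lambda>z. G z t) has_derivative D z0 t) (at z0)" by (rule deriv)
        then have "((\<lambda>y. norm ((G y t - G z0 t) - D z0 t (y - z0)) / norm (y - z0)) \<longlongrightarrow> 0) (at z0)"
          unfolding has_derivative_iff_norm by blast
        moreover have "\<forall>i. X i \<in> UNIV - {z0}" using X(1) by auto
        ultimately show "(\<lambda>i. cmod (r i t) / norm (X i - z0)) \<longlonglongrightarrow> 0"
          using X(2) unfolding tendsto_at_iff_sequentially o_def r_def by blast
      qed
      show "AE t in lborel. norm (cmod (r i t) / norm (X i - z0)) \<le> 2 * K t" for i
      proof (intro AE_I2)
        fix t
        have "X i \<noteq> z0" "X i \<in> ball z0 1" using X(1) by auto
        then have "cmod (r i t) \<le> K t * norm (X i - z0) + K t * norm (X i - z0)"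
          unfolding r_def using mvt[of "X i" t] bound[OF z0, of t "X i - z0"]
          by (intro norm_triangle_le_diff) auto
        then show "norm (cmod (r i t) / norm (X i - z0)) \<le> 2 * K t"
          using \<open>X i \<noteq> z0\<close> by (simp add: field_simps)
      qed
      show "(\<lambda>t. cmod (r i t) / norm (X i - z0)) \<in> borel_measurable lborel" for i
        using borel_measurable_integrable[OF rint] by measurable
    qed (use K in auto)
    then have lim: "(\<lambda>i. \<integral>t. cmod (r i t) / norm (X i - z0) \<partial>lborel) \<longlonglongrightarrow> 0" by simp
    have eq: "(\<integral>t. G (X i) t \<partial>lborel) - (\<integral>t. G z0 t \<partial>lborel) - (\<integral>t. D z0 t (X i - z0) \<partial>lborel)
        = (\<integral>t. r i t \<partial>lborel)" for i
      unfolding r_def by (simp add: int Dint)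
    show "(\<lambda>i. norm ((\<integral>t. G (X i) t \<partial>lborel) - (\<integral>t. G z0 t \<partial>lborel) - (\<integral>t. D z0 t (X i - z0) \<partial>lborel))
        / norm (X i - z0)) \<longlonglongrightarrow> 0"
      unfolding eq
    proof (rule tendsto_sandwich[OF _ _ tendsto_const lim])
      show "\<forall>\<^sub>F i in sequentially. cmod (\<integral>t. r i t \<partial>lborel) / norm (X i - z0)
          \<le> (\<integral>t. cmod (r i t) / norm (X i - z0) \<partial>lborel)"
        by (intro always_eventually allI) (simp add: divide_right_mono)
    qed simp
  qed
  moreover have "at z0 within ball z0 1 = at z0" by (rule at_within_open) auto
  ultimately show ?thesis by metis
qed

text \<open>By translation invariance the integral of \<open>f (t - s *\<^sub>R v)\<close> does not
  depend on \<open>s\<close>; its derivative at \<open>s = 0\<close>, computed under the integral,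
  is minus the integral in question. This serves as integration by parts for the Fourier
  transform.\<close>

lemma integral_dir_deriv:
  fixes f :: "'a::euclidean_space \<Rightarrow> complex"
  assumes f: "f \<in> schwartz"
  shows "(\<integral>x. dir_deriv v f x \<partial>lborel) = 0"
proof -
  define M where "M = Suc DIM('a)"
  obtain C where C: "0 \<le> C" "\<And>x. cmod (dir_deriv v f x) \<le> C / jbracket x ^ M"
    using schwartz_bounded[OF schwartz_dir_deriv[OF f]] by blast
  \<comment> \<open>For \<open>|s| < 1\<close> submultiplicativity bounds \<open>jbracket t\<close>
    by \<open>2 * jbracket v * jbracket (t - s *\<^sub>R v)\<close>, so one integrable majorant
    serves all these translates.\<close>
  define K where "K t = C * (2 * jbracket v) ^ M * (1 / jbracket t ^ M)" for t :: 'a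
  have "((\<lambda>s::real. \<integral>t. f (t - s *\<^sub>R v) \<partial>lborel) has_derivative
      (\<lambda>h. \<integral>t. dir_deriv (- h *\<^sub>R v) f (t - 0 *\<^sub>R v) \<partial>lborel)) (at 0)"
  proof (rule has_derivative_integral_local[where K=K])
    show "integrable lborel (\<lambda>t. f (t - s *\<^sub>R v))" for s
      by (intro schwartz_integrable schwartz_translate f)
    show "((\<lambda>s. f (t - s *\<^sub>R v)) has_derivative (\<lambda>h. dir_deriv (- h *\<^sub>R v) f (t - s *\<^sub>R v))) (at s)" for s t
    proof -
      have "((\<lambda>s. t - s *\<^sub>R v) has_derivative (\<lambda>h. - h *\<^sub>R v)) (at s)"
        by (rule has_derivative_eq_rhs[OF has_derivative_diff[OF has_derivative_const
              has_derivative_scaleR_left[OF has_derivative_ident]]]) simp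
      from has_derivative_compose[OF this schwartz_has_derivative[OF f]] show ?thesis .
    qed
    show "(\<lambda>t. dir_deriv (- h *\<^sub>R v) f (t - 0 *\<^sub>R v)) \<in> borel_measurable borel" for h
      using schwartz_measurable[OF schwartz_dir_deriv[OF f]] by simp
    show "cmod (dir_deriv (- h *\<^sub>R v) f (t - s *\<^sub>R v)) \<le> K t * norm h" if "s \<in> ball 0 1" for s t h
    proof -
      have "jbracket t \<le> 2 * jbracket (t - s *\<^sub>R v) * jbracket (s *\<^sub>R v)"
        using jbracket_add[of "t - s *\<^sub>R v" "s *\<^sub>R v"] by simp
      also have "\<dots> \<le> 2 * jbracket (t - s *\<^sub>R v) * jbracket v"
        using that by (intro mult_left_mono jbracket_mono) (auto simp: mult_left_le_one_le)
      finally have "jbracket t ^ M \<le> (2 * jbracket v * jbracket (t - s *\<^sub>R v)) ^ M"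
        by (intro power_mono) (auto simp: algebra_simps)
      then have "1 / jbracket (t - s *\<^sub>R v) ^ M \<le> (2 * jbracket v) ^ M * (1 / jbracket t ^ M)"
        by (simp add: field_simps power_mult_distrib)
      then have "C * (1 / jbracket (t - s *\<^sub>R v) ^ M) \<le> C * ((2 * jbracket v) ^ M * (1 / jbracket t ^ M))"
        using C by (intro mult_left_mono) auto
      then have "cmod (dir_deriv v f (t - s *\<^sub>R v)) \<le> K t"
        using C(2)[of "t - s *\<^sub>R v"] by (simp add: K_def mult.assoc)
      then have "\<bar>h\<bar> * cmod (dir_deriv v f (t - s *\<^sub>R v)) \<le> \<bar>h\<bar> * K t"
        by (intro mult_left_mono) auto
      moreover have "dir_deriv (- h *\<^sub>R v) f (t - s *\<^sub>R v) = - h *\<^sub>R dir_deriv v f (t - s *\<^sub>R v)"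
        by (rule linear_scale[OF dir_deriv_linear[OF f]])
      ultimately show ?thesis by (simp add: norm_mult mult.commute)
    qed
    show "integrable lborel K" unfolding K_def M_def
      by (intro integrable_mult_right integrable_inverse_jbracket) auto
    show "0 \<le> K t" for t unfolding K_def using C by simp
  qed
  moreover have "(\<lambda>s::real. \<integral>t. f (t - s *\<^sub>R v) \<partial>lborel) = (\<lambda>s. \<integral>t. f t \<partial>lborel)"
    using integral_lborel_translate[OF schwartz_measurable[OF f], of "- (s *\<^sub>R v)" for s] by simp
  ultimately have "((\<lambda>s::real. \<integral>t. f t \<partial>lborel) has_derivative
      (\<lambda>h. \<integral>t. dir_deriv (- h *\<^sub>R v) f t \<partial>lborel)) (at 0)" by simp
  from has_derivative_unique[OF this has_derivative_const]
  have "(\<integral>t. dir_deriv (- (-1) *\<^sub>R v) f t \<partial>lborel) = 0" by (rule fun_cong)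
  then show ?thesis by simp
qed

text \<open>The Fourier transform in the second variable, with the first as a parameter. Fourier
  transforms, short-time Fourier transforms, \<tau>-Wigner distributions and marginals are all read
  off from it, so that invariance of the Schwartz space is proved once.\<close>

definition pft :: "('b::euclidean_space \<times> 'a::euclidean_space \<Rightarrow> complex) \<Rightarrow> 'b \<times> 'a \<Rightarrow> complex" where
  "pft F = (\<lambda>z. \<integral>t. F (fst z, t) * cis (- 2 * pi * (snd z \<bullet> t)) \<partial>lborel)"

lemma schwartz_bounded_snd:
  assumes "F \<in> schwartz"
  obtains C where "0 \<le> C" "\<And>x t. cmod (F (x, t)) \<le> C / jbracket t ^ N"
proof -
  obtain C where C: "0 \<le> C" "\<And>z. cmod (F z) \<le> C / jbracket z ^ N"
    using schwartz_bounded[OF assms] by blast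
  have "C / jbracket (x, t) ^ N \<le> C / jbracket t ^ N" for x :: 'a and t :: 'b
    using C jbracket_snd_le[of "(x, t)"]
    by (intro divide_left_mono power_mono mult_pos_pos) auto
  with C show thesis using that by (meson order_trans)
qed

lemma schwartz_slice_modulated:
  fixes F :: "'b::euclidean_space \<times> 'a::euclidean_space \<Rightarrow> complex"
  assumes "F \<in> schwartz"
  shows "(\<lambda>t. F (x, t) * cis (- 2 * pi * (\<xi> \<bullet> t))) \<in> schwartz"
  using schwartz_modulate[OF schwartz_slice_snd[OF assms], of "(- 2 * pi) *\<^sub>R \<xi>" x]
  by (simp add: mult.commute inner_commute)

lemma pft_bounded:
  fixes F :: "'b::euclidean_space \<times> 'a::euclidean_space \<Rightarrow> complex"
  assumes "F \<in> schwartz"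
  shows "\<exists>C. \<forall>z. cmod (pft F z) \<le> C"
proof -
  obtain C where C: "0 \<le> C" "\<And>x t. cmod (F (x, t)) \<le> C / jbracket t ^ Suc DIM('a)"
    using schwartz_bounded_snd[OF assms] by blast
  have "cmod (pft F z) \<le> (\<integral>t. C * (1 / jbracket t ^ Suc DIM('a)) \<partial>(lborel :: 'a measure))" for z
    unfolding pft_def
  proof (rule Bochner_Integration.integral_norm_bound_integral)
    show "integrable lborel (\<lambda>t. F (fst z, t) * cis (- 2 * pi * (snd z \<bullet> t)))"
      by (intro schwartz_integrable schwartz_slice_modulated assms)
    show "integrable lborel (\<lambda>t::'a. C * (1 / jbracket t ^ Suc DIM('a)))"
      by (intro integrable_mult_right integrable_inverse_jbracket) auto
    show "cmod (F (fst z, t) * cis (- 2 * pi * (snd z \<bullet> t))) \<le> C * (1 / jbracket t ^ Suc DIM('a))" for t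
      using C by (simp add: norm_mult del: power_Suc)
  qed
  then show ?thesis by blast
qed

lemma pft_cmult: "pft (\<lambda>z. c * F z) z = c * pft F z"
  unfolding pft_def by (simp add: mult.assoc)

text \<open>A derivative in the parameter passes under the integral, while a derivative in the
  frequency brings down \<open>- 2 * pi * \<i>\<close> times the integration variable. The sum is
  again \<open>pft\<close> of a Schwartz function, which closes the range of \<open>pft\<close>
  under derivatives.\<close>

lemma pft_has_derivative:
  fixes F :: "'b::euclidean_space \<times> 'a::euclidean_space \<Rightarrow> complex"
  assumes F: "F \<in> schwartz"
  shows "(pft F has_derivative
    (\<lambda>h. pft (\<lambda>z. dir_deriv (fst h, 0) F z + (- 2 * pi * \<i>) * (of_real (z \<bullet> (0, snd h)) * F z)) z)) (at z)"
proof -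
  define M where "M = Suc DIM('a)"
  define H where "H h = (\<lambda>z. dir_deriv (fst h, 0) F z + (- 2 * pi * \<i>) * (of_real (z \<bullet> (0, snd h)) * F z))"
    for h :: "'b \<times> 'a"
  have HS: "H h \<in> schwartz" for h
    unfolding H_def by (intro schwartz_add schwartz_cmult schwartz_mult_inner schwartz_dir_deriv F)
  have "\<exists>C. 0 \<le> C \<and> (\<forall>x t. cmod (dir_deriv b F (x, t)) \<le> C / jbracket t ^ M)" for b
    using schwartz_bounded_snd[OF schwartz_dir_deriv[OF F]] by metis
  then obtain c where c: "\<And>b. 0 \<le> c b" "\<And>b x t. cmod (dir_deriv b F (x, t)) \<le> c b / jbracket t ^ M"
    by metis
  \<comment> \<open>One power of decay beyond the integrable order \<open>M\<close> compensates the
    factor \<open>t \<bullet> snd h\<close> of the frequency derivative.\<close>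
  obtain C where C: "0 \<le> C" "\<And>x t. cmod (F (x, t)) \<le> C / jbracket t ^ Suc M"
    using schwartz_bounded_snd[OF F] by blast
  define K where "K t = (sum c Basis + 2 * pi * C) * (1 / jbracket t ^ M)" for t :: 'a
  have HK: "cmod (H h (x, t)) \<le> K t * norm h" for h x t
  proof -
    have "cmod (dir_deriv (fst h, 0) F (x, t)) \<le> norm (fst h, 0::'a) * (\<Sum>b\<in>Basis. cmod (dir_deriv b F (x, t)))"
      by (rule dir_deriv_cmod_le[OF F])
    also have "\<dots> \<le> norm h * (\<Sum>b\<in>Basis. c b / jbracket t ^ M)"
      using norm_fst_le[of "fst h" "snd h"] by (intro mult_mono sum_mono c sum_nonneg) auto
    finally have 1: "cmod (dir_deriv (fst h, 0) F (x, t)) \<le> norm h * (sum c Basis / jbracket t ^ M)"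
      by (simp add: sum_divide_distrib)
    have "\<bar>t \<bullet> snd h\<bar> \<le> jbracket t * norm h"
    proof -
      have "\<bar>t \<bullet> snd h\<bar> \<le> norm t * norm (snd h)" by (rule Cauchy_Schwarz_ineq2)
      also have "\<dots> \<le> jbracket t * norm h"
        using norm_snd_le[of "snd h" "fst h"] norm_le_jbracket by (intro mult_mono) auto
      finally show ?thesis .
    qed
    then have "\<bar>t \<bullet> snd h\<bar> * cmod (F (x, t)) \<le> (jbracket t * norm h) * (C / jbracket t ^ Suc M)"
      by (intro mult_mono C) auto
    then have 2: "2 * pi * (\<bar>t \<bullet> snd h\<bar> * cmod (F (x, t))) \<le> 2 * pi * (norm h * (C / jbracket t ^ M))"
      by (intro mult_left_mono) (auto simp: field_simps)
    have "cmod (H h (x, t)) \<le> cmod (dir_deriv (fst h, 0) F (x, t)) + 2 * pi * (\<bar>t \<bullet> snd h\<bar> * cmod (F (x, t)))"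
      unfolding H_def by (rule order_trans[OF norm_triangle_ineq]) (simp add: norm_mult)
    also have "\<dots> \<le> norm h * (sum c Basis / jbracket t ^ M) + 2 * pi * (norm h * (C / jbracket t ^ M))"
      using 1 2 by linarith
    also have "\<dots> = K t * norm h" by (simp add: K_def field_simps)
    finally show ?thesis .
  qed
  have "((\<lambda>z. \<integral>t. F (fst z, t) * cis (- 2 * pi * (snd z \<bullet> t)) \<partial>lborel) has_derivative
      (\<lambda>h. \<integral>t. H h (fst z, t) * cis (- 2 * pi * (snd z \<bullet> t)) \<partial>lborel)) (at z)"
  proof (rule has_derivative_integral_local[where K=K])
    show "integrable lborel (\<lambda>t. F (fst z, t) * cis (- 2 * pi * (snd z \<bullet> t)))" for z :: "'b \<times> 'a"
      by (intro schwartz_integrable schwartz_slice_modulated F)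
    show "((\<lambda>z. F (fst z, t) * cis (- 2 * pi * (snd z \<bullet> t))) has_derivative
        (\<lambda>h. H h (fst z, t) * cis (- 2 * pi * (snd z \<bullet> t)))) (at z)" for z :: "'b \<times> 'a" and t
    proof -
      have 1: "((\<lambda>z. F (fst z, t)) has_derivative (\<lambda>h. dir_deriv (fst h, 0) F (fst z, t))) (at z)"
        by (rule has_derivative_compose[OF _ schwartz_has_derivative[OF F]])
           (auto intro!: derivative_eq_intros)
      have 2: "((\<lambda>z::'b \<times> 'a. cis (- 2 * pi * (snd z \<bullet> t))) has_derivative
          (\<lambda>h. (- 2 * pi * (snd h \<bullet> t)) *\<^sub>R (\<i> * cis (- 2 * pi * (snd z \<bullet> t))))) (at z)"
        by (rule has_derivative_cis) (auto intro!: derivative_eq_intros)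
      show ?thesis
        using has_derivative_mult[OF 1 2]
        by (rule has_derivative_eq_rhs) (auto simp: H_def algebra_simps scaleR_conv_of_real inner_commute)
    qed
    show "(\<lambda>t. H h (fst z, t) * cis (- 2 * pi * (snd z \<bullet> t))) \<in> borel_measurable borel" for h
      by (intro schwartz_measurable schwartz_slice_modulated HS)
    show "cmod (H h (fst z, t) * cis (- 2 * pi * (snd z \<bullet> t))) \<le> K t * norm h" for z :: "'b \<times> 'a" and t h
      using HK by (simp add: norm_mult)
    show "integrable lborel K" unfolding K_def M_def
      by (intro integrable_mult_right integrable_inverse_jbracket) auto
    show "0 \<le> K t" for t unfolding K_def using C c by (intro mult_nonneg_nonneg add_nonneg_nonneg sum_nonneg) auto
  qed
  then show ?thesis unfolding pft_def H_def .
qed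

text \<open>The bracket is at most 1 plus the sum of the moduli of the coordinates, so each further
  power of it costs one multiplication by a coordinate, which stays inside the class. Decay is thus
  obtained from bare boundedness.\<close>

lemma rapidI_bounded:
  assumes "f \<in> \<C>"
    and bdd: "\<And>f. f \<in> \<C> \<Longrightarrow> \<exists>C. \<forall>x. cmod (f x) \<le> C"
    and mult: "\<And>f b. f \<in> \<C> \<Longrightarrow> b \<in> Basis \<Longrightarrow> (\<lambda>x. of_real (x \<bullet> b) * f x) \<in> \<C>"
  shows "rapid f"
proof -
  have "\<exists>C. \<forall>x. jbracket x ^ N * cmod (f x) \<le> C" if "f \<in> \<C>" for N f
    using that
  proof (induction N arbitrary: f)
    case 0
    then show ?case using bdd by simp
  next
    case (Suc N)
    obtain A where A: "\<And>x. jbracket x ^ N * cmod (f x) \<le> A" using Suc by blast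
    have "\<forall>b\<in>Basis. \<exists>B. \<forall>x. jbracket x ^ N * cmod (of_real (x \<bullet> b) * f x) \<le> B"
      using Suc mult by blast
    then obtain B where B: "\<And>b x. b \<in> Basis \<Longrightarrow> jbracket x ^ N * cmod (of_real (x \<bullet> b) * f x) \<le> B b"
      by metis
    have "jbracket x ^ Suc N * cmod (f x) \<le> A + sum B Basis" for x
    proof -
      have "jbracket x \<le> 1 + (\<Sum>b\<in>Basis. \<bar>x \<bullet> b\<bar>)"
        using jbracket_le[of x] norm_le_l1[of x] by linarith
      then have "jbracket x * (jbracket x ^ N * cmod (f x))
          \<le> (1 + (\<Sum>b\<in>Basis. \<bar>x \<bullet> b\<bar>)) * (jbracket x ^ N * cmod (f x))"
        by (intro mult_right_mono) auto
      also have "\<dots> = jbracket x ^ N * cmod (f x)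
          + (\<Sum>b\<in>Basis. jbracket x ^ N * cmod (of_real (x \<bullet> b) * f x))"
        by (simp add: distrib_right sum_distrib_left sum_distrib_right norm_mult algebra_simps)
      also have "\<dots> \<le> A + sum B Basis"
        by (intro add_mono sum_mono A B)
      finally show ?thesis by (simp add: mult.assoc)
    qed
    then show ?case by blast
  qed
  then show ?thesis using assms(1) unfolding rapid_def by blast
qed

text \<open>The invariant class is the range of \<open>pft\<close>. A parameter coordinate can be
  moved inside the integral. A frequency coordinate becomes a derivative of \<open>F\<close> in the
  integration variable, divided by \<open>2 * pi * \<i>\<close>, because the integral of the full
  derivative \<open>dir_deriv i g\<close> vanishes.\<close>

lemma pft_schwartz:
  fixes F :: "'b::euclidean_space \<times> 'a::euclidean_space \<Rightarrow> complex"
  assumes "F \<in> schwartz"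
  shows "pft F \<in> schwartz"
proof (rule schwartz_coinduct[of _ "{pft F |F. F \<in> schwartz}"])
  have multS: "(\<lambda>z. of_real (z \<bullet> b) * f z) \<in> {pft F |F. F \<in> schwartz}"
    if b: "b \<in> Basis" and f: "f \<in> {pft F |F. F \<in> schwartz}" for b :: "'b \<times> 'a" and f
  proof -
    obtain F where F: "F \<in> schwartz" "f = pft F" using f by blast
    from b consider i where "b = (i, 0)" | i where "b = (0, i)"
      unfolding Basis_prod_def by auto
    then show ?thesis
    proof cases
      case 1
      have "of_real (z \<bullet> b) * f z = pft (\<lambda>z. of_real (z \<bullet> b) * F z) z" for z
        by (simp add: 1 F pft_def inner_prod_def mult.assoc)
      then show ?thesis using schwartz_mult_inner[OF F(1), of b] by blast
    next
      case 2
      have "of_real (z \<bullet> b) * f z = pft (\<lambda>z. (1 / (2 * pi * \<i>)) * dir_deriv (0, i) F z) z" for z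
      proof -
        obtain x \<xi> where z: "z = (x, \<xi>)" by fastforce
        define g where "g = (\<lambda>t. F (x, t) * cis (- 2 * pi * (\<xi> \<bullet> t)))"
        have D: "(g has_derivative (\<lambda>h. dir_deriv (0, h) F (x, t) * cis (- 2 * pi * (\<xi> \<bullet> t))
            - 2 * pi * \<i> * of_real (\<xi> \<bullet> h) * g t)) (at t)" for t
        proof -
          have 1: "((\<lambda>t. F (x, t)) has_derivative (\<lambda>h. dir_deriv (0, h) F (x, t))) (at t)"
            by (rule has_derivative_compose[OF _ schwartz_has_derivative[OF F(1)]])
               (auto intro!: derivative_eq_intros)
          have 2: "((\<lambda>t. cis (- 2 * pi * (\<xi> \<bullet> t))) has_derivative
              (\<lambda>h. (- 2 * pi * (\<xi> \<bullet> h)) *\<^sub>R (\<i> * cis (- 2 * pi * (\<xi> \<bullet> t))))) (at t)"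
            by (rule has_derivative_cis) (auto intro!: derivative_eq_intros)
          show ?thesis unfolding g_def
            by (rule has_derivative_eq_rhs[OF has_derivative_mult[OF 1 2]])
               (auto simp: algebra_simps scaleR_conv_of_real)
        qed
        have gS: "g \<in> schwartz" unfolding g_def by (rule schwartz_slice_modulated[OF F(1)])
        have dS: "(\<lambda>t. dir_deriv (0, i) F (x, t) * cis (- 2 * pi * (\<xi> \<bullet> t))) \<in> schwartz"
          by (rule schwartz_slice_modulated[OF schwartz_dir_deriv[OF F(1)]])
        have "0 = (\<integral>t. dir_deriv i g t \<partial>lborel)" by (simp add: integral_dir_deriv[OF gS])
        also have "\<dots> = (\<integral>t. dir_deriv (0, i) F (x, t) * cis (- 2 * pi * (\<xi> \<bullet> t))
            - 2 * pi * \<i> * of_real (\<xi> \<bullet> i) * g t \<partial>lborel)"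
          unfolding dir_deriv_eq[OF D] ..
        also have "\<dots> = pft (dir_deriv (0, i) F) z - 2 * pi * \<i> * of_real (\<xi> \<bullet> i) * f z"
          by (subst Bochner_Integration.integral_diff)
             (use dS gS in \<open>auto intro!: schwartz_integrable integrable_mult_right simp: pft_def z F g_def\<close>)
        finally show ?thesis unfolding pft_cmult by (simp add: z 2 field_simps)
      qed
      then show ?thesis using schwartz_cmult[OF schwartz_dir_deriv[OF F(1)]] by blast
    qed
  qed
  fix f :: "'b \<times> 'a \<Rightarrow> complex"
  assume f: "f \<in> {pft F |F. F \<in> schwartz}"
  then obtain F where F: "F \<in> schwartz" "f = pft F" by blast
  show "f differentiable (at x)" for x
    using pft_has_derivative[OF F(1)] unfolding F(2) differentiable_def by blast
  show "rapid f"
    by (rule rapidI_bounded[OF f]) (use pft_bounded multS in auto)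
  show "dir_deriv b f \<in> {pft F |F. F \<in> schwartz}" for b
  proof -
    have "(\<lambda>z. dir_deriv (fst b, 0) F z + (- 2 * pi * \<i>) * (of_real (z \<bullet> (0, snd b)) * F z)) \<in> schwartz"
      by (intro schwartz_add schwartz_cmult schwartz_mult_inner schwartz_dir_deriv F)
    then show ?thesis unfolding F(2) dir_deriv_eq[OF pft_has_derivative[OF F(1)]] by blast
  qed
qed (use assms in blast)

section \<open>Fourier inversion and the reproducing formula\<close>

lemma schwartz_nonzero_integral:
  fixes f :: "'a::euclidean_space \<Rightarrow> complex"
  assumes f: "f \<in> schwartz" "f \<noteq> (\<lambda>x. 0)"
  shows "0 < (\<integral>x. (cmod (f x))\<^sup>2 \<partial>lborel)"
    and "(\<integral>x. f x * cnj (f x) \<partial>lborel) = of_real (\<integral>x. (cmod (f x))\<^sup>2 \<partial>lborel)"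
proof -
  have "integrable lborel (\<lambda>x. f x * cnj (f x))"
    by (intro schwartz_integrable schwartz_mult schwartz_cnj f)
  then have "integrable lborel (\<lambda>x. of_real ((cmod (f x))\<^sup>2) :: complex)"
    by (simp only: complex_norm_square)
  then have int: "integrable lborel (\<lambda>x. (cmod (f x))\<^sup>2)"
    unfolding complex_of_real_integrable_eq .
  show eq: "(\<integral>x. f x * cnj (f x) \<partial>lborel) = of_real (\<integral>x. (cmod (f x))\<^sup>2 \<partial>lborel)"
    unfolding complex_norm_square[symmetric] by (rule integral_complex_of_real)
  have "(\<integral>x. (cmod (f x))\<^sup>2 \<partial>lborel) \<noteq> 0"
  proof
    assume "(\<integral>x. (cmod (f x))\<^sup>2 \<partial>lborel) = 0"
    then have "AE x in lborel. (cmod (f x))\<^sup>2 = 0"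
      using int by (subst (asm) integral_nonneg_eq_0_iff_AE) auto
    then have ae: "AE x in lborel. f x = 0" by simp
    have op: "open {x. f x \<noteq> 0}"
      by (intro open_Collect_neq schwartz_continuous_on[OF f(1)] continuous_intros)
    have "{x. f x \<noteq> 0} \<in> null_sets lborel"
      using ae op by (subst (asm) AE_iff_null) auto
    then have "negligible {x. f x \<noteq> 0}"
      by (simp add: negligible_iff_null_sets null_sets_completionI)
    with op have "{x. f x \<noteq> 0} = {}" using open_not_negligible by blast
    with f(2) show False by auto
  qed
  then show "0 < (\<integral>x. (cmod (f x))\<^sup>2 \<partial>lborel)"
    by (simp add: order_less_le)
qed

lemma schwartz_Fubini:
  fixes F :: "'a::euclidean_space \<times> 'b::euclidean_space \<Rightarrow> complex"
  assumes "F \<in> schwartz"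
  shows "(\<integral>z. F z \<partial>lborel) = (\<integral>x. (\<integral>y. F (x, y) \<partial>lborel) \<partial>lborel)"
    and "(\<integral>y. (\<integral>x. F (x, y) \<partial>lborel) \<partial>lborel) = (\<integral>x. (\<integral>y. F (x, y) \<partial>lborel) \<partial>lborel)"
proof -
  have int: "integrable (lborel \<Otimes>\<^sub>M lborel) F"
    using schwartz_integrable[OF assms] by (simp add: lborel_prod)
  show "(\<integral>z. F z \<partial>lborel) = (\<integral>x. (\<integral>y. F (x, y) \<partial>lborel) \<partial>lborel)"
    using lborel_pair.integral_fst'[OF int] by (simp add: lborel_prod)
  show "(\<integral>y. (\<integral>x. F (x, y) \<partial>lborel) \<partial>lborel) = (\<integral>x. (\<integral>y. F (x, y) \<partial>lborel) \<partial>lborel)"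
    using lborel_pair.Fubini_integral[of "\<lambda>x y. F (x, y)"] int by simp
qed

lemma schwartz_chirp:
  fixes F :: "'a::euclidean_space \<times> 'a \<Rightarrow> complex"
  assumes "F \<in> schwartz"
  shows "(\<lambda>z. cis (c * (fst z \<bullet> snd z)) * F z) \<in> schwartz"
proof (rule schwartz_mult_phase[OF assms])
  show "((\<lambda>z::'a \<times> 'a. c * (fst z \<bullet> snd z)) has_derivative
      (\<lambda>h. c * (fst z \<bullet> snd h + fst h \<bullet> snd z))) (at z)" for z
    by (intro has_derivative_mult_right has_derivative_inner has_derivative_fst has_derivative_snd
        has_derivative_ident)
  show "\<exists>w d. \<forall>z. c * (fst z \<bullet> snd b + fst b \<bullet> snd z) = z \<bullet> w + d" for b :: "'a \<times> 'a"
    by (rule exI[of _ "(c *\<^sub>R snd b, c *\<^sub>R fst b)"], rule exI[of _ 0])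
       (simp add: inner_prod_def inner_commute algebra_simps)
qed

definition fourier :: "('a::euclidean_space \<Rightarrow> complex) \<Rightarrow> 'a \<Rightarrow> complex" where
  "fourier f = (\<lambda>\<xi>. \<integral>t. f t * cis (- 2 * pi * (\<xi> \<bullet> t)) \<partial>lborel)"

text \<open>Obtained from the partial transform of the tensor product of \<open>f\<close> with
  itself, by freezing the parameter at a point where \<open>f\<close> does not vanish and dividing
  by that value.\<close>

lemma fourier_schwartz:
  assumes "f \<in> schwartz"
  shows "fourier f \<in> schwartz"
proof (cases "f = (\<lambda>x. 0)")
  case True
  then show ?thesis using schwartz_zero by (simp add: fourier_def)
next
  case False
  then obtain x where x: "f x \<noteq> 0" by auto
  have "(\<lambda>y. pft (\<lambda>z. f (fst z) * f (snd z)) (x, y)) \<in> schwartz"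
    by (intro schwartz_slice_snd pft_schwartz schwartz_tensor assms)
  from schwartz_cmult[OF this, of "1 / f x"] show ?thesis
    using x by (simp add: pft_def fourier_def mult.assoc)
qed

lemma fourier_mult_formula:
  assumes f: "f \<in> schwartz" and g: "g \<in> schwartz"
  shows "(\<integral>z. fourier f z * g z \<partial>lborel) = (\<integral>y. f y * fourier g y \<partial>lborel)"
proof -
  define F where "F = (\<lambda>z. cis (- 2 * pi * (fst z \<bullet> snd z)) * (g (fst z) * f (snd z)))"
  have F: "F \<in> schwartz" unfolding F_def by (intro schwartz_chirp schwartz_tensor f g)
  have "(\<integral>z. fourier f z * g z \<partial>lborel) = (\<integral>z. (\<integral>y. F (z, y) \<partial>lborel) \<partial>lborel)"
  proof (intro Bochner_Integration.integral_cong refl)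
    fix z
    have "F (z, y) = f y * cis (- 2 * pi * (z \<bullet> y)) * g z" for y by (simp add: F_def)
    then show "fourier f z * g z = (\<integral>y. F (z, y) \<partial>lborel)" by (simp add: fourier_def)
  qed
  also have "\<dots> = (\<integral>y. (\<integral>z. F (z, y) \<partial>lborel) \<partial>lborel)"
    by (rule schwartz_Fubini(2)[OF F, symmetric])
  also have "\<dots> = (\<integral>y. f y * fourier g y \<partial>lborel)"
  proof (intro Bochner_Integration.integral_cong refl)
    fix y
    have "F (z, y) = f y * (g z * cis (- 2 * pi * (y \<bullet> z)))" for z by (simp add: F_def inner_commute)
    then show "(\<integral>z. F (z, y) \<partial>lborel) = f y * fourier g y" by (simp add: fourier_def)
  qed
  finally show ?thesis .
qed

lemma schwartz_scale:
  "f \<in> schwartz \<Longrightarrow> c \<noteq> 0 \<Longrightarrow> (\<lambda>x. f (c *\<^sub>R x)) \<in> schwartz"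
  using schwartz_compose_affine[of f "\<lambda>x. c *\<^sub>R x" 0] by (simp add: inj_def linear_iff algebra_simps)

text \<open>Evaluate \<open>\<integral> fourier h z * \<Theta> (\<epsilon> z) dz\<close> by the multiplication formula and let \<open>\<epsilon>\<close> tend to zero:
  any Schwartz function can play the role that Gaussians have in the usual proof of Fourier
  inversion, at the price of an undetermined constant.\<close>

lemma fourier_inversion_at_0:
  fixes h \<Theta> :: "'a::euclidean_space \<Rightarrow> complex"
  assumes h: "h \<in> schwartz" and \<Theta>: "\<Theta> \<in> schwartz"
  shows "\<Theta> 0 * (\<integral>z. fourier h z \<partial>lborel) = h 0 * (\<integral>y. fourier \<Theta> y \<partial>lborel)"
proof -
  define \<epsilon> where "\<epsilon> k = inverse (real (Suc k))" for k
  have \<epsilon>: "\<epsilon> k > 0" for k by (simp add: \<epsilon>_def)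
  have \<epsilon>0: "\<epsilon> \<longlonglongrightarrow> 0" unfolding \<epsilon>_def by (rule LIMSEQ_inverse_real_of_nat)
  have eq: "(\<integral>z. fourier h z * \<Theta> (\<epsilon> k *\<^sub>R z) \<partial>lborel) = (\<integral>y. h (\<epsilon> k *\<^sub>R y) * fourier \<Theta> y \<partial>lborel)" for k
  proof -
    define hk where "hk = (\<lambda>y. h (\<epsilon> k *\<^sub>R y))"
    have hk: "hk \<in> schwartz" unfolding hk_def using h \<epsilon>[of k] by (intro schwartz_scale) auto
    \<comment> \<open>Rescaling the Fourier integral moves the dilation from \<open>\<Theta>\<close>
      to \<open>h\<close>; the power of \<open>\<epsilon> k\<close> disappears when the outer
      integral is rescaled as well.\<close>
    have 1: "fourier h z = \<epsilon> k ^ DIM('a) *\<^sub>R fourier hk (\<epsilon> k *\<^sub>R z)" for z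
    proof -
      have "(\<lambda>t. h t * cis (- 2 * pi * (z \<bullet> t))) \<in> schwartz"
        using schwartz_modulate[OF h, of "(- 2 * pi) *\<^sub>R z"] by (simp add: inner_commute mult.commute)
      from integral_lborel_scale[OF schwartz_measurable[OF this], of "\<epsilon> k"] \<epsilon>[of k]
      show ?thesis unfolding fourier_def hk_def by simp
    qed
    have P: "(\<lambda>w. fourier hk w * \<Theta> w) \<in> schwartz"
      by (intro schwartz_mult fourier_schwartz hk \<Theta>)
    have "(\<integral>z. fourier h z * \<Theta> (\<epsilon> k *\<^sub>R z) \<partial>lborel)
        = \<epsilon> k ^ DIM('a) *\<^sub>R (\<integral>z. fourier hk (\<epsilon> k *\<^sub>R z) * \<Theta> (\<epsilon> k *\<^sub>R z) \<partial>lborel)"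
      unfolding 1 by simp
    also have "\<dots> = (\<integral>w. fourier hk w * \<Theta> w \<partial>lborel)"
      using integral_lborel_scale[OF schwartz_measurable[OF P], of "\<epsilon> k"] \<epsilon>[of k] by simp
    also have "\<dots> = (\<integral>y. hk y * fourier \<Theta> y \<partial>lborel)"
      by (rule fourier_mult_formula[OF hk \<Theta>])
    finally show ?thesis unfolding hk_def .
  qed
  have lim: "(\<lambda>k. \<integral>z. f z * g (\<epsilon> k *\<^sub>R z) \<partial>lborel) \<longlonglongrightarrow> (\<integral>z. f z * g 0 \<partial>lborel)"
    if f: "f \<in> schwartz" and g: "g \<in> schwartz" for f g :: "'a \<Rightarrow> complex"
  proof -
    obtain C where C: "\<And>x. cmod (g x) \<le> C / jbracket x ^ 0"
      using schwartz_bounded[OF g] by blast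
    show ?thesis
    proof (rule integral_dominated_convergence[where w="\<lambda>z. cmod (f z) * C"])
      show "AE z in lborel. (\<lambda>k. f z * g (\<epsilon> k *\<^sub>R z)) \<longlonglongrightarrow> f z * g 0"
      proof (intro AE_I2 tendsto_mult tendsto_const)
        fix z :: 'a
        have "(\<lambda>k. \<epsilon> k *\<^sub>R z) \<longlonglongrightarrow> 0 *\<^sub>R z" by (rule tendsto_scaleR[OF \<epsilon>0 tendsto_const])
        moreover have "isCont g 0"
          by (rule has_derivative_continuous[OF schwartz_has_derivative[OF g]])
        ultimately show "(\<lambda>k. g (\<epsilon> k *\<^sub>R z)) \<longlonglongrightarrow> g 0"
          using isCont_tendsto_compose by fastforce
      qed
      show "AE z in lborel. norm (f z * g (\<epsilon> k *\<^sub>R z)) \<le> cmod (f z) * C" for k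
        using C by (auto simp: norm_mult intro!: mult_left_mono)
      show "integrable lborel (\<lambda>z. cmod (f z) * C)"
        using schwartz_integrable[OF f] by (intro integrable_mult_left integrable_norm)
      show "(\<lambda>z. f z * g (\<epsilon> k *\<^sub>R z)) \<in> borel_measurable lborel" for k
        using schwartz_measurable[OF schwartz_mult[OF f schwartz_scale[OF g, of "\<epsilon> k"]]] \<epsilon>[of k] by simp
      show "(\<lambda>z. f z * g 0) \<in> borel_measurable lborel"
        using schwartz_measurable[OF f] by simp
    qed
  qed
  have "(\<lambda>k. \<integral>z. fourier h z * \<Theta> (\<epsilon> k *\<^sub>R z) \<partial>lborel) \<longlonglongrightarrow> (\<integral>z. fourier h z * \<Theta> 0 \<partial>lborel)"
    by (rule lim[OF fourier_schwartz[OF h] \<Theta>])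
  moreover have "(\<lambda>k. \<integral>z. fourier h z * \<Theta> (\<epsilon> k *\<^sub>R z) \<partial>lborel) \<longlonglongrightarrow> (\<integral>z. fourier \<Theta> z * h 0 \<partial>lborel)"
    unfolding eq using lim[OF fourier_schwartz[OF \<Theta>] h] by (simp add: mult.commute)
  ultimately have "(\<integral>z. fourier h z * \<Theta> 0 \<partial>lborel) = (\<integral>z. fourier \<Theta> z * h 0 \<partial>lborel)"
    by (rule LIMSEQ_unique)
  then show ?thesis by (simp add: mult.commute)
qed

lemma fourier_translate:
  assumes "h \<in> schwartz"
  shows "fourier (\<lambda>y. h (a + y)) \<xi> = cis (2 * pi * (\<xi> \<bullet> a)) * fourier h \<xi>"
proof -
  have S: "(\<lambda>y. cis (2 * pi * (\<xi> \<bullet> a)) * (h y * cis (- 2 * pi * (\<xi> \<bullet> y)))) \<in> schwartz"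
    using schwartz_cmult[OF schwartz_modulate[OF assms, of "(- 2 * pi) *\<^sub>R \<xi>"]]
    by (simp add: inner_commute mult.commute)
  have "cis (2 * pi * (\<xi> \<bullet> a)) * (h (a + y) * cis (- 2 * pi * (\<xi> \<bullet> (a + y))))
      = h (a + y) * cis (- 2 * pi * (\<xi> \<bullet> y))" for y
  proof -
    have "cis (2 * pi * (\<xi> \<bullet> a)) * cis (- 2 * pi * (\<xi> \<bullet> (a + y))) = cis (- 2 * pi * (\<xi> \<bullet> y))"
      by (simp add: cis_mult inner_add_right algebra_simps)
    then show ?thesis by (simp add: ac_simps)
  qed
  then have "fourier (\<lambda>y. h (a + y)) \<xi>
      = (\<integral>y. cis (2 * pi * (\<xi> \<bullet> a)) * (h (a + y) * cis (- 2 * pi * (\<xi> \<bullet> (a + y)))) \<partial>lborel)"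
    unfolding fourier_def by (simp only:)
  also have "\<dots> = (\<integral>y. cis (2 * pi * (\<xi> \<bullet> a)) * (h y * cis (- 2 * pi * (\<xi> \<bullet> y))) \<partial>lborel)"
    by (rule integral_lborel_translate[OF schwartz_measurable[OF S]])
  finally show ?thesis unfolding fourier_def by simp
qed

text \<open>\<open>\<Theta>\<close> is translated so that it does not vanish at 0, and the identity
  at 0 is applied to translates of \<open>h\<close>. If \<open>c\<close> were 0, the multiplication
  formula with \<open>cnj (fourier h z)\<close> as second factor would make the L^2 norm of every
  \<open>fourier h\<close> vanish, yet the transform of the squared modulus of
  \<open>\<Theta>\<close> is positive at 0.\<close>

lemma fourier_inversion:
  fixes \<Theta> :: "'a::euclidean_space \<Rightarrow> complex"
  assumes "\<Theta> \<in> schwartz" "\<Theta> \<noteq> (\<lambda>x. 0)"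
  shows "\<exists>c. c \<noteq> 0 \<and> (\<forall>h\<in>schwartz. \<forall>t::'a.
    (\<integral>\<xi>. fourier h \<xi> * cis (2 * pi * (\<xi> \<bullet> t)) \<partial>lborel) = c * h t)"
proof -
  obtain a where a: "\<Theta> a \<noteq> 0" using assms(2) by auto
  define \<Theta>' where "\<Theta>' = (\<lambda>y. \<Theta> (a + y))"
  have \<Theta>': "\<Theta>' \<in> schwartz" "\<Theta>' 0 \<noteq> 0"
    using schwartz_translate[OF assms(1), of "- a"] a by (simp_all add: \<Theta>'_def add.commute)
  define c where "c = (\<integral>y. fourier \<Theta>' y \<partial>lborel) / \<Theta>' 0"
  have inv: "(\<integral>\<xi>. fourier h \<xi> * cis (2 * pi * (\<xi> \<bullet> t)) \<partial>lborel) = c * h t"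
    if h: "h \<in> schwartz" for h :: "'a \<Rightarrow> complex" and t
  proof -
    have "(\<lambda>y. h (t + y)) \<in> schwartz"
      using schwartz_translate[OF h, of "- t"] by (simp add: add.commute)
    from fourier_inversion_at_0[OF this \<Theta>'(1)]
    have "\<Theta>' 0 * (\<integral>\<xi>. fourier h \<xi> * cis (2 * pi * (\<xi> \<bullet> t)) \<partial>lborel) = h t * (\<integral>y. fourier \<Theta>' y \<partial>lborel)"
      by (simp add: fourier_translate[OF h] mult.commute[of "fourier h _"])
    then show ?thesis using \<Theta>'(2) by (simp add: c_def field_simps)
  qed
  have "c \<noteq> 0"
  proof
    assume c: "c = 0"
    have zero: "fourier h = (\<lambda>x. 0)" if h: "h \<in> schwartz" for h :: "'a \<Rightarrow> complex"
    proof (rule ccontr)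
      assume nz: "fourier h \<noteq> (\<lambda>x. 0)"
      have S: "fourier h \<in> schwartz" by (rule fourier_schwartz[OF h])
      have "fourier (\<lambda>z. cnj (fourier h z)) y = 0" for y
      proof -
        have "fourier (\<lambda>z. cnj (fourier h z)) y = (\<integral>\<xi>. cnj (fourier h \<xi> * cis (2 * pi * (\<xi> \<bullet> y))) \<partial>lborel)"
          unfolding fourier_def by (simp add: cis_cnj inner_commute)
        also have "\<dots> = cnj (\<integral>\<xi>. fourier h \<xi> * cis (2 * pi * (\<xi> \<bullet> y)) \<partial>lborel)"
          by (rule Bochner_Integration.integral_cnj)
        finally show ?thesis by (simp only: inv[OF h] c) simp
      qed
      then have "(\<integral>z. fourier h z * cnj (fourier h z) \<partial>lborel) = 0"
        by (simp add: fourier_mult_formula[OF h schwartz_cnj[OF S]])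
      with schwartz_nonzero_integral[OF S nz] show False by simp
    qed
    have "fourier (\<lambda>x. \<Theta> x * cnj (\<Theta> x)) 0 = 0"
      by (simp add: zero schwartz_mult schwartz_cnj assms)
    with schwartz_nonzero_integral[OF assms] show False by (simp add: fourier_def)
  qed
  then show ?thesis using inv by blast
qed

section \<open>The short-time Fourier transform of Schwartz functions\<close>

definition stft_fun :: "('a::euclidean_space \<Rightarrow> complex) \<Rightarrow> ('a \<Rightarrow> complex) \<Rightarrow> 'a \<times> 'a \<Rightarrow> complex" where
  "stft_fun \<phi> f = pft (\<lambda>z. f (snd z) * cnj (\<phi> (snd z - fst z)))"

lemma stft_fun_integrand:
  assumes "\<phi> \<in> schwartz" "f \<in> schwartz"
  shows "(\<lambda>z. f (snd z) * cnj (\<phi> (snd z - fst z))) \<in> schwartz"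
proof -
  have "inj (\<lambda>z::'a \<times> 'a. (snd z, snd z - fst z))"
    by (auto simp: inj_def)
  then show ?thesis
    using schwartz_compose_affine[OF schwartz_tensor[OF assms(2) schwartz_cnj[OF assms(1)]],
        of "\<lambda>z. (snd z, snd z - fst z)" 0]
    by (simp add: linear_iff algebra_simps)
qed

lemma stft_fun_schwartz:
  "\<phi> \<in> schwartz \<Longrightarrow> f \<in> schwartz \<Longrightarrow> stft_fun \<phi> f \<in> schwartz"
  unfolding stft_fun_def by (intro pft_schwartz stft_fun_integrand)

lemma stft_fun_eq:
  "stft_fun \<phi> f (x, \<xi>) = (\<integral>t. f t * cnj (\<phi> (t - x)) * cis (- 2 * pi * (\<xi> \<bullet> t)) \<partial>lborel)"
  by (simp add: stft_fun_def pft_def)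

lemma stft_dist_of:
  "\<phi> \<in> schwartz \<Longrightarrow> stft \<phi> (dist_of f) x \<xi> = stft_fun \<phi> f (x, \<xi>)"
  unfolding stft_def stft_fun_eq
  by (subst dpair_dist_of, erule schwartz_tf_shift) (simp add: tf_shift_def cis_cnj inner_commute ac_simps)

lemma integral_schwartz_reflect:
  fixes f :: "'a::euclidean_space \<Rightarrow> complex"
  assumes "f \<in> schwartz"
  shows "(\<integral>x. f (a - x) \<partial>lborel) = (\<integral>x. f x \<partial>lborel)"
proof -
  have [measurable]: "f \<in> borel_measurable borel" by (rule schwartz_measurable[OF assms])
  have "(\<integral>x. f x \<partial>lborel) = (\<integral>x. f (a + x) \<partial>lborel)" by (rule integral_lborel_translate[symmetric]) simp
  also have "\<dots> = (\<integral>x. f (a - x) \<partial>lborel)"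
    by (subst integral_lborel_scale[where c="-1"]) simp_all
  finally show ?thesis by simp
qed

text \<open>Joint regularity in the argument \<open>t\<close> and the phase-space point
  \<open>(x, \<xi>)\<close> is what allows a superposition of time-frequency shifts to be paired
  with a tempered distribution under the integral sign. The phase is bilinear in \<open>t\<close>
  and \<open>\<xi>\<close>, hence quadratic as \<open>schwartz_mult_phase\<close> demands.\<close>

lemma schwartz_superposition:
  fixes \<phi> :: "'a::euclidean_space \<Rightarrow> complex"
  assumes \<phi>: "\<phi> \<in> schwartz" and \<theta>: "\<theta> \<in> schwartz"
  shows "(\<lambda>z. \<theta> (snd z) * tf_shift (fst (snd z)) (snd (snd z)) \<phi> (fst z)) \<in> schwartz"
proof -
  have "(\<lambda>z::'a \<times> 'a \<times> 'a. \<theta> (snd z) * \<phi> (fst z - fst (snd z))) \<in> schwartz"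
  proof -
    have "inj (\<lambda>z::'a \<times> 'a \<times> 'a. (snd z, fst z - fst (snd z)))"
      by (auto simp: inj_def)
    then show ?thesis
      using schwartz_compose_affine[OF schwartz_tensor[OF \<theta> \<phi>],
          of "\<lambda>z::'a \<times> 'a \<times> 'a. (snd z, fst z - fst (snd z))" 0]
      by (simp add: linear_iff algebra_simps)
  qed
  then have "(\<lambda>z. cis (2 * pi * (fst z \<bullet> snd (snd z))) * (\<theta> (snd z) * \<phi> (fst z - fst (snd z)))) \<in> schwartz"
  proof (rule schwartz_mult_phase)
    show "((\<lambda>z::'a \<times> 'a \<times> 'a. 2 * pi * (fst z \<bullet> snd (snd z))) has_derivative
        (\<lambda>h. 2 * pi * (fst z \<bullet> snd (snd h) + fst h \<bullet> snd (snd z)))) (at z)" for z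
      by (intro has_derivative_mult_right has_derivative_inner has_derivative_fst has_derivative_snd
          has_derivative_ident)
    show "\<exists>w d. \<forall>z. 2 * pi * (fst z \<bullet> snd (snd b) + fst b \<bullet> snd (snd z)) = z \<bullet> w + d"
      for b :: "'a \<times> 'a \<times> 'a"
      by (rule exI[of _ "((2 * pi) *\<^sub>R snd (snd b), 0, (2 * pi) *\<^sub>R fst b)"], rule exI[of _ 0])
         (simp add: inner_prod_def inner_commute algebra_simps)
  qed
  then show ?thesis by (simp add: tf_shift_def ac_simps)
qed

text \<open>Fourier inversion in \<xi> at fixed \<open>x\<close> returns
  \<open>c * f t * cnj (\<phi> (t - x))\<close>, and integrating over \<open>x\<close> against the
  window leaves its squared L^2 norm \<open>I\<close>. Hence \<open>k = c * I\<close>, the same for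
  all \<open>f\<close>.\<close>

lemma stft_fun_reproducing:
  fixes \<phi> :: "'a::euclidean_space \<Rightarrow> complex"
  assumes \<phi>: "\<phi> \<in> schwartz" "\<phi> \<noteq> (\<lambda>x. 0)"
  shows "\<exists>k. k \<noteq> 0 \<and> (\<forall>f\<in>schwartz. \<forall>t.
    (\<integral>w. stft_fun \<phi> f w * tf_shift (fst w) (snd w) \<phi> t \<partial>lborel) = k * f t)"
proof -
  obtain c where c0: "c \<noteq> 0" "\<forall>h\<in>schwartz. \<forall>t::'a.
      (\<integral>\<xi>. fourier h \<xi> * cis (2 * pi * (\<xi> \<bullet> t)) \<partial>lborel) = c * h t"
    using fourier_inversion[OF \<phi>] by blast
  note c = c0(1) c0(2)[rule_format]
  define I where "I = (\<integral>x. \<phi> x * cnj (\<phi> x) \<partial>lborel)"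
  have I: "I \<noteq> 0" using schwartz_nonzero_integral[OF \<phi>] by (simp add: I_def)
  have "(\<integral>w. stft_fun \<phi> f w * tf_shift (fst w) (snd w) \<phi> t \<partial>lborel) = (c * I) * f t"
    if f: "f \<in> schwartz" for f t
  proof -
    define G where "G = (\<lambda>w. stft_fun \<phi> f w * tf_shift (fst w) (snd w) \<phi> t)"
    have "G \<in> schwartz"
      using schwartz_slice_snd[OF schwartz_superposition[OF \<phi>(1) stft_fun_schwartz[OF \<phi>(1) f]], of t]
      unfolding G_def by simp
    then have "(\<integral>w. G w \<partial>lborel) = (\<integral>x. (\<integral>\<xi>. G (x, \<xi>) \<partial>lborel) \<partial>lborel)"
      by (rule schwartz_Fubini)
    also have "\<dots> = (\<integral>x. (c * f t) * (\<phi> (t - x) * cnj (\<phi> (t - x))) \<partial>lborel)"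
    proof (intro Bochner_Integration.integral_cong refl)
      fix x
      define h where "h = (\<lambda>t. f t * cnj (\<phi> (t - x)))"
      have h: "h \<in> schwartz"
        unfolding h_def by (intro schwartz_mult f schwartz_cnj schwartz_translate \<phi>)
      have "G (x, \<xi>) = \<phi> (t - x) * (fourier h \<xi> * cis (2 * pi * (\<xi> \<bullet> t)))" for \<xi>
        by (simp add: G_def stft_fun_eq fourier_def h_def tf_shift_def inner_commute)
      then have "(\<integral>\<xi>. G (x, \<xi>) \<partial>lborel) = \<phi> (t - x) * (c * h t)"
        using c(2)[OF h, of t] by simp
      then show "(\<integral>\<xi>. G (x, \<xi>) \<partial>lborel) = (c * f t) * (\<phi> (t - x) * cnj (\<phi> (t - x)))"
        by (simp add: h_def ac_simps)
    qed
    also have "\<dots> = (c * f t) * I"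
      unfolding I_def using integral_schwartz_reflect[OF schwartz_mult[OF \<phi>(1) schwartz_cnj[OF \<phi>(1)]], of t]
      by simp
    finally show ?thesis by (simp add: G_def)
  qed
  then show ?thesis using c(1) I by (intro exI[of _ "c * I"]) simp
qed

section \<open>Tempered distributions under the integral sign\<close>

text \<open>A finite quadrature rule that is uniformly good for all Lipschitz functions with a fixed decay;
  it is what lets a tempered distribution be moved inside an integral.\<close>

lemma uniform_quadrature:
  fixes e :: real
  assumes "e > 0"
  shows "\<exists>(Y :: 'z::euclidean_space set) w. finite Y \<and> (\<forall>g :: 'z \<Rightarrow> complex.
    (\<forall>z. cmod (g z) \<le> 1 / jbracket z ^ Suc DIM('z)) \<longrightarrow> (\<forall>z z'. cmod (g z - g z') \<le> norm (z - z')) \<longrightarrow>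
    cmod ((\<integral>z. g z \<partial>lborel) - (\<Sum>y\<in>Y. of_real (w y) * g y)) \<le> e)"
proof -
  define W where "W z = 1 / jbracket z ^ Suc DIM('z)" for z :: 'z
  have Wint: "integrable lborel W"
    unfolding W_def by (rule integrable_inverse_jbracket) simp
  have W0: "0 \<le> W z" for z by (simp add: W_def)
  have [measurable]: "W \<in> borel_measurable borel" using borel_measurable_integrable[OF Wint] by simp
  have "(\<lambda>k. \<integral>z. indicator (- ball 0 (real k)) z * W z \<partial>lborel) \<longlonglongrightarrow> (\<integral>z. 0 \<partial>(lborel :: 'z measure))"
  proof (rule integral_dominated_convergence[where w=W])
    show "AE z in lborel. (\<lambda>k. indicator (- ball 0 (real k)) z * W z) \<longlonglongrightarrow> 0"
    proof (intro AE_I2 tendsto_eventually)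
      fix z :: 'z
      obtain K :: nat where "norm z < real K" using reals_Archimedean2 by blast
      then show "\<forall>\<^sub>F k in sequentially. indicator (- ball 0 (real k)) z * W z = 0"
        by (intro eventually_sequentiallyI[of K]) (auto simp: indicator_def)
    qed
  qed (use Wint W0 in \<open>auto split: split_indicator\<close>)
  then have "(\<lambda>k. \<integral>z. indicator (- ball 0 (real k)) z * W z \<partial>lborel) \<longlonglongrightarrow> 0" by simp
  then have "\<forall>\<^sub>F k in sequentially. (\<integral>z. indicator (- ball 0 (real k)) z * W z \<partial>lborel) < e / 2"
    by (rule order_tendstoD) (use assms in simp)
  then obtain k :: nat where k: "(\<integral>z. indicator (- ball 0 (real k)) z * W z \<partial>lborel) < e / 2"
    by (auto simp: eventually_sequentially)
  define B :: "'z set" where "B = ball 0 (real k)"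
  have [measurable]: "B \<in> sets borel" by (simp add: B_def)
  have Bfin: "emeasure lborel B < \<infinity>" unfolding B_def by (rule emeasure_lborel_ball_finite)
  \<comment> \<open>Simple functions that approximate the identity act as roundings: the nodes will
    be the finitely many values of one \<open>F i\<close>, the weights the measures of its fibres
    inside the ball \<open>B\<close>. Neither depends on the integrand, which makes the rule
    uniform.\<close>
  obtain F :: "nat \<Rightarrow> 'z \<Rightarrow> 'z" where F: "\<And>i. simple_function borel (F i)"
    "\<And>z. (\<lambda>i. F i z) \<longlonglongrightarrow> z" "\<And>i z. dist (F i z) 0 \<le> 2 * dist z 0"
    using borel_measurable_implies_sequence_metric[of "\<lambda>z::'z. z" borel 0] by auto
  have [measurable]: "F i \<in> borel_measurable borel" for i
    using F(1) by (rule borel_measurable_simple_function)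
  have FB: "norm (indicator B z * norm (z - F i z)) \<le> indicator B z * (3 * real k)" for i z
  proof -
    have "norm (z - F i z) \<le> norm z + norm (F i z)" by (rule norm_triangle_ineq4)
    also have "\<dots> \<le> 3 * norm z" using F(3)[of i z] by simp
    finally show ?thesis by (auto simp: B_def split: split_indicator)
  qed
  have intB: "integrable lborel (\<lambda>z. indicator B z * norm (z - F i z))" for i
    by (rule Bochner_Integration.integrable_bound[of _ "\<lambda>z. indicator B z * (3 * real k)"])
       (use Bfin FB in \<open>auto simp: abs_mult\<close>)
  have intW: "integrable lborel (\<lambda>z. indicator (- B) z * W z)"
    by (rule Bochner_Integration.integrable_bound[OF Wint]) (use W0 in \<open>auto split: split_indicator\<close>)
  have "(\<lambda>i. \<integral>z. indicator B z * norm (z - F i z) \<partial>lborel) \<longlonglongrightarrow> (\<integral>z. 0 \<partial>(lborel :: 'z measure))"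
  proof (rule integral_dominated_convergence[where w="\<lambda>z. indicator B z * (3 * real k)"])
    show "AE z in lborel. (\<lambda>i. indicator B z * norm (z - F i z)) \<longlonglongrightarrow> 0"
    proof (intro AE_I2)
      fix z
      have "(\<lambda>i. indicator B z * norm (z - F i z)) \<longlonglongrightarrow> indicator B z * norm (z - z)"
        by (intro tendsto_intros F)
      then show "(\<lambda>i. indicator B z * norm (z - F i z)) \<longlonglongrightarrow> 0" by simp
    qed
    show "AE z in lborel. norm (indicator B z * norm (z - F i z)) \<le> indicator B z * (3 * real k)" for i
      by (intro AE_I2 FB)
  qed (use Bfin in auto)
  then have "(\<lambda>i. \<integral>z. indicator B z * norm (z - F i z) \<partial>lborel) \<longlonglongrightarrow> 0" by simp
  then have "\<forall>\<^sub>F i in sequentially. (\<integral>z. indicator B z * norm (z - F i z) \<partial>lborel) < e / 2"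
    by (rule order_tendstoD) (use assms in simp)
  then obtain i where i: "(\<integral>z. indicator B z * norm (z - F i z) \<partial>lborel) < e / 2"
    by (auto simp: eventually_sequentially)
  define Y where "Y = range (F i)"
  have fin: "finite Y" using F(1)[of i] by (simp add: Y_def simple_function_def)
  define A where "A y = B \<inter> F i -` {y}" for y
  have [measurable]: "A y \<in> sets borel" for y
  proof -
    have "F i -` {y} \<inter> space borel \<in> sets borel" by (rule measurable_sets[of _ borel borel]) auto
    then show ?thesis by (simp add: A_def)
  qed
  have Afin: "emeasure lborel (A y) < \<infinity>" for y
    by (rule le_less_trans[OF emeasure_mono Bfin]) (auto simp: A_def)
  show ?thesis
  proof (intro exI[of _ Y] exI[of _ "\<lambda>y. measure lborel (A y)"] conjI allI impI fin)
    fix g :: "'z \<Rightarrow> complex"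
    assume dec: "\<forall>z. cmod (g z) \<le> 1 / jbracket z ^ Suc DIM('z)"
      and lip: "\<forall>z z'. cmod (g z - g z') \<le> norm (z - z')"
    have "1-lipschitz_on UNIV g"
      using lip by (intro lipschitz_onI) (auto simp: dist_norm)
    then have [measurable]: "g \<in> borel_measurable borel"
      using lipschitz_on_continuous_on borel_measurable_continuous_onI by blast
    have gint: "integrable lborel g"
      by (rule Bochner_Integration.integrable_bound[OF Wint]) (use dec W0 in \<open>auto simp: W_def\<close>)
    have sum_eq: "indicator B z *\<^sub>R g (F i z) = (\<Sum>y\<in>Y. indicator (A y) z *\<^sub>R g y)" for z
    proof -
      have "(\<Sum>y\<in>Y. indicator (A y) z *\<^sub>R g y) = (\<Sum>y\<in>{F i z}. indicator (A y) z *\<^sub>R g y)"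
        using fin by (intro sum.mono_neutral_right) (auto simp: A_def Y_def split: split_indicator)
      then show ?thesis by (simp add: A_def indicator_def)
    qed
    have simp_int: "integrable lborel (\<lambda>z. indicator B z *\<^sub>R g (F i z))"
      unfolding sum_eq using Afin by (intro Bochner_Integration.integrable_sum integrable_indicator) auto
    have "(\<integral>z. indicator B z *\<^sub>R g (F i z) \<partial>lborel) = (\<Sum>y\<in>Y. of_real (measure lborel (A y)) * g y)"
      unfolding sum_eq using Afin
      by (subst Bochner_Integration.integral_sum) (auto simp: scaleR_conv_of_real)
    then have "(\<integral>z. g z \<partial>lborel) - (\<Sum>y\<in>Y. of_real (measure lborel (A y)) * g y)
        = (\<integral>z. g z - indicator B z *\<^sub>R g (F i z) \<partial>lborel)"
      using gint simp_int by simp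
    \<comment> \<open>Outside \<open>B\<close> the decay bounds the error, inside \<open>B\<close>
      the Lipschitz condition does; \<open>k\<close> and \<open>i\<close> were chosen so that each
      part is below \<open>e / 2\<close>.\<close>
    also have "cmod \<dots> \<le> (\<integral>z. indicator (- B) z * W z + indicator B z * norm (z - F i z) \<partial>lborel)"
    proof (rule Bochner_Integration.integral_norm_bound_integral)
      show "integrable lborel (\<lambda>z. g z - indicator B z *\<^sub>R g (F i z))"
        by (intro Bochner_Integration.integrable_diff gint simp_int)
      show "integrable lborel (\<lambda>z. indicator (- B) z * W z + indicator B z * norm (z - F i z))"
        by (intro Bochner_Integration.integrable_add intW intB)
      show "cmod (g z - indicator B z *\<^sub>R g (F i z)) \<le> indicator (- B) z * W z + indicator B z * norm (z - F i z)"
        for z using dec lip by (auto simp: W_def split: split_indicator)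
    qed
    also have "\<dots> \<le> e" using intW intB k i by (simp add: B_def)
    finally show "cmod ((\<integral>z. g z \<partial>lborel) - (\<Sum>y\<in>Y. of_real (measure lborel (A y)) * g y)) \<le> e" .
  qed
qed

section \<open>Linearity of derivatives and distributions, and seminorms\<close>

lemma dir_deriv_add:
  assumes "f \<in> schwartz" "g \<in> schwartz"
  shows "dir_deriv v (\<lambda>x. f x + g x) = (\<lambda>x. dir_deriv v f x + dir_deriv v g x)"
  by (rule dir_deriv_eq) (intro has_derivative_add schwartz_has_derivative assms)

lemma dir_deriv_cmult:
  assumes "f \<in> schwartz"
  shows "dir_deriv v (\<lambda>x. c * f x) = (\<lambda>x. c * dir_deriv v f x)"
  by (rule dir_deriv_eq) (intro has_derivative_mult_right schwartz_has_derivative assms)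

lemma iter_deriv_add:
  assumes "f \<in> schwartz" "g \<in> schwartz" "set bs \<subseteq> Basis"
  shows "iter_deriv bs (\<lambda>x. f x + g x) = (\<lambda>x. iter_deriv bs f x + iter_deriv bs g x)"
  using assms(3)
  by (induction bs)
     (simp_all add: dir_deriv_add schwartz_iter_deriv assms flip: dir_deriv_def)

lemma iter_deriv_cmult:
  assumes "f \<in> schwartz" "set bs \<subseteq> Basis"
  shows "iter_deriv bs (\<lambda>x. c * f x) = (\<lambda>x. c * iter_deriv bs f x)"
  using assms(2)
  by (induction bs)
     (simp_all add: dir_deriv_cmult schwartz_iter_deriv assms flip: dir_deriv_def)

lemma iter_deriv_diff:
  assumes "f \<in> schwartz" "g \<in> schwartz" "set bs \<subseteq> Basis"
  shows "iter_deriv bs (\<lambda>x. f x - g x) = (\<lambda>x. iter_deriv bs f x - iter_deriv bs g x)"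
  using iter_deriv_add[OF assms(1) schwartz_cmult[OF assms(2), of "-1"] assms(3)]
    iter_deriv_cmult[OF assms(2,3), of "-1"] by simp

lemma iter_deriv_zero: "set bs \<subseteq> Basis \<Longrightarrow> iter_deriv bs (\<lambda>x. 0) = (\<lambda>x. 0)"
  using iter_deriv_cmult[OF schwartz_zero, of bs 0] by simp

lemma iter_deriv_sum:
  assumes "\<And>i. i \<in> I \<Longrightarrow> f i \<in> schwartz" "set bs \<subseteq> Basis"
  shows "iter_deriv bs (\<lambda>x. \<Sum>i\<in>I. f i x) = (\<lambda>x. \<Sum>i\<in>I. iter_deriv bs (f i) x)"
  using assms(1)
  by (induction I rule: infinite_finite_induct)
     (simp_all add: iter_deriv_zero iter_deriv_add schwartz_sum assms(2))

lemma tempered_add: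
  "u \<in> tempered_distributions \<Longrightarrow> f \<in> schwartz \<Longrightarrow> g \<in> schwartz \<Longrightarrow> u (\<lambda>x. f x + g x) = u f + u g"
  by (simp add: tempered_distributions_def)

lemma tempered_cmult:
  "u \<in> tempered_distributions \<Longrightarrow> f \<in> schwartz \<Longrightarrow> u (\<lambda>x. c * f x) = c * u f"
  by (simp add: tempered_distributions_def)

lemma tempered_diff:
  "u \<in> tempered_distributions \<Longrightarrow> f \<in> schwartz \<Longrightarrow> g \<in> schwartz \<Longrightarrow> u (\<lambda>x. f x - g x) = u f - u g"
  using tempered_add[of u f "\<lambda>x. - 1 * g x"] tempered_cmult[of u g "-1"] schwartz_cmult[of g "-1"]
  by simp

lemma tempered_sum:
  assumes u: "u \<in> tempered_distributions" and f: "\<And>i. i \<in> I \<Longrightarrow> f i \<in> schwartz"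
  shows "u (\<lambda>x. \<Sum>i\<in>I. f i x) = (\<Sum>i\<in>I. u (f i))"
  using f
proof (induction I rule: infinite_finite_induct)
  case (insert i I)
  then show ?case by (simp add: tempered_add[OF u] schwartz_sum)
qed (use tempered_cmult[OF u schwartz_zero, of 0] in simp_all)

lemma finite_multi_indices: "finite {bs :: 'a::euclidean_space list. set bs \<subseteq> Basis \<and> length bs \<le> N}"
  by (rule finite_lists_length_le) simp

lemma schwartz_seminorm_le:
  fixes f :: "'a::euclidean_space \<Rightarrow> complex"
  assumes "\<And>bs x. set bs \<subseteq> Basis \<Longrightarrow> length bs \<le> N \<Longrightarrow> jbracket x ^ N * cmod (iter_deriv bs f x) \<le> c"
  shows "schwartz_seminorm N f \<le> real (card {bs :: 'a list. set bs \<subseteq> Basis \<and> length bs \<le> N}) * c"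
  unfolding schwartz_seminorm_def by (rule sum_bounded_above) (auto intro!: cSUP_least assms)

lemma le_schwartz_seminorm:
  fixes f :: "'a::euclidean_space \<Rightarrow> complex"
  assumes f: "f \<in> schwartz"
  shows "jbracket x ^ N * cmod (f x) \<le> schwartz_seminorm N f"
proof -
  have bdd: "bdd_above (range (\<lambda>x. jbracket x ^ N * cmod (iter_deriv bs f x)))" if "set bs \<subseteq> Basis" for bs
    using f that by (simp add: schwartz_def)
  have nonneg: "0 \<le> (SUP x. jbracket x ^ N * cmod (iter_deriv bs f x))" if "set bs \<subseteq> Basis" for bs
    by (rule cSUP_upper2[OF bdd[OF that], of undefined]) auto
  have "jbracket x ^ N * cmod (f x) \<le> (SUP x. jbracket x ^ N * cmod (iter_deriv [] f x))"
    using bdd[of "[]"] by (intro cSUP_upper2[of _ _ x]) auto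
  also have "\<dots> \<le> schwartz_seminorm N f"
    unfolding schwartz_seminorm_def
    by (rule member_le_sum[of "[]" _ "\<lambda>bs. SUP x. jbracket x ^ N * cmod (iter_deriv bs f x)"])
       (auto simp: finite_multi_indices intro: nonneg)
  finally show ?thesis .
qed

text \<open>Continuity in pointwise form: the number of multi-indices in
  \<open>schwartz_seminorm\<close> is absorbed into \<open>C\<close>, so that a single bound
  \<open>c\<close> on all weighted derivatives is enough to estimate \<open>u f\<close>.\<close>

lemma tempered_bound:
  fixes u :: "('a::euclidean_space \<Rightarrow> complex) \<Rightarrow> complex"
  assumes "u \<in> tempered_distributions"
  shows "\<exists>N C. 0 \<le> C \<and> (\<forall>f c. f \<in> schwartz \<longrightarrow>
    (\<forall>bs x. set bs \<subseteq> Basis \<longrightarrow> length bs \<le> N \<longrightarrow> jbracket x ^ N * cmod (iter_deriv bs f x) \<le> c) \<longrightarrow>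
    cmod (u f) \<le> C * c)"
proof -
  obtain N C where NC: "\<And>f. f \<in> schwartz \<Longrightarrow> cmod (u f) \<le> C * schwartz_seminorm N f"
    using assms unfolding tempered_distributions_def by blast
  define m where "m = real (card {bs :: 'a list. set bs \<subseteq> Basis \<and> length bs \<le> N})"
  have "cmod (u f) \<le> (\<bar>C\<bar> * m) * c"
    if f: "f \<in> schwartz" and b: "\<And>bs x. set bs \<subseteq> Basis \<Longrightarrow> length bs \<le> N \<Longrightarrow>
        jbracket x ^ N * cmod (iter_deriv bs f x) \<le> c" for f c
  proof -
    have "0 \<le> schwartz_seminorm N f"
      by (rule order_trans[OF _ le_schwartz_seminorm[OF f, of undefined]]) simp
    then have "cmod (u f) \<le> \<bar>C\<bar> * schwartz_seminorm N f"
      using NC[OF f] by (meson abs_ge_self mult_right_mono order_trans)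
    also have "\<dots> \<le> \<bar>C\<bar> * (m * c)"
      unfolding m_def by (intro mult_left_mono schwartz_seminorm_le b) auto
    finally show ?thesis by (simp add: mult.assoc)
  qed
  moreover have "0 \<le> \<bar>C\<bar> * m" by (simp add: m_def)
  ultimately show ?thesis by blast
qed

section \<open>Marginals and slices of jointly Schwartz functions\<close>

lemma marginal_eq_pft: "(\<integral>z. G (t, z) \<partial>lborel) = pft G (t, 0)"
  by (simp add: pft_def)

lemma schwartz_marginal:
  assumes "G \<in> schwartz"
  shows "(\<lambda>t. \<integral>z. G (t, z) \<partial>lborel) \<in> schwartz"
  unfolding marginal_eq_pft by (intro schwartz_slice_fst pft_schwartz assms)

lemma set_map_Pair_Basis:
  "set bs \<subseteq> Basis \<Longrightarrow> set (map (\<lambda>b. (b, 0 :: 'b::euclidean_space)) bs) \<subseteq> Basis"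
  unfolding Basis_prod_def by auto

lemma iter_deriv_marginal:
  fixes G :: "'a::euclidean_space \<times> 'z::euclidean_space \<Rightarrow> complex"
  assumes G: "G \<in> schwartz" and "set bs \<subseteq> Basis"
  shows "iter_deriv bs (\<lambda>t. \<integral>z. G (t, z) \<partial>lborel)
    = (\<lambda>t. \<integral>z. iter_deriv (map (\<lambda>b. (b, 0)) bs) G (t, z) \<partial>lborel)"
  using assms(2)
proof (induction bs)
  case (Cons b bs)
  define H where "H = iter_deriv (map (\<lambda>b. (b, 0 :: 'z)) bs) G"
  have H: "H \<in> schwartz"
    unfolding H_def using Cons.prems set_map_Pair_Basis[of bs, where 'b='z]
    by (intro schwartz_iter_deriv G) simp
  have "((\<lambda>t. pft H (t, 0)) has_derivative
      (\<lambda>h. pft (\<lambda>z. dir_deriv (fst (h, 0 :: 'z), 0) H z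
        + (- 2 * pi * \<i>) * (of_real (z \<bullet> (0, snd (h, 0 :: 'z))) * H z)) (t, 0))) (at t)" for t
    by (rule has_derivative_compose[OF _ pft_has_derivative[OF H]]) (auto intro!: derivative_eq_intros)
  then have D: "((\<lambda>t. \<integral>z. H (t, z) \<partial>lborel) has_derivative
      (\<lambda>h. \<integral>z. dir_deriv (h, 0) H (t, z) \<partial>lborel)) (at t)" for t
    unfolding marginal_eq_pft by (simp flip: zero_prod_def)
  show ?case
    using Cons dir_deriv_eq[OF D, of b] by (simp add: H_def flip: dir_deriv_def)
qed simp

lemma iter_deriv_slice:
  fixes G :: "'a::euclidean_space \<times> 'z::euclidean_space \<Rightarrow> complex"
  assumes G: "G \<in> schwartz" and "set bs \<subseteq> Basis"
  shows "iter_deriv bs (\<lambda>t. G (t, z)) = (\<lambda>t. iter_deriv (map (\<lambda>b. (b, 0)) bs) G (t, z))"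
  using assms(2)
proof (induction bs)
  case (Cons b bs)
  define H where "H = iter_deriv (map (\<lambda>b. (b, 0 :: 'z)) bs) G"
  have H: "H \<in> schwartz"
    unfolding H_def using Cons.prems set_map_Pair_Basis[of bs, where 'b='z]
    by (intro schwartz_iter_deriv G) simp
  have D: "((\<lambda>t. H (t, z)) has_derivative (\<lambda>h. dir_deriv (h, 0) H (t, z))) (at t)" for t
    by (rule has_derivative_compose[OF _ schwartz_has_derivative[OF H]]) (auto intro!: derivative_eq_intros)
  show ?case
    using Cons dir_deriv_eq[OF D, of b] by (simp add: H_def flip: dir_deriv_def)
qed simp

text \<open>These are, up to scaling, the decay and Lipschitz conditions of
  \<open>uniform_quadrature\<close> for the slices of \<open>H\<close> in \<open>z\<close>, weighted
  by \<open>jbracket t ^ N\<close> and with a constant free of \<open>t\<close>. Joint decay of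
  order \<open>N + M\<close> is split between the variables; the Lipschitz bound is the mean value
  inequality in \<open>z\<close>.\<close>

lemma schwartz_slice_estimates:
  fixes H :: "'a::euclidean_space \<times> 'z::euclidean_space \<Rightarrow> complex"
  assumes H: "H \<in> schwartz"
  obtains K where "0 \<le> K"
    and "\<And>t z. jbracket t ^ N * cmod (H (t, z)) \<le> K / jbracket z ^ M"
    and "\<And>t z z'. jbracket t ^ N * cmod (H (t, z) - H (t, z')) \<le> K * norm (z - z')"
proof -
  obtain K1 where K1: "0 \<le> K1" "\<And>w. cmod (H w) \<le> K1 / jbracket w ^ (N + M)"
    using schwartz_bounded[OF H] by blast
  have "\<exists>C. 0 \<le> C \<and> (\<forall>w. cmod (dir_deriv b H w) \<le> C / jbracket w ^ N)" for b
    using schwartz_bounded[OF schwartz_dir_deriv[OF H]] by metis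
  then obtain c where c: "\<And>b. 0 \<le> c b" "\<And>b w. cmod (dir_deriv b H w) \<le> c b / jbracket w ^ N"
    by metis
  define K2 where "K2 = sum c Basis"
  have K2: "0 \<le> K2" unfolding K2_def by (intro sum_nonneg c)
  have weight: "jbracket t ^ N \<le> jbracket (t, z) ^ N" for t :: 'a and z :: 'z
    using jbracket_fst_le[of "(t, z)"] by (intro power_mono) auto
  show thesis
  proof (rule that[of "K1 + K2"])
    show "0 \<le> K1 + K2" using K1 K2 by simp
    show "jbracket t ^ N * cmod (H (t, z)) \<le> (K1 + K2) / jbracket z ^ M" for t z
    proof -
      have "jbracket t ^ N * jbracket z ^ M \<le> jbracket (t, z) ^ N * jbracket (t, z) ^ M"
        using jbracket_snd_le[of "(t, z)"] by (intro mult_mono weight power_mono) auto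
      then have "(jbracket t ^ N * jbracket z ^ M) * cmod (H (t, z))
          \<le> jbracket (t, z) ^ (N + M) * cmod (H (t, z))"
        by (intro mult_right_mono) (auto simp: power_add)
      also have "\<dots> \<le> K1" using K1(2)[of "(t, z)"] by (simp add: field_simps)
      also have "\<dots> \<le> K1 + K2" using K2 by simp
      finally show ?thesis by (simp add: field_simps)
    qed
    show "jbracket t ^ N * cmod (H (t, z) - H (t, z')) \<le> (K1 + K2) * norm (z - z')" for t z z'
    proof -
      have "cmod (H (t, z) - H (t, z')) \<le> (K2 / jbracket t ^ N) * norm (z - z')"
      proof (rule differentiable_bound[of UNIV "\<lambda>z. H (t, z)" "\<lambda>z h. dir_deriv (0, h) H (t, z)"])
        fix z :: 'z
        show "((\<lambda>z. H (t, z)) has_derivative (\<lambda>h. dir_deriv (0, h) H (t, z))) (at z within UNIV)"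
          by (rule has_derivative_compose[OF _ schwartz_has_derivative[OF H]])
             (auto intro!: derivative_eq_intros)
        show "onorm (\<lambda>h. dir_deriv (0, h) H (t, z)) \<le> K2 / jbracket t ^ N"
        proof (rule onorm_bound)
          fix h :: 'z
          have "cmod (dir_deriv (0, h) H (t, z)) \<le> norm (0 :: 'a, h) * (\<Sum>b\<in>Basis. cmod (dir_deriv b H (t, z)))"
            by (rule dir_deriv_cmod_le[OF H])
          also have "\<dots> \<le> norm h * (\<Sum>b\<in>Basis. c b / jbracket (t, z) ^ N)"
            by (intro mult_mono sum_mono c sum_nonneg) (auto simp: norm_Pair)
          also have "\<dots> = norm h * (K2 / jbracket (t, z) ^ N)"
            by (simp add: K2_def sum_divide_distrib)
          also have "\<dots> \<le> norm h * (K2 / jbracket t ^ N)"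
            using weight[of t z] K2 by (intro mult_left_mono divide_left_mono mult_pos_pos) auto
          finally show "cmod (dir_deriv (0, h) H (t, z)) \<le> K2 / jbracket t ^ N * norm h"
            by (simp add: mult.commute)
        qed (use K2 in simp)
      qed auto
      then have "jbracket t ^ N * cmod (H (t, z) - H (t, z')) \<le> K2 * norm (z - z')"
        by (simp add: field_simps)
      also have "\<dots> \<le> (K1 + K2) * norm (z - z')"
        using K1 by (intro mult_right_mono) auto
      finally show ?thesis .
    qed
  qed
qed

text \<open>A quadrature rule turns the integral of \<open>G (t, z)\<close> into a finite sum
  \<open>R\<close>, through which \<open>u\<close> passes by linearity. The rule is good uniformly
  over all \<open>t\<close> and all derivatives that the order of \<open>u\<close> sees, so
  \<open>u\<close> is close on \<open>R\<close> and on the integral. It is equally good for the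
  scalar function \<open>U\<close>, whose Lipschitz bound also gives the continuity.\<close>

lemma tempered_integral:
  fixes u :: "('a::euclidean_space \<Rightarrow> complex) \<Rightarrow> complex"
    and G :: "'a \<times> 'z::euclidean_space \<Rightarrow> complex"
  assumes u: "u \<in> tempered_distributions" and G: "G \<in> schwartz"
  shows "continuous_on UNIV (\<lambda>z. u (\<lambda>t. G (t, z)))"
    and "u (\<lambda>t. \<integral>z. G (t, z) \<partial>lborel) = (\<integral>z. u (\<lambda>t. G (t, z)) \<partial>lborel)"
proof -
  define M where "M = Suc DIM('z)"
  obtain N C where C0: "0 \<le> C" "\<forall>f c. f \<in> schwartz \<longrightarrow>
      (\<forall>bs x. set bs \<subseteq> Basis \<longrightarrow> length bs \<le> N \<longrightarrow> jbracket x ^ N * cmod (iter_deriv bs f x) \<le> c) \<longrightarrow>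
      cmod (u f) \<le> C * c"
    using tempered_bound[OF u] by (elim exE conjE)
  note C = C0(1) C0(2)[rule_format]
  define I where "I = {bs :: 'a list. set bs \<subseteq> Basis \<and> length bs \<le> N}"
  define D where "D bs = iter_deriv (map (\<lambda>b. (b, 0 :: 'z)) bs) G" for bs
  have D: "D bs \<in> schwartz" if "bs \<in> I" for bs
    using that set_map_Pair_Basis[of bs, where 'b='z] unfolding D_def I_def
    by (intro schwartz_iter_deriv G) auto
  have slice: "iter_deriv bs (\<lambda>t. G (t, z)) t = D bs (t, z)" if "bs \<in> I" for bs z t
    using that by (simp add: D_def I_def iter_deriv_slice[OF G])
  have "\<exists>K. 0 \<le> K \<and> (\<forall>t z. jbracket t ^ N * cmod (D bs (t, z)) \<le> K / jbracket z ^ M)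
      \<and> (\<forall>t z z'. jbracket t ^ N * cmod (D bs (t, z) - D bs (t, z')) \<le> K * norm (z - z'))" if "bs \<in> I" for bs
    using schwartz_slice_estimates[OF D[OF that], of N M] by metis
  then obtain k where k: "\<And>bs. bs \<in> I \<Longrightarrow> 0 \<le> k bs"
      "\<And>bs t z. bs \<in> I \<Longrightarrow> jbracket t ^ N * cmod (D bs (t, z)) \<le> k bs / jbracket z ^ M"
      "\<And>bs t z z'. bs \<in> I \<Longrightarrow> jbracket t ^ N * cmod (D bs (t, z) - D bs (t, z')) \<le> k bs * norm (z - z')"
    by metis
  have finI: "finite I" unfolding I_def by (rule finite_multi_indices)
  define K where "K = sum k I"
  have K0: "0 \<le> K" unfolding K_def by (intro sum_nonneg k)
  have kK: "k bs \<le> K" if "bs \<in> I" for bs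
    unfolding K_def using k(1) finI that by (intro member_le_sum) auto
  have K1: "jbracket t ^ N * cmod (D bs (t, z)) \<le> K / jbracket z ^ M" if "bs \<in> I" for bs t z
    by (rule order_trans[OF k(2)[OF that] divide_right_mono[OF kK[OF that]]]) simp
  have K2: "jbracket t ^ N * cmod (D bs (t, z) - D bs (t, z')) \<le> K * norm (z - z')" if "bs \<in> I" for bs t z z'
    by (rule order_trans[OF k(3)[OF that] mult_right_mono[OF kK[OF that]]]) simp
  define U where "U z = u (\<lambda>t. G (t, z))" for z
  note GS = schwartz_slice_fst[OF G]
  have U1: "cmod (U z) \<le> C * (K / jbracket z ^ M)" for z
    unfolding U_def using K1 by (intro C(2) GS) (simp add: slice I_def)
  have U2: "cmod (U z - U z') \<le> C * (K * norm (z - z'))" for z z'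
    unfolding U_def tempered_diff[OF u GS GS, symmetric]
    using K2 by (intro C(2) schwartz_diff GS) (simp add: iter_deriv_diff[OF GS GS] slice I_def)
  have "(C * K)-lipschitz_on UNIV U"
    using U2 C K0 by (intro lipschitz_onI) (auto simp: dist_norm mult.assoc)
  then show "continuous_on UNIV (\<lambda>z. u (\<lambda>t. G (t, z)))"
    using lipschitz_on_continuous_on unfolding U_def by blast
  \<comment> \<open>One constant for both uses of the rule, to the derivatives of \<open>G\<close>
    and to \<open>U\<close>. The summand 1 makes it positive, so that functions can be divided by it
    to fit the normalised rule.\<close>
  define L where "L = K + C * K + 1"
  have L: "L > 0" "K \<le> L" "C * K \<le> L" unfolding L_def using K0 mult_nonneg_nonneg[OF C(1) K0] by linarith+
  define \<Psi> where "\<Psi> = (\<lambda>t. \<integral>z. G (t, z) \<partial>lborel)"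
  have \<Psi>: "\<Psi> \<in> schwartz" unfolding \<Psi>_def by (rule schwartz_marginal[OF G])
  have "cmod (u \<Psi> - (\<integral>z. U z \<partial>lborel)) \<le> e * (C * L + L)" if e: "e > 0" for e
  proof -
    obtain Y :: "'z set" and w :: "'z \<Rightarrow> real" where fin: "finite Y" and quad0: "\<forall>g :: 'z \<Rightarrow> complex.
        (\<forall>z. cmod (g z) \<le> 1 / jbracket z ^ M) \<longrightarrow> (\<forall>z z'. cmod (g z - g z') \<le> norm (z - z')) \<longrightarrow>
        cmod ((\<integral>z. g z \<partial>lborel) - (\<Sum>y\<in>Y. of_real (w y) * g y)) \<le> e"
      using uniform_quadrature[OF e, where 'z='z] unfolding M_def by (elim exE conjE)
    note quad = quad0[rule_format]
    have quadL: "cmod ((\<integral>z. g z \<partial>lborel) - (\<Sum>y\<in>Y. of_real (w y) * g y)) \<le> e * L"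
      if g1: "\<And>z. cmod (g z) \<le> L / jbracket z ^ M" and g2: "\<And>z z'. cmod (g z - g z') \<le> L * norm (z - z')"
      for g :: "'z \<Rightarrow> complex"
    proof -
      have "cmod ((\<integral>z. g z / of_real L \<partial>lborel) - (\<Sum>y\<in>Y. of_real (w y) * (g y / of_real L))) \<le> e"
        using L g1 g2
        by (intro quad) (auto simp: norm_divide field_simps simp flip: diff_divide_distrib)
      also have "(\<integral>z. g z / of_real L \<partial>lborel) - (\<Sum>y\<in>Y. of_real (w y) * (g y / of_real L))
          = ((\<integral>z. g z \<partial>lborel) - (\<Sum>y\<in>Y. of_real (w y) * g y)) / of_real L"
        by (simp add: sum_divide_distrib diff_divide_distrib)
      finally show ?thesis using L by (simp add: norm_divide field_simps)
    qed
    define R where "R = (\<lambda>t. \<Sum>y\<in>Y. of_real (w y) * G (t, y))"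
    have R: "R \<in> schwartz" unfolding R_def by (intro schwartz_sum schwartz_cmult GS)
    have uR: "u R = (\<Sum>y\<in>Y. of_real (w y) * U y)"
      unfolding R_def U_def by (simp add: tempered_sum[OF u] schwartz_cmult GS tempered_cmult[OF u])
    have "cmod (u (\<lambda>t. \<Psi> t - R t)) \<le> C * (e * L)"
    proof (rule C(2)[OF schwartz_diff[OF \<Psi> R]])
      fix bs :: "'a list" and t assume bs: "set bs \<subseteq> Basis" "length bs \<le> N"
      then have I: "bs \<in> I" by (simp add: I_def)
      \<comment> \<open>The weight is put into the integrand, so that the quadrature error bounds
        the weighted derivative of the difference of \<open>\<Psi>\<close> and \<open>R\<close> at
        \<open>t\<close> directly.\<close>
      define g where "g z = of_real (jbracket t ^ N) * D bs (t, z)" for z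
      have "cmod ((\<integral>z. g z \<partial>lborel) - (\<Sum>y\<in>Y. of_real (w y) * g y)) \<le> e * L"
      proof (rule quadL)
        show "cmod (g z) \<le> L / jbracket z ^ M" for z
          using order_trans[OF K1[OF I] divide_right_mono[OF L(2)]] by (simp add: g_def norm_mult norm_power)
        show "cmod (g z - g z') \<le> L * norm (z - z')" for z z'
          using order_trans[OF K2[OF I] mult_right_mono[OF L(2)]]
          by (simp add: g_def norm_mult norm_power flip: right_diff_distrib)
      qed
      moreover have "iter_deriv bs R t = (\<Sum>y\<in>Y. of_real (w y) * D bs (t, y))"
        unfolding R_def
        by (subst iter_deriv_sum) (simp_all add: schwartz_cmult GS iter_deriv_cmult bs slice[OF I])
      moreover have "iter_deriv bs \<Psi> t = (\<integral>z. D bs (t, z) \<partial>lborel)"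
        unfolding \<Psi>_def D_def iter_deriv_marginal[OF G bs(1)] ..
      ultimately have "cmod (of_real (jbracket t ^ N) * (iter_deriv bs \<Psi> t - iter_deriv bs R t)) \<le> e * L"
        by (simp add: g_def right_diff_distrib sum_distrib_left ac_simps)
      then show "jbracket t ^ N * cmod (iter_deriv bs (\<lambda>t. \<Psi> t - R t) t) \<le> e * L"
        by (simp add: iter_deriv_diff[OF \<Psi> R bs(1)] norm_mult norm_power)
    qed
    moreover have "cmod ((\<integral>z. U z \<partial>lborel) - (\<Sum>y\<in>Y. of_real (w y) * U y)) \<le> e * L"
    proof (rule quadL)
      show "cmod (U z) \<le> L / jbracket z ^ M" for z
        using order_trans[OF U1[of z]] divide_right_mono[OF L(3), of "jbracket z ^ M"] by simp
      show "cmod (U z - U z') \<le> L * norm (z - z')" for z z'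
        using order_trans[OF U2[of z z']] mult_right_mono[OF L(3), of "norm (z - z')"] by (simp add: mult.assoc)
    qed
    ultimately have "cmod (u \<Psi> - u R) \<le> C * (e * L)" "cmod ((\<integral>z. U z \<partial>lborel) - u R) \<le> e * L"
      by (simp_all add: tempered_diff[OF u \<Psi> R] uR)
    then have "cmod ((u \<Psi> - u R) - ((\<integral>z. U z \<partial>lborel) - u R)) \<le> C * (e * L) + e * L"
      by (intro norm_triangle_le_diff) linarith
    then show ?thesis by (simp add: algebra_simps)
  qed
  note approx = this
  have CL: "C * L + L > 0" using C(1) L by (intro add_nonneg_pos) auto
  have "cmod (u \<Psi> - (\<integral>z. U z \<partial>lborel)) \<le> e" if "e > 0" for e
    using approx[of "e / (C * L + L)"] that CL by simp
  then have "cmod (u \<Psi> - (\<integral>z. U z \<partial>lborel)) \<le> 0"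
    by (rule field_le_epsilon) simp
  then show "u (\<lambda>t. \<integral>z. G (t, z) \<partial>lborel) = (\<integral>z. u (\<lambda>t. G (t, z)) \<partial>lborel)"
    by (simp add: U_def \<Psi>_def)
qed

section \<open>Operators with symbols in the Wiener amalgam space\<close>

lemma tau_wigner_eq_pft:
  "tau_wigner \<tau> f g = pft (\<lambda>z. f (fst z + \<tau> *\<^sub>R snd z) * cnj (g (fst z - (1 - \<tau>) *\<^sub>R snd z)))"
  by (simp add: fun_eq_iff tau_wigner_def pft_def)

lemma tau_wigner_integrand:
  assumes "f \<in> schwartz" "g \<in> schwartz"
  shows "(\<lambda>z. f (fst z + \<tau> *\<^sub>R snd z) * cnj (g (fst z - (1 - \<tau>) *\<^sub>R snd z))) \<in> schwartz"
proof -
  have "inj (\<lambda>z::'a \<times> 'a. (fst z + \<tau> *\<^sub>R snd z, fst z - (1 - \<tau>) *\<^sub>R snd z))"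
  proof (rule injI)
    fix z w :: "'a \<times> 'a"
    assume eq: "(fst z + \<tau> *\<^sub>R snd z, fst z - (1 - \<tau>) *\<^sub>R snd z)
      = (fst w + \<tau> *\<^sub>R snd w, fst w - (1 - \<tau>) *\<^sub>R snd w)"
    \<comment> \<open>The weights \<open>\<tau>\<close> and \<open>1 - \<tau>\<close> add up to 1,
      so the two arguments determine the integration variable as their difference.\<close>
    have "snd v = (fst v + \<tau> *\<^sub>R snd v) - (fst v - (1 - \<tau>) *\<^sub>R snd v)" for v :: "'a \<times> 'a"
      by (simp add: algebra_simps)
    then have "snd z = snd w" using eq by (metis prod.inject)
    with eq show "z = w" by (simp add: prod_eq_iff)
  qed
  then show ?thesis
    using schwartz_compose_affine[OF schwartz_tensor[OF assms(1) schwartz_cnj[OF assms(2)]],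
        of "\<lambda>z. (fst z + \<tau> *\<^sub>R snd z, fst z - (1 - \<tau>) *\<^sub>R snd z)" 0]
    by (simp add: linear_iff algebra_simps)
qed

lemma tau_wigner_schwartz:
  "f \<in> schwartz \<Longrightarrow> g \<in> schwartz \<Longrightarrow> tau_wigner \<tau> f g \<in> schwartz"
  unfolding tau_wigner_eq_pft by (intro pft_schwartz tau_wigner_integrand)

text \<open>Substituting \<open>a + t\<close> for \<open>t\<close> with \<open>a = w1 - u1\<close>
  brings both functions back to a common base point \<open>y\<close>. The phases combine into the
  unimodular constant \<open>p\<close> and a character of frequency \<open>\<eta>\<close>, so only a
  translation survives in the modulus.\<close>

lemma tau_wigner_tf_shift:
  fixes f g :: "'a::euclidean_space \<Rightarrow> complex"
  assumes f: "f \<in> schwartz" and g: "g \<in> schwartz"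
  shows "cmod (tau_wigner \<tau> (tf_shift w1 w2 f) (tf_shift u1 u2 g) z)
    = cmod (tau_wigner \<tau> f g (z - (w1 - \<tau> *\<^sub>R (w1 - u1), \<tau> *\<^sub>R w2 + (1 - \<tau>) *\<^sub>R u2)))"
proof -
  obtain x \<xi> where z: "z = (x, \<xi>)" by fastforce
  define a where "a = w1 - u1"
  define \<eta> where "\<eta> = \<xi> - (\<tau> *\<^sub>R w2 + (1 - \<tau>) *\<^sub>R u2)"
  define y where "y = x - (w1 - \<tau> *\<^sub>R a)"
  define K where "K t = (tf_shift w1 w2 f (x + \<tau> *\<^sub>R t) * cnj (tf_shift u1 u2 g (x - (1 - \<tau>) *\<^sub>R t)))
    * cis (- 2 * pi * (\<xi> \<bullet> t))" for t
  have "K \<in> schwartz"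
    using schwartz_slice_modulated[OF tau_wigner_integrand[OF schwartz_tf_shift[OF f] schwartz_tf_shift[OF g]]]
    unfolding K_def by simp
  then have meas: "K \<in> borel_measurable borel" by (rule schwartz_measurable)
  define p where "p = cis (2 * pi * (x \<bullet> (w2 - u2) - a \<bullet> \<eta>))"
  have K: "K (a + t) = p * (f (y + \<tau> *\<^sub>R t) * cnj (g (y - (1 - \<tau>) *\<^sub>R t)) * cis (- 2 * pi * (\<eta> \<bullet> t)))" for t
  proof -
    have e1: "x + \<tau> *\<^sub>R (a + t) - w1 = y + \<tau> *\<^sub>R t"
      by (simp add: y_def algebra_simps)
    have e2: "x - (1 - \<tau>) *\<^sub>R (a + t) - u1 = y - (1 - \<tau>) *\<^sub>R t"
      by (simp add: y_def a_def algebra_simps)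
    have ph: "cis (2 * pi * ((x + \<tau> *\<^sub>R (a + t)) \<bullet> w2)) * cnj (cis (2 * pi * ((x - (1 - \<tau>) *\<^sub>R (a + t)) \<bullet> u2)))
        * cis (- 2 * pi * (\<xi> \<bullet> (a + t))) = p * cis (- 2 * pi * (\<eta> \<bullet> t))"
      unfolding p_def \<eta>_def cis_cnj cis_mult
      by (rule arg_cong[of _ _ cis]) (simp add: algebra_simps inner_commute inner_diff_left inner_diff_right inner_add_left inner_add_right)
    have "K (a + t) = (cis (2 * pi * ((x + \<tau> *\<^sub>R (a + t)) \<bullet> w2)) * cnj (cis (2 * pi * ((x - (1 - \<tau>) *\<^sub>R (a + t)) \<bullet> u2)))
        * cis (- 2 * pi * (\<xi> \<bullet> (a + t)))) * (f (y + \<tau> *\<^sub>R t) * cnj (g (y - (1 - \<tau>) *\<^sub>R t)))"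
      unfolding K_def tf_shift_def e1 e2 complex_cnj_mult by (simp only: ac_simps)
    then show ?thesis unfolding ph by (simp only: ac_simps)
  qed
  have "tau_wigner \<tau> (tf_shift w1 w2 f) (tf_shift u1 u2 g) z = (\<integral>t. K t \<partial>lborel)"
    by (simp add: z tau_wigner_def K_def)
  also have "\<dots> = (\<integral>t. K (a + t) \<partial>lborel)"
    by (rule integral_lborel_translate[OF meas, symmetric])
  also have "\<dots> = p * tau_wigner \<tau> f g (y, \<eta>)"
    unfolding K by (simp add: tau_wigner_def)
  finally show ?thesis
    by (simp add: p_def norm_mult z y_def a_def \<eta>_def)
qed

text \<open>The distributional arguments yield continuity only after multiplication by a Schwartz
  function. Near each point it can be divided out, by a translate of \<open>\<theta>0\<close> that
  does not vanish there.\<close>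

lemma continuous_on_of_schwartz_mult:
  fixes K :: "'a::euclidean_space \<Rightarrow> complex"
  assumes mult: "\<And>\<theta>. \<theta> \<in> schwartz \<Longrightarrow> continuous_on UNIV (\<lambda>w. \<theta> w * K w)"
    and \<theta>0: "\<theta>0 \<in> schwartz" "\<theta>0 \<noteq> (\<lambda>x::'a. 0)"
  shows "continuous_on UNIV K"
proof (intro continuous_at_imp_continuous_on ballI)
  fix w0
  obtain a where a: "\<theta>0 a \<noteq> 0" using \<theta>0(2) by auto
  define \<theta> where "\<theta> w = \<theta>0 (w - (w0 - a))" for w
  have \<theta>: "\<theta> \<in> schwartz" unfolding \<theta>_def by (rule schwartz_translate[OF \<theta>0(1)])
  have nz: "\<theta> w0 \<noteq> 0" using a by (simp add: \<theta>_def)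
  have c\<theta>: "continuous_on UNIV \<theta>" by (rule schwartz_continuous_on[OF \<theta> continuous_on_id])
  have "isCont (\<lambda>w. (\<theta> w * K w) / \<theta> w) w0"
    using mult[OF \<theta>] c\<theta> by (intro isCont_divide nz) (simp_all add: continuous_on_eq_continuous_at)
  moreover have "\<forall>\<^sub>F w in nhds w0. (\<theta> w * K w) / \<theta> w = K w"
  proof -
    have "open {w. \<theta> w \<noteq> 0}" by (intro open_Collect_neq c\<theta> continuous_intros)
    then have "\<forall>\<^sub>F w in nhds w0. w \<in> {w. \<theta> w \<noteq> 0}" using nz by (intro eventually_nhds_in_open) auto
    then show ?thesis by eventually_elim simp
  qed
  ultimately show "isCont K w0" by (simp only: isCont_cong)
qed

lemma schwartz_Pair_nonzero:
  fixes \<phi> :: "'a::euclidean_space \<Rightarrow> complex"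
  assumes "\<phi> \<in> schwartz" "\<phi> \<noteq> (\<lambda>x. 0)"
  shows "\<exists>\<theta>\<in>schwartz. \<theta> \<noteq> (\<lambda>w::'a \<times> 'a. 0)"
proof
  show "(\<lambda>z. \<phi> (fst z) * \<phi> (snd z)) \<in> schwartz" by (intro schwartz_tensor assms)
  obtain a where "\<phi> a \<noteq> 0" using assms(2) by auto
  then show "(\<lambda>z. \<phi> (fst z) * \<phi> (snd z)) \<noteq> (\<lambda>w. 0)" by (auto simp: fun_eq_iff)
qed

section \<open>Nonnegative integrals: reflection, moduli and Tonelli's theorem\<close>

lemma nn_integral_lborel_reflect:
  fixes f :: "'a::euclidean_space \<Rightarrow> ennreal"
  assumes [measurable]: "f \<in> borel_measurable borel"
  shows "(\<integral>\<^sup>+x. f (a - x) \<partial>lborel) = (\<integral>\<^sup>+x. f x \<partial>lborel)"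
proof -
  have "(\<integral>\<^sup>+x. f x \<partial>lborel) = (\<integral>\<^sup>+x. f x \<partial>density (distr lborel borel (\<lambda>x. a + (-1) *\<^sub>R x)) (\<lambda>_. 1))"
    using lborel_affine[of "-1" a] by simp
  also have "\<dots> = (\<integral>\<^sup>+x. f (a - x) \<partial>lborel)"
    by (simp add: nn_integral_density nn_integral_distr)
  finally show ?thesis by simp
qed

lemma cmod_integral_le_nn_integral:
  fixes f :: "'a \<Rightarrow> complex"
  shows "ennreal (cmod (\<integral>x. f x \<partial>M)) \<le> (\<integral>\<^sup>+x. ennreal (cmod (f x)) \<partial>M)"
  by (cases "integrable M f") (simp_all add: integral_norm_bound_ennreal not_integrable_integral_eq)

lemma nn_integral_schwartz_finite:
  "f \<in> schwartz \<Longrightarrow> (\<integral>\<^sup>+x. ennreal (cmod (f x)) \<partial>lborel) < \<infinity>"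
  using schwartz_integrable[of f] by (simp add: integrable_iff_bounded)

lemma nn_integral_lborel_Fubini:
  fixes h :: "'a::euclidean_space \<Rightarrow> 'b::euclidean_space \<Rightarrow> real"
  assumes "continuous_on UNIV (\<lambda>z. h (fst z) (snd z))"
  shows "(\<integral>\<^sup>+x. (\<integral>\<^sup>+y. ennreal (h x y) \<partial>lborel) \<partial>lborel)
      = (\<integral>\<^sup>+y. (\<integral>\<^sup>+x. ennreal (h x y) \<partial>lborel) \<partial>lborel)"
    and "(\<integral>\<^sup>+z. ennreal (h (fst z) (snd z)) \<partial>lborel)
      = (\<integral>\<^sup>+x. (\<integral>\<^sup>+y. ennreal (h x y) \<partial>lborel) \<partial>lborel)"
proof -
  have "(\<lambda>z. h (fst z) (snd z)) \<in> borel_measurable borel"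
    using assms by (rule borel_measurable_continuous_onI)
  then have m: "(\<lambda>z. ennreal (h (fst z) (snd z))) \<in> borel_measurable (lborel \<Otimes>\<^sub>M lborel)"
    by (simp add: lborel_prod)
  show "(\<integral>\<^sup>+x. (\<integral>\<^sup>+y. ennreal (h x y) \<partial>lborel) \<partial>lborel)
      = (\<integral>\<^sup>+y. (\<integral>\<^sup>+x. ennreal (h x y) \<partial>lborel) \<partial>lborel)"
    using lborel_pair.Fubini[OF m] by simp
  show "(\<integral>\<^sup>+z. ennreal (h (fst z) (snd z)) \<partial>lborel)
      = (\<integral>\<^sup>+x. (\<integral>\<^sup>+y. ennreal (h x y) \<partial>lborel) \<partial>lborel)"
    using lborel.nn_integral_fst[OF m] by (simp add: lborel_prod)
qed

text \<open>The reproducing formula writes \<open>f\<close> as a superposition of shifts of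
  \<open>\<phi>\<close> with coefficients \<open>V u\<close>. By covariance the distribution of two
  shifted windows has the modulus of a translate of \<open>W0\<close>, so Tonelli's theorem gives a
  product of L^1 norms and a constant free of \<open>w1\<close> and \<open>w2\<close>.\<close>

lemma tau_wigner_L1_bound:
  fixes \<phi> :: "'a::euclidean_space \<Rightarrow> complex"
  assumes \<phi>: "\<phi> \<in> schwartz" "\<phi> \<noteq> (\<lambda>x. 0)" and \<tau>: "\<tau> \<noteq> 1"
  obtains C :: real where "0 \<le> C" and "\<And>f w1 w2. f \<in> schwartz \<Longrightarrow>
    (\<integral>\<^sup>+z. ennreal (cmod (tau_wigner \<tau> (tf_shift w1 w2 \<phi>) f z)) \<partial>lborel)
      \<le> ennreal C * (\<integral>\<^sup>+u. ennreal (cmod (stft_fun \<phi> f u)) \<partial>lborel)"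
proof -
  obtain k where k0: "k \<noteq> 0" "\<forall>f\<in>schwartz. \<forall>t.
      (\<integral>w. stft_fun \<phi> f w * tf_shift (fst w) (snd w) \<phi> t \<partial>lborel) = k * f t"
    using stft_fun_reproducing[OF \<phi>] by blast
  note k = k0(1) k0(2)[rule_format]
  define W0 where "W0 = tau_wigner \<tau> \<phi> \<phi>"
  have W0: "W0 \<in> schwartz" unfolding W0_def by (intro tau_wigner_schwartz \<phi>)
  define A where "A = (\<integral>\<^sup>+z. ennreal (cmod (W0 z)) \<partial>lborel)"
  have A: "A < \<infinity>" unfolding A_def by (rule nn_integral_schwartz_finite[OF W0])
  have key: "ennreal (cmod k) * (\<integral>\<^sup>+z. ennreal (cmod (tau_wigner \<tau> (tf_shift w1 w2 \<phi>) f z)) \<partial>lborel)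
      \<le> A * (\<integral>\<^sup>+u. ennreal (cmod (stft_fun \<phi> f u)) \<partial>lborel)" if f: "f \<in> schwartz" for f w1 w2
  proof -
    define V where "V = stft_fun \<phi> f"
    have V: "V \<in> schwartz" unfolding V_def by (intro stft_fun_schwartz \<phi> f)
    define g where "g = tf_shift w1 w2 \<phi>"
    have g: "g \<in> schwartz" unfolding g_def by (intro schwartz_tf_shift \<phi>)
    define \<zeta> where "\<zeta> u = (w1 - \<tau> *\<^sub>R (w1 - fst u), \<tau> *\<^sub>R w2 + (1 - \<tau>) *\<^sub>R snd u)" for u :: "'a \<times> 'a"
    have pointwise: "ennreal (cmod k * cmod (tau_wigner \<tau> g f z))
        \<le> (\<integral>\<^sup>+u. ennreal (cmod (V u) * cmod (W0 (z - \<zeta> u))) \<partial>lborel)" for z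
    proof -
      obtain x \<xi> where z: "z = (x, \<xi>)" by fastforce
      define SP where "SP = (\<lambda>z::'a \<times> 'a \<times> 'a. V (snd z) * tf_shift (fst (snd z)) (snd (snd z)) \<phi> (fst z))"
      have SP: "SP \<in> schwartz" unfolding SP_def by (rule schwartz_superposition[OF \<phi>(1) V])
      \<comment> \<open>Here \<open>fst v\<close> is the time variable and \<open>snd v\<close> the
        phase-space variable. Integrating over \<open>snd v\<close> first restores \<open>f\<close>,
        over \<open>fst v\<close> first gives distributions of shifted windows; that
        \<open>F\<close> is jointly Schwartz justifies the exchange.\<close>
      define F where "F = (\<lambda>v::'a \<times> 'a \<times> 'a. g (x + \<tau> *\<^sub>R fst v)
          * cnj (SP (x - (1 - \<tau>) *\<^sub>R fst v, snd v)) * cis (- 2 * pi * (\<xi> \<bullet> fst v)))"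
      have F: "F \<in> schwartz"
      proof -
        define L where "L = (\<lambda>v::'a \<times> 'a \<times> 'a. (\<tau> *\<^sub>R fst v, (- (1 - \<tau>)) *\<^sub>R fst v, snd v))"
        have "linear L" by (simp add: L_def linear_iff algebra_simps)
        moreover have "inj L" using \<tau> by (auto simp: L_def inj_def prod_eq_iff)
        ultimately have S: "(\<lambda>v. (\<lambda>z. g (fst z) * cnj (SP (snd z))) (L v + (x, x, 0))) \<in> schwartz"
          by (intro schwartz_compose_affine schwartz_tensor g schwartz_cnj SP)
        have "F = (\<lambda>v. cis (v \<bullet> (- (2 * pi) *\<^sub>R \<xi>, 0))
            * (\<lambda>z. g (fst z) * cnj (SP (snd z))) (L v + (x, x, 0)))"
          by (simp add: fun_eq_iff F_def L_def inner_prod_def inner_commute algebra_simps)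
        then show ?thesis using schwartz_modulate[OF S] by simp
      qed
      have "cnj k * tau_wigner \<tau> g f z = (\<integral>t. (\<integral>u. F (t, u) \<partial>lborel) \<partial>lborel)"
      proof -
        have "(\<integral>u. F (t, u) \<partial>lborel)
            = cnj k * (g (x + \<tau> *\<^sub>R t) * cnj (f (x - (1 - \<tau>) *\<^sub>R t)) * cis (- 2 * pi * (\<xi> \<bullet> t)))" for t
        proof -
          have "(\<integral>u. F (t, u) \<partial>lborel) = (\<integral>u. (g (x + \<tau> *\<^sub>R t) * cis (- 2 * pi * (\<xi> \<bullet> t)))
              * cnj (SP (x - (1 - \<tau>) *\<^sub>R t, u)) \<partial>lborel)"
            by (simp add: F_def ac_simps)
          also have "\<dots> = (g (x + \<tau> *\<^sub>R t) * cis (- 2 * pi * (\<xi> \<bullet> t)))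
              * cnj (\<integral>u. SP (x - (1 - \<tau>) *\<^sub>R t, u) \<partial>lborel)"
            by simp
          also have "(\<integral>u. SP (x - (1 - \<tau>) *\<^sub>R t, u) \<partial>lborel) = k * f (x - (1 - \<tau>) *\<^sub>R t)"
            using k(2)[OF f] by (simp add: SP_def V_def)
          finally show ?thesis by simp
        qed
        then show ?thesis by (simp add: z tau_wigner_def)
      qed
      also have "\<dots> = (\<integral>u. (\<integral>t. F (t, u) \<partial>lborel) \<partial>lborel)"
        by (rule schwartz_Fubini(2)[OF F, symmetric])
      also have "\<dots> = (\<integral>u. cnj (V u) * tau_wigner \<tau> g (tf_shift (fst u) (snd u) \<phi>) z \<partial>lborel)"
      proof (intro Bochner_Integration.integral_cong refl)
        fix u :: "'a \<times> 'a"
        have "F (t, u) = cnj (V u) * (g (x + \<tau> *\<^sub>R t)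
            * cnj (tf_shift (fst u) (snd u) \<phi> (x - (1 - \<tau>) *\<^sub>R t)) * cis (- 2 * pi * (\<xi> \<bullet> t)))" for t
          by (simp add: F_def SP_def ac_simps)
        then show "(\<integral>t. F (t, u) \<partial>lborel) = cnj (V u) * tau_wigner \<tau> g (tf_shift (fst u) (snd u) \<phi>) z"
          by (simp add: z tau_wigner_def)
      qed
      finally have "cmod k * cmod (tau_wigner \<tau> g f z)
          = cmod (\<integral>u. cnj (V u) * tau_wigner \<tau> g (tf_shift (fst u) (snd u) \<phi>) z \<partial>lborel)"
        by (metis complex_mod_cnj norm_mult)
      also have "ennreal \<dots> \<le> (\<integral>\<^sup>+u. ennreal (cmod (cnj (V u) * tau_wigner \<tau> g (tf_shift (fst u) (snd u) \<phi>) z)) \<partial>lborel)"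
        by (rule cmod_integral_le_nn_integral)
      also have "\<dots> = (\<integral>\<^sup>+u. ennreal (cmod (V u) * cmod (W0 (z - \<zeta> u))) \<partial>lborel)"
        unfolding norm_mult complex_mod_cnj g_def tau_wigner_tf_shift[OF \<phi>(1) \<phi>(1)] \<zeta>_def W0_def ..
      finally show ?thesis .
    qed
    have cont: "continuous_on UNIV (\<lambda>v. cmod (V (snd v)) * cmod (W0 (fst v - \<zeta> (snd v))))"
      unfolding \<zeta>_def
      by (intro continuous_intros schwartz_continuous_on[OF V] schwartz_continuous_on[OF W0])
    have [measurable]: "W0 \<in> borel_measurable borel" by (rule schwartz_measurable[OF W0])
    have [measurable]: "V \<in> borel_measurable borel" by (rule schwartz_measurable[OF V])
    have "ennreal (cmod k) * (\<integral>\<^sup>+z. ennreal (cmod (tau_wigner \<tau> g f z)) \<partial>lborel)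
        = (\<integral>\<^sup>+z. ennreal (cmod k * cmod (tau_wigner \<tau> g f z)) \<partial>lborel)"
      using schwartz_measurable[OF tau_wigner_schwartz[OF g f]]
      by (subst nn_integral_cmult[symmetric]) (auto simp: ennreal_mult)
    also have "\<dots> \<le> (\<integral>\<^sup>+z. (\<integral>\<^sup>+u. ennreal (cmod (V u) * cmod (W0 (z - \<zeta> u))) \<partial>lborel) \<partial>lborel)"
      by (intro nn_integral_mono pointwise)
    also have "\<dots> = (\<integral>\<^sup>+u. (\<integral>\<^sup>+z. ennreal (cmod (V u) * cmod (W0 (z - \<zeta> u))) \<partial>lborel) \<partial>lborel)"
      by (rule nn_integral_lborel_Fubini(1)[OF cont])
    also have "\<dots> = (\<integral>\<^sup>+u. ennreal (cmod (V u)) * A \<partial>lborel)"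
    proof (intro nn_integral_cong)
      fix u :: "'a \<times> 'a"
      have "(\<integral>\<^sup>+z. ennreal (cmod (V u) * cmod (W0 (z - \<zeta> u))) \<partial>lborel)
          = ennreal (cmod (V u)) * (\<integral>\<^sup>+z. ennreal (cmod (W0 (- \<zeta> u + z))) \<partial>lborel)"
        by (subst nn_integral_cmult[symmetric]) (auto simp: ennreal_mult)
      also have "\<dots> = ennreal (cmod (V u)) * A"
        unfolding A_def by (subst nn_integral_lborel_translate) auto
      finally show "(\<integral>\<^sup>+z. ennreal (cmod (V u) * cmod (W0 (z - \<zeta> u))) \<partial>lborel) = ennreal (cmod (V u)) * A" .
    qed
    also have "\<dots> = A * (\<integral>\<^sup>+u. ennreal (cmod (V u)) \<partial>lborel)"
      by (subst nn_integral_multc) (auto simp: mult.commute)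
    finally show ?thesis by (simp add: g_def V_def)
  qed
  obtain A' where A': "0 \<le> A'" "A = ennreal A'" using A by (metis ennreal_cases less_irrefl infinity_ennreal_def)
  show thesis
  proof (rule that[of "A' / cmod k"])
    show "0 \<le> A' / cmod k" using A' by simp
    fix f :: "'a \<Rightarrow> complex" and w1 w2 :: 'a assume f: "f \<in> schwartz"
    let ?X = "\<integral>\<^sup>+z. ennreal (cmod (tau_wigner \<tau> (tf_shift w1 w2 \<phi>) f z)) \<partial>lborel"
    let ?Y = "\<integral>\<^sup>+u. ennreal (cmod (stft_fun \<phi> f u)) \<partial>lborel"
    have "?X = ennreal (1 / cmod k) * (ennreal (cmod k) * ?X)"
      using k(1) by (simp add: mult.assoc[symmetric] ennreal_mult[symmetric])
    also have "\<dots> \<le> ennreal (1 / cmod k) * (A * ?Y)"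
      by (intro mult_left_mono key f) auto
    also have "\<dots> = ennreal (A' / cmod k) * ?Y"
      using A' by (simp add: mult.assoc[symmetric] ennreal_mult[symmetric])
    finally show "?X \<le> ennreal (A' / cmod k) * ?Y" .
  qed
qed

section \<open>Amalgam symbols as functionals bounded in the L^1 norm\<close>

lemma Lp_norm_1: "Lp_norm 1 F = (\<integral>\<^sup>+x. F x \<partial>lborel)"
proof -
  have "ennreal_powr x 1 = x" for x
    by (cases x) (auto simp: ennreal_powr_def)
  then show ?thesis by (simp add: Lp_norm_def)
qed

lemma stft_uminus:
  "stft \<Phi> u \<zeta> (- z) = u (tf_shift \<zeta> z (\<lambda>x. cnj (\<Phi> x)))"
  by (simp add: stft_def dpair_def tf_shift_def cis_cnj)

text \<open>Expanding \<open>\<psi>\<close> in shifts of the conjugated window moves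
  \<open>u\<close> onto these shifts, where the amalgam norm controls it. The transform
  \<open>V\<close> is bounded in the frequency \<open>z\<close> by a window average of
  \<open>\<psi>\<close>, and \<open>K\<close> is integrable in \<open>z\<close> with a bound common
  to almost all \<open>\<zeta>\<close>. Integrating the averages over \<open>\<zeta>\<close> gives
  the L^1 norm of \<open>\<psi>\<close>.\<close>

lemma wiener_amalgam_L1_bound:
  fixes \<Phi> :: "'a::euclidean_space \<Rightarrow> complex"
  assumes \<Phi>: "\<Phi> \<in> schwartz" "\<Phi> \<noteq> (\<lambda>x. 0)" and u: "u \<in> wiener_amalgam \<Phi> 1 \<infinity>"
  obtains C :: real where "0 \<le> C"
    and "\<And>\<psi>. \<psi> \<in> schwartz \<Longrightarrow> ennreal (cmod (u \<psi>)) \<le> ennreal C * (\<integral>\<^sup>+x. ennreal (cmod (\<psi> x)) \<partial>lborel)"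
proof -
  have ut: "u \<in> tempered_distributions" using u by (simp add: wiener_amalgam_def)
  define \<Phi>' where "\<Phi>' = (\<lambda>x. cnj (\<Phi> x))"
  have \<Phi>': "\<Phi>' \<in> schwartz" "\<Phi>' \<noteq> (\<lambda>x. 0)"
    using \<Phi> by (auto simp: \<Phi>'_def schwartz_cnj fun_eq_iff)
  obtain k where k0: "k \<noteq> 0" "\<forall>f\<in>schwartz. \<forall>t.
      (\<integral>w. stft_fun \<Phi>' f w * tf_shift (fst w) (snd w) \<Phi>' t \<partial>lborel) = k * f t"
    using stft_fun_reproducing[OF \<Phi>'] by blast
  note k = k0(1) k0(2)[rule_format]
  define K where "K w = u (tf_shift (fst w) (snd w) \<Phi>')" for w
  \<comment> \<open>Continuity supplies the measurability of \<open>K\<close> that the splitting of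
    the double integral below relies on.\<close>
  have contK: "continuous_on UNIV K"
  proof -
    obtain \<theta>0 where \<theta>0: "\<theta>0 \<in> schwartz" "\<theta>0 \<noteq> (\<lambda>w::'a \<times> 'a. 0)"
      using schwartz_Pair_nonzero[OF \<Phi>] by blast
    show ?thesis
    proof (rule continuous_on_of_schwartz_mult[OF _ \<theta>0])
      fix \<theta> :: "'a \<times> 'a \<Rightarrow> complex" assume \<theta>: "\<theta> \<in> schwartz"
      from tempered_integral(1)[OF ut schwartz_superposition[OF \<Phi>'(1) \<theta>]]
      show "continuous_on UNIV (\<lambda>w. \<theta> w * K w)"
        by (simp add: K_def tempered_cmult[OF ut schwartz_tf_shift[OF \<Phi>'(1)]])
    qed
  qed
  define A where "A = wiener_amalgam_norm \<Phi> 1 \<infinity> u"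
  have A: "A < \<infinity>" using u by (simp add: A_def wiener_amalgam_def)
  \<comment> \<open>The minus sign in the amalgam norm and the conjugation in the pairing cancel, so
    the norm measures \<open>u\<close> exactly on the shifts of the conjugated window.\<close>
  have AE: "AE \<zeta> in lborel. (\<integral>\<^sup>+z. ennreal (cmod (K (\<zeta>, z))) \<partial>lborel) \<le> A"
  proof -
    have "A = esssup lborel (\<lambda>\<zeta>. \<integral>\<^sup>+z. ennreal (cmod (K (\<zeta>, z))) \<partial>lborel)"
      unfolding A_def wiener_amalgam_norm_def Lp_norm_1 stft_uminus K_def \<Phi>'_def
      by (simp add: Lp_norm_def)
    then show ?thesis using esssup_AE by metis
  qed
  define P where "P = (\<integral>\<^sup>+x. ennreal (cmod (\<Phi> x)) \<partial>lborel)"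
  have P: "P < \<infinity>" unfolding P_def by (rule nn_integral_schwartz_finite[OF \<Phi>(1)])
  have key: "ennreal (cmod k * cmod (u \<psi>)) \<le> (A * P) * (\<integral>\<^sup>+x. ennreal (cmod (\<psi> x)) \<partial>lborel)"
    if \<psi>: "\<psi> \<in> schwartz" for \<psi>
  proof -
    define V where "V = stft_fun \<Phi>' \<psi>"
    have V: "V \<in> schwartz" unfolding V_def by (intro stft_fun_schwartz \<Phi>' \<psi>)
    have "k * u \<psi> = u (\<lambda>t. k * \<psi> t)" by (rule tempered_cmult[OF ut \<psi>, symmetric])
    also have "\<dots> = u (\<lambda>t. \<integral>w. V w * tf_shift (fst w) (snd w) \<Phi>' t \<partial>lborel)"
      unfolding V_def k(2)[OF \<psi>] ..
    also have "\<dots> = (\<integral>w. V w * K w \<partial>lborel)"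
      using tempered_integral(2)[OF ut schwartz_superposition[OF \<Phi>'(1) V]]
      by (simp add: K_def tempered_cmult[OF ut schwartz_tf_shift[OF \<Phi>'(1)]])
    finally have "cmod k * cmod (u \<psi>) = cmod (\<integral>w. V w * K w \<partial>lborel)" by (metis norm_mult)
    also have "ennreal \<dots> \<le> (\<integral>\<^sup>+w. ennreal (cmod (V w * K w)) \<partial>lborel)"
      by (rule cmod_integral_le_nn_integral)
    also have "\<dots> = (\<integral>\<^sup>+\<zeta>. (\<integral>\<^sup>+z. ennreal (cmod (V (\<zeta>, z) * K (\<zeta>, z))) \<partial>lborel) \<partial>lborel)"
    proof -
      have "continuous_on UNIV (\<lambda>w. cmod (V w * K w))"
        by (intro continuous_intros contK schwartz_continuous_on[OF V])
      then show ?thesis using nn_integral_lborel_Fubini(2)[of "\<lambda>\<zeta> z. cmod (V (\<zeta>, z) * K (\<zeta>, z))"] by simp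
    qed
    also have "\<dots> \<le> (\<integral>\<^sup>+\<zeta>. (\<integral>\<^sup>+t. ennreal (cmod (\<psi> t) * cmod (\<Phi> (t - \<zeta>))) \<partial>lborel) * A \<partial>lborel)"
    proof (intro nn_integral_mono_AE)
      show "AE \<zeta> in lborel. (\<integral>\<^sup>+z. ennreal (cmod (V (\<zeta>, z) * K (\<zeta>, z))) \<partial>lborel)
          \<le> (\<integral>\<^sup>+t. ennreal (cmod (\<psi> t) * cmod (\<Phi> (t - \<zeta>))) \<partial>lborel) * A"
        using AE
      proof eventually_elim
        case (elim \<zeta>)
        define B where "B = (\<integral>\<^sup>+t. ennreal (cmod (\<psi> t) * cmod (\<Phi> (t - \<zeta>))) \<partial>lborel)"
        have VB: "ennreal (cmod (V (\<zeta>, z))) \<le> B" for z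
        proof -
          have "ennreal (cmod (V (\<zeta>, z))) \<le> (\<integral>\<^sup>+t. ennreal (cmod (\<psi> t * cnj (\<Phi>' (t - \<zeta>)) * cis (- 2 * pi * (z \<bullet> t)))) \<partial>lborel)"
            unfolding V_def stft_fun_eq by (rule cmod_integral_le_nn_integral)
          then show ?thesis by (simp add: B_def norm_mult \<Phi>'_def)
        qed
        have [measurable]: "(\<lambda>z. K (\<zeta>, z)) \<in> borel_measurable borel"
          by (intro borel_measurable_continuous_onI continuous_on_compose2[OF contK] continuous_intros) auto
        have "(\<integral>\<^sup>+z. ennreal (cmod (V (\<zeta>, z) * K (\<zeta>, z))) \<partial>lborel)
            \<le> (\<integral>\<^sup>+z. B * ennreal (cmod (K (\<zeta>, z))) \<partial>lborel)"
          by (intro nn_integral_mono) (simp add: norm_mult ennreal_mult mult_right_mono VB)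
        also have "\<dots> = B * (\<integral>\<^sup>+z. ennreal (cmod (K (\<zeta>, z))) \<partial>lborel)"
          by (rule nn_integral_cmult) simp
        also have "\<dots> \<le> B * A" by (intro mult_left_mono elim) simp
        finally show ?case by (simp add: B_def)
      qed
    qed
    also have "\<dots> = (A * P) * (\<integral>\<^sup>+x. ennreal (cmod (\<psi> x)) \<partial>lborel)"
    proof -
      have [measurable]: "\<psi> \<in> borel_measurable borel" "\<Phi> \<in> borel_measurable borel"
        by (intro schwartz_measurable \<psi> \<Phi>)+
      have cont: "continuous_on UNIV (\<lambda>v. cmod (\<psi> (snd v)) * cmod (\<Phi> (snd v - fst v)))"
        by (intro continuous_intros schwartz_continuous_on[OF \<psi>] schwartz_continuous_on[OF \<Phi>(1)])
      have "(\<integral>\<^sup>+\<zeta>. (\<integral>\<^sup>+t. ennreal (cmod (\<psi> t) * cmod (\<Phi> (t - \<zeta>))) \<partial>lborel) \<partial>lborel)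
          = (\<integral>\<^sup>+t. (\<integral>\<^sup>+\<zeta>. ennreal (cmod (\<psi> t) * cmod (\<Phi> (t - \<zeta>))) \<partial>lborel) \<partial>lborel)"
        by (rule nn_integral_lborel_Fubini(1)[OF cont])
      also have "\<dots> = (\<integral>\<^sup>+t. ennreal (cmod (\<psi> t)) * P \<partial>lborel)"
      proof (intro nn_integral_cong)
        fix t
        have "(\<integral>\<^sup>+\<zeta>. ennreal (cmod (\<psi> t) * cmod (\<Phi> (t - \<zeta>))) \<partial>lborel)
            = ennreal (cmod (\<psi> t)) * (\<integral>\<^sup>+\<zeta>. ennreal (cmod (\<Phi> (t - \<zeta>))) \<partial>lborel)"
          by (subst nn_integral_cmult[symmetric]) (auto simp: ennreal_mult)
        then show "(\<integral>\<^sup>+\<zeta>. ennreal (cmod (\<psi> t) * cmod (\<Phi> (t - \<zeta>))) \<partial>lborel) = ennreal (cmod (\<psi> t)) * P"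
          unfolding P_def by (subst (asm) nn_integral_lborel_reflect) auto
      qed
      also have "\<dots> = (\<integral>\<^sup>+x. ennreal (cmod (\<psi> x)) \<partial>lborel) * P"
        by (rule nn_integral_multc) simp
      finally show ?thesis
      proof (subst nn_integral_multc)
        have "(\<lambda>v. cmod (\<psi> (snd v)) * cmod (\<Phi> (snd v - fst v))) \<in> borel_measurable borel"
          using cont by (rule borel_measurable_continuous_onI)
        then have m: "(\<lambda>v. ennreal (cmod (\<psi> (snd v)) * cmod (\<Phi> (snd v - fst v)))) \<in> borel_measurable (lborel \<Otimes>\<^sub>M lborel)"
          by (simp add: lborel_prod)
        show "(\<lambda>\<zeta>. \<integral>\<^sup>+t. ennreal (cmod (\<psi> t) * cmod (\<Phi> (t - \<zeta>))) \<partial>lborel) \<in> borel_measurable lborel"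
          using lborel.borel_measurable_nn_integral_fst[OF m] by simp
      qed (simp add: ac_simps)
    qed
    finally show ?thesis .
  qed
  have "A * P < \<infinity>" using A P by (simp add: ennreal_mult_less_top)
  then obtain B where B: "0 \<le> B" "A * P = ennreal B" by (metis ennreal_cases less_irrefl infinity_ennreal_def)
  show thesis
  proof (rule that[of "B / cmod k"])
    show "0 \<le> B / cmod k" using B by simp
    fix \<psi> :: "'a \<Rightarrow> complex" assume \<psi>: "\<psi> \<in> schwartz"
    let ?Y = "\<integral>\<^sup>+u. ennreal (cmod (\<psi> u)) \<partial>lborel"
    have "ennreal (cmod (u \<psi>)) = ennreal (1 / cmod k) * ennreal (cmod k * cmod (u \<psi>))"
      using k(1) by (simp add: ennreal_mult[symmetric])
    also have "\<dots> \<le> ennreal (1 / cmod k) * (A * P * ?Y)"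
      by (intro mult_left_mono key \<psi>) auto
    also have "\<dots> = ennreal (B / cmod k) * ?Y"
      using B by (simp add: mult.assoc[symmetric] ennreal_mult[symmetric])
    finally show "ennreal (cmod (u \<psi>)) \<le> ennreal (B / cmod k) * ?Y" .
  qed
qed

section \<open>Size and continuity of the transform of
  \<open>OP_tau \<tau> \<sigma> f\<close>\<close>

lemma stft_OP_tau:
  assumes "\<phi> \<in> schwartz"
  shows "stft \<phi> (OP_tau \<tau> \<sigma> f) x \<xi> = \<sigma> (\<lambda>z. cnj (tau_wigner \<tau> (tf_shift x \<xi> \<phi>) f z))"
  unfolding stft_def dpair_OP_tau[OF schwartz_tf_shift[OF assms]] by (simp add: dpair_def)

lemma OP_tau_stft_bound:
  fixes \<phi> :: "'a::euclidean_space \<Rightarrow> complex" and \<Phi> :: "'a \<times> 'a \<Rightarrow> complex"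
  assumes \<phi>: "\<phi> \<in> schwartz" "\<phi> \<noteq> (\<lambda>x. 0)" and \<Phi>: "\<Phi> \<in> schwartz" "\<Phi> \<noteq> (\<lambda>x. 0)"
    and \<sigma>: "\<sigma> \<in> wiener_amalgam \<Phi> 1 \<infinity>" and \<tau>: "\<tau> \<noteq> 1"
  obtains C :: real where "0 \<le> C" and "\<And>f x \<xi>. f \<in> schwartz \<Longrightarrow>
    ennreal (cmod (stft \<phi> (OP_tau \<tau> \<sigma> f) x \<xi>)) \<le> ennreal C * (\<integral>\<^sup>+u. ennreal (cmod (stft_fun \<phi> f u)) \<partial>lborel)"
proof -
  obtain C1 where C1: "0 \<le> C1" "\<And>\<psi>. \<psi> \<in> schwartz \<Longrightarrow>
      ennreal (cmod (\<sigma> \<psi>)) \<le> ennreal C1 * (\<integral>\<^sup>+x. ennreal (cmod (\<psi> x)) \<partial>lborel)"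
    using wiener_amalgam_L1_bound[OF \<Phi> \<sigma>] by metis
  obtain C2 where C2: "0 \<le> C2" "\<And>f w1 w2. f \<in> schwartz \<Longrightarrow>
      (\<integral>\<^sup>+z. ennreal (cmod (tau_wigner \<tau> (tf_shift w1 w2 \<phi>) f z)) \<partial>lborel)
        \<le> ennreal C2 * (\<integral>\<^sup>+u. ennreal (cmod (stft_fun \<phi> f u)) \<partial>lborel)"
    using tau_wigner_L1_bound[OF \<phi> \<tau>] by metis
  show thesis
  proof (rule that[of "C1 * C2"])
    show "0 \<le> C1 * C2" using C1 C2 by simp
    fix f :: "'a \<Rightarrow> complex" and x \<xi> assume f: "f \<in> schwartz"
    have W: "(\<lambda>z. cnj (tau_wigner \<tau> (tf_shift x \<xi> \<phi>) f z)) \<in> schwartz"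
      by (intro schwartz_cnj tau_wigner_schwartz schwartz_tf_shift \<phi> f)
    have "ennreal (cmod (stft \<phi> (OP_tau \<tau> \<sigma> f) x \<xi>))
        \<le> ennreal C1 * (\<integral>\<^sup>+z. ennreal (cmod (tau_wigner \<tau> (tf_shift x \<xi> \<phi>) f z)) \<partial>lborel)"
      unfolding stft_OP_tau[OF \<phi>(1)] using C1(2)[OF W] by simp
    also have "\<dots> \<le> ennreal C1 * (ennreal C2 * (\<integral>\<^sup>+u. ennreal (cmod (stft_fun \<phi> f u)) \<partial>lborel))"
      by (intro mult_left_mono C2 f) auto
    also have "\<dots> = ennreal (C1 * C2) * (\<integral>\<^sup>+u. ennreal (cmod (stft_fun \<phi> f u)) \<partial>lborel)"
      using C1(1) C2(1) by (simp add: ennreal_mult mult.assoc)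
    finally show "ennreal (cmod (stft \<phi> (OP_tau \<tau> \<sigma> f) x \<xi>))
        \<le> ennreal (C1 * C2) * (\<integral>\<^sup>+u. ennreal (cmod (stft_fun \<phi> f u)) \<partial>lborel)" .
  qed
qed

text \<open>Comparing target norms presupposes measurability, since \<open>esssup\<close> takes the
  value top on functions that are not measurable. Continuity is proved for the product with an
  arbitrary Schwartz function \<open>\<theta>\<close>, because then the symbol acts on slices of a
  function that is Schwartz in the phase-space variable and the shift together.\<close>

lemma OP_tau_stft_continuous:
  fixes \<phi> :: "'a::euclidean_space \<Rightarrow> complex"
  assumes \<phi>: "\<phi> \<in> schwartz" "\<phi> \<noteq> (\<lambda>x. 0)" and f: "f \<in> schwartz"
    and \<sigma>: "\<sigma> \<in> tempered_distributions"
  shows "continuous_on UNIV (\<lambda>w. stft \<phi> (OP_tau \<tau> \<sigma> f) (fst w) (snd w))"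
proof -
  obtain \<theta>0 where \<theta>0: "\<theta>0 \<in> schwartz" "\<theta>0 \<noteq> (\<lambda>w::'a \<times> 'a. 0)"
    using schwartz_Pair_nonzero[OF \<phi>] by blast
  show ?thesis
  proof (rule continuous_on_of_schwartz_mult[OF _ \<theta>0])
    fix \<theta> :: "'a \<times> 'a \<Rightarrow> complex" assume \<theta>: "\<theta> \<in> schwartz"
    \<comment> \<open>\<open>\<theta>\<close> is conjugated because the conjugation in
      \<open>G\<close> undoes it.\<close>
    define SP where "SP = (\<lambda>z::'a \<times> 'a \<times> 'a. cnj (\<theta> (snd z)) * tf_shift (fst (snd z)) (snd (snd z)) \<phi> (fst z))"
    have SP: "SP \<in> schwartz" unfolding SP_def by (rule schwartz_superposition[OF \<phi>(1) schwartz_cnj[OF \<theta>]])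
    \<comment> \<open>The shift and the position are packed into the first component as parameters,
      since \<open>pft\<close> transforms the second one; \<open>G\<close> then regroups the
      variables as phase-space point and shift.\<close>
    define F where "F = (\<lambda>v::(('a \<times> 'a) \<times> 'a) \<times> 'a.
      SP (snd (fst v) + \<tau> *\<^sub>R snd v, fst (fst v)) * cnj (f (snd (fst v) - (1 - \<tau>) *\<^sub>R snd v)))"
    have F: "F \<in> schwartz"
    proof -
      define L where "L = (\<lambda>v::(('a \<times> 'a) \<times> 'a) \<times> 'a.
        ((snd (fst v) + \<tau> *\<^sub>R snd v, fst (fst v)), snd (fst v) - (1 - \<tau>) *\<^sub>R snd v))"
      have "linear L" by (simp add: L_def linear_iff algebra_simps)
      moreover have "inj L"
      proof (rule injI)
        fix v w assume eq: "L v = L w"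
        have "snd v = fst (fst (L v)) - snd (L v)" for v by (simp add: L_def algebra_simps)
        then have "snd v = snd w" using eq by metis
        then show "v = w" using eq by (simp add: L_def prod_eq_iff)
      qed
      ultimately show ?thesis
        using schwartz_compose_affine[OF schwartz_tensor[OF SP schwartz_cnj[OF f]], of L 0]
        by (simp add: L_def F_def)
    qed
    define G where "G = (\<lambda>v::('a \<times> 'a) \<times> ('a \<times> 'a). cnj (pft F ((snd v, fst (fst v)), snd (fst v))))"
    have G: "G \<in> schwartz"
    proof -
      have "inj (\<lambda>v::('a \<times> 'a) \<times> ('a \<times> 'a). ((snd v, fst (fst v)), snd (fst v)))"
        by (auto simp: inj_def)
      then show ?thesis
        using schwartz_compose_affine[OF schwartz_cnj[OF pft_schwartz[OF F]],
            of "\<lambda>v. ((snd v, fst (fst v)), snd (fst v))" 0]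
        by (simp add: linear_iff G_def)
    qed
    have "G (z, w) = \<theta> w * cnj (tau_wigner \<tau> (tf_shift (fst w) (snd w) \<phi>) f z)" for z w
    proof -
      obtain x \<xi> where z: "z = (x, \<xi>)" by fastforce
      have "pft F ((w, x), \<xi>) = (\<integral>t. cnj (\<theta> w) * (tf_shift (fst w) (snd w) \<phi> (x + \<tau> *\<^sub>R t)
          * cnj (f (x - (1 - \<tau>) *\<^sub>R t)) * cis (- 2 * pi * (\<xi> \<bullet> t))) \<partial>lborel)"
        by (simp add: pft_def F_def SP_def mult.assoc)
      also have "\<dots> = cnj (\<theta> w) * tau_wigner \<tau> (tf_shift (fst w) (snd w) \<phi>) f z"
        by (simp add: z tau_wigner_def)
      finally show ?thesis by (simp add: G_def z)
    qed
    then have "\<sigma> (\<lambda>z. G (z, w)) = \<theta> w * stft \<phi> (OP_tau \<tau> \<sigma> f) (fst w) (snd w)" for w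
      unfolding stft_OP_tau[OF \<phi>(1)]
      by (simp add: tempered_cmult[OF \<sigma>] schwartz_cnj tau_wigner_schwartz schwartz_tf_shift \<phi> f)
    with tempered_integral(1)[OF \<sigma> G]
    show "continuous_on UNIV (\<lambda>w. \<theta> w * stft \<phi> (OP_tau \<tau> \<sigma> f) (fst w) (snd w))" by simp
  qed
qed

section \<open>Chirp symbols\<close>

lemma dist_of_tempered:
  fixes m :: "'a::euclidean_space \<Rightarrow> complex"
  assumes m: "m \<in> borel_measurable borel" and bdd: "\<And>x. cmod (m x) \<le> 1"
  shows "dist_of m \<in> tempered_distributions"
proof -
  have int: "integrable lborel (\<lambda>x. m x * f x)" if "f \<in> schwartz" for f
    by (rule Bochner_Integration.integrable_bound[OF schwartz_integrable[OF that]])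
       (use m bdd schwartz_measurable[OF that] in \<open>auto simp: norm_mult mult_left_le_one_le\<close>)
  define N where "N = Suc DIM('a)"
  define C where "C = (\<integral>x. 1 / jbracket x ^ N \<partial>(lborel :: 'a measure))"
  have bound: "cmod (dist_of m f) \<le> C * schwartz_seminorm N f" if f: "f \<in> schwartz" for f
  proof -
    have Nint: "integrable lborel (\<lambda>x::'a. schwartz_seminorm N f * (1 / jbracket x ^ N))"
      unfolding N_def by (intro integrable_mult_right integrable_inverse_jbracket) simp
    have "cmod (\<integral>x. m x * f x \<partial>lborel) \<le> (\<integral>x. schwartz_seminorm N f * (1 / jbracket x ^ N) \<partial>(lborel :: 'a measure))"
    proof (rule Bochner_Integration.integral_norm_bound_integral[OF int[OF f] Nint])
      fix x
      have "cmod (m x * f x) \<le> cmod (f x)"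
        using bdd[of x] by (simp add: norm_mult mult_left_le_one_le)
      also have "\<dots> \<le> schwartz_seminorm N f * (1 / jbracket x ^ N)"
        using le_schwartz_seminorm[OF f, of x N] by (simp add: field_simps)
      finally show "cmod (m x * f x) \<le> schwartz_seminorm N f * (1 / jbracket x ^ N)" .
    qed
    also have "\<dots> = C * schwartz_seminorm N f"
      unfolding C_def by (simp only: integral_mult_right_zero mult.commute)
    finally show ?thesis using f by (simp add: dist_of_def)
  qed
  show ?thesis
    unfolding tempered_distributions_def
  proof (intro CollectI conjI ballI allI impI)
    show "dist_of m (\<lambda>x. f x + g x) = dist_of m f + dist_of m g" if "f \<in> schwartz" "g \<in> schwartz" for f g
      using that by (simp add: dist_of_def schwartz_add int distrib_left)
    show "dist_of m (\<lambda>x. c * f x) = c * dist_of m f" if "f \<in> schwartz" for f c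
    proof -
      have "(\<lambda>x. m x * (c * f x)) = (\<lambda>x. c * (m x * f x))" by (simp add: ac_simps)
      then show ?thesis using that by (simp add: dist_of_def schwartz_cmult)
    qed
    show "\<exists>N C. \<forall>f\<in>schwartz. cmod (dist_of m f) \<le> C * schwartz_seminorm N f"
      using bound by blast
  qed (simp add: dist_of_def)
qed

definition chirp :: "real \<Rightarrow> 'a::euclidean_space \<times> 'a \<Rightarrow> complex" where
  "chirp c = (\<lambda>z. cis (2 * pi * c * (fst z \<bullet> snd z)))"

lemma chirp_tempered: "dist_of (chirp c) \<in> tempered_distributions"
proof (rule dist_of_tempered)
  show "chirp c \<in> borel_measurable borel"
    unfolding chirp_def by (intro borel_measurable_continuous_onI continuous_intros)
qed (simp add: chirp_def)

text \<open>Translating a chirp only multiplies it by a character, so the inner norm does not depend on the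
  window position.\<close>

lemma chirp_wiener_amalgam:
  fixes \<Phi> :: "'a::euclidean_space \<times> 'a \<Rightarrow> complex"
  assumes \<Phi>: "\<Phi> \<in> schwartz"
  shows "dist_of (chirp c) \<in> wiener_amalgam \<Phi> 1 \<infinity>"
proof -
  define \<Phi>' where "\<Phi>' = (\<lambda>y. cnj (\<Phi> y))"
  have \<Phi>': "\<Phi>' \<in> schwartz" unfolding \<Phi>'_def by (rule schwartz_cnj[OF \<Phi>])
  define h where "h = (\<lambda>y. chirp c y * \<Phi>' y)"
  have h: "h \<in> schwartz" unfolding h_def chirp_def by (rule schwartz_chirp[OF \<Phi>'])
  define H where "H = fourier h"
  have H: "H \<in> schwartz" unfolding H_def by (rule fourier_schwartz[OF h])
  have stft: "cmod (stft \<Phi> (dist_of (chirp c)) \<zeta> (- z)) = cmod (H (- c *\<^sub>R (snd \<zeta>, fst \<zeta>) - z))" for \<zeta> z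
  proof -
    \<comment> \<open>The cross terms of the bilinear phase at \<open>\<zeta> + y\<close> form a
      character in \<open>y\<close> whose frequency is \<open>c\<close> times \<open>\<zeta>\<close>
      with its components exchanged; the modulation contributes \<open>z\<close>.\<close>
    define a where "a = - c *\<^sub>R (snd \<zeta>, fst \<zeta>) - z"
    define q where "q = cis (2 * pi * (c * (fst \<zeta> \<bullet> snd \<zeta>) + \<zeta> \<bullet> z))"
    have S: "(\<lambda>y. chirp c y * tf_shift \<zeta> z \<Phi>' y) \<in> schwartz"
      unfolding chirp_def by (rule schwartz_chirp[OF schwartz_tf_shift[OF \<Phi>']])
    have "stft \<Phi> (dist_of (chirp c)) \<zeta> (- z) = (\<integral>y. chirp c y * tf_shift \<zeta> z \<Phi>' y \<partial>lborel)"
      unfolding stft_uminus by (simp add: dist_of_def schwartz_tf_shift[OF \<Phi>'] flip: \<Phi>'_def)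
    also have "\<dots> = (\<integral>y. chirp c (\<zeta> + y) * tf_shift \<zeta> z \<Phi>' (\<zeta> + y) \<partial>lborel)"
      by (rule integral_lborel_translate[OF schwartz_measurable[OF S], symmetric])
    also have "\<dots> = (\<integral>y. q * (h y * cis (- 2 * pi * (a \<bullet> y))) \<partial>lborel)"
    proof (intro Bochner_Integration.integral_cong refl)
      fix y
      have "chirp c (\<zeta> + y) * cis (2 * pi * ((\<zeta> + y) \<bullet> z)) = q * (chirp c y * cis (- 2 * pi * (a \<bullet> y)))"
        unfolding chirp_def q_def a_def cis_mult
        by (rule arg_cong[of _ _ cis]) (simp add: inner_prod_def inner_commute algebra_simps)
      then show "chirp c (\<zeta> + y) * tf_shift \<zeta> z \<Phi>' (\<zeta> + y) = q * (h y * cis (- 2 * pi * (a \<bullet> y)))"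
        by (simp add: tf_shift_def h_def mult.assoc[symmetric])
    qed
    also have "\<dots> = q * H a" by (simp add: H_def fourier_def)
    finally show ?thesis by (simp add: q_def a_def norm_mult)
  qed
  have "wiener_amalgam_norm \<Phi> 1 \<infinity> (dist_of (chirp c))
      = esssup lborel (\<lambda>\<zeta>::'a \<times> 'a. \<integral>\<^sup>+z. ennreal (cmod (H (- c *\<^sub>R (snd \<zeta>, fst \<zeta>) - z))) \<partial>lborel)"
    unfolding wiener_amalgam_norm_def Lp_norm_1 stft by (simp add: Lp_norm_def)
  also have "\<dots> = esssup lborel (\<lambda>\<zeta>::'a \<times> 'a. \<integral>\<^sup>+z. ennreal (cmod (H z)) \<partial>lborel)"
  proof -
    have [measurable]: "H \<in> borel_measurable borel" by (rule schwartz_measurable[OF H])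
    show ?thesis by (subst nn_integral_lborel_reflect[of "\<lambda>z. ennreal (cmod (H z))"]) simp_all
  qed
  also have "\<dots> \<le> (\<integral>\<^sup>+z. ennreal (cmod (H z)) \<partial>lborel)"
    by (rule esssup_I) auto
  also have "\<dots> < \<infinity>" by (rule nn_integral_schwartz_finite[OF H])
  finally show ?thesis by (simp add: wiener_amalgam_def chirp_tempered)
qed

text \<open>Integrating the chirp against the conjugated distribution over \<xi> is Fourier
  inversion at the time \<open>- c *\<^sub>R x\<close>, so the inner integral collapses to one value
  of the product of \<open>g\<close> and \<open>f\<close>. The two dilations are the arguments of
  that product at this time.\<close>

lemma chirp_tau_wigner:
  fixes \<phi> :: "'a::euclidean_space \<Rightarrow> complex"
  assumes \<phi>: "\<phi> \<in> schwartz" "\<phi> \<noteq> (\<lambda>x. 0)"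
  shows "\<exists>k. k \<noteq> 0 \<and> (\<forall>f\<in>schwartz. \<forall>g\<in>schwartz. \<forall>c \<tau>.
    dpair (dist_of (chirp c)) (tau_wigner \<tau> g f)
      = k * (\<integral>x. cnj (g ((1 - \<tau> * c) *\<^sub>R x)) * f ((1 + (1 - \<tau>) * c) *\<^sub>R x :: 'a) \<partial>lborel))"
proof -
  obtain \<kappa> where \<kappa>0: "\<kappa> \<noteq> 0" "\<forall>h\<in>schwartz. \<forall>t::'a.
      (\<integral>\<xi>. fourier h \<xi> * cis (2 * pi * (\<xi> \<bullet> t)) \<partial>lborel) = \<kappa> * h t"
    using fourier_inversion[OF \<phi>] by blast
  note \<kappa> = \<kappa>0(2)[rule_format]
  have "dpair (dist_of (chirp c)) (tau_wigner \<tau> g f)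
      = cnj \<kappa> * (\<integral>x. cnj (g ((1 - \<tau> * c) *\<^sub>R x)) * f ((1 + (1 - \<tau>) * c) *\<^sub>R x) \<partial>lborel)"
    if f: "f \<in> schwartz" and g: "g \<in> schwartz" for f g :: "'a \<Rightarrow> complex" and c \<tau>
  proof -
    have W: "tau_wigner \<tau> g f \<in> schwartz" by (rule tau_wigner_schwartz[OF g f])
    define F where "F = (\<lambda>z. chirp c z * cnj (tau_wigner \<tau> g f z))"
    have F: "F \<in> schwartz" unfolding F_def chirp_def by (intro schwartz_chirp schwartz_cnj W)
    have "dpair (dist_of (chirp c)) (tau_wigner \<tau> g f) = (\<integral>z. F z \<partial>lborel)"
      by (simp add: dpair_dist_of[OF W] F_def)
    also have "\<dots> = (\<integral>x. (\<integral>\<xi>. F (x, \<xi>) \<partial>lborel) \<partial>lborel)"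
      by (rule schwartz_Fubini(1)[OF F])
    also have "\<dots> = (\<integral>x. cnj \<kappa> * (cnj (g ((1 - \<tau> * c) *\<^sub>R x)) * f ((1 + (1 - \<tau>) * c) *\<^sub>R x)) \<partial>lborel)"
    proof (intro Bochner_Integration.integral_cong refl)
      fix x
      define h where "h = (\<lambda>t. g (x + \<tau> *\<^sub>R t) * cnj (f (x - (1 - \<tau>) *\<^sub>R t)))"
      have h: "h \<in> schwartz"
        using schwartz_slice_snd[OF tau_wigner_integrand[OF g f], of x] by (simp add: h_def)
      have "F (x, \<xi>) = cnj (fourier h \<xi> * cis (2 * pi * (\<xi> \<bullet> (- c *\<^sub>R x))))" for \<xi>
        by (simp add: F_def chirp_def tau_wigner_def fourier_def h_def cis_cnj inner_commute ac_simps)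
      then have "(\<integral>\<xi>. F (x, \<xi>) \<partial>lborel)
          = cnj (\<integral>\<xi>. fourier h \<xi> * cis (2 * pi * (\<xi> \<bullet> (- c *\<^sub>R x))) \<partial>lborel)"
        by (simp only: Bochner_Integration.integral_cnj)
      also have "\<dots> = cnj (\<kappa> * h (- c *\<^sub>R x))" by (simp only: \<kappa>[OF h])
      also have "\<dots> = cnj \<kappa> * (cnj (g ((1 - \<tau> * c) *\<^sub>R x)) * f ((1 + (1 - \<tau>) * c) *\<^sub>R x))"
        by (simp add: h_def algebra_simps)
      finally show "(\<integral>\<xi>. F (x, \<xi>) \<partial>lborel)
          = cnj \<kappa> * (cnj (g ((1 - \<tau> * c) *\<^sub>R x)) * f ((1 + (1 - \<tau>) * c) *\<^sub>R x))" .
    qed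
    finally show ?thesis by simp
  qed
  moreover have "cnj \<kappa> \<noteq> 0" using \<kappa>0(1) by simp
  ultimately show ?thesis by blast
qed

section \<open>Rank-one operators from degenerate chirps\<close>

lemma integral_scale_divide:
  fixes f :: "'a::euclidean_space \<Rightarrow> complex"
  assumes "f \<in> schwartz" "a > 0"
  shows "(\<integral>x. f ((1 / a) *\<^sub>R x) \<partial>lborel) = of_real (a ^ DIM('a)) * (\<integral>x. f x \<partial>lborel)"
proof -
  have "(\<integral>x. f ((1 / a) *\<^sub>R x) \<partial>lborel) = \<bar>a\<bar> ^ DIM('a) *\<^sub>R (\<integral>x. f ((1 / a) *\<^sub>R a *\<^sub>R x) \<partial>lborel)"
    by (rule integral_lborel_scale)
       (use schwartz_measurable[OF schwartz_scale[OF assms(1), of "1 / a"]] assms(2) in auto)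
  then show ?thesis using assms(2) by (simp add: scaleR_conv_of_real)
qed

text \<open>With \<open>c = 1 / \<tau>\<close> the operator is \<open>f \<mapsto> const * (\<integral> f) \<delta>_0\<close>, with \<open>c = - 1 / (1 - \<tau>)\<close> it is
  \<open>f \<mapsto> const * f(0)\<close>.\<close>

lemma stft_OP_tau_chirp_delta:
  fixes \<phi> :: "'a::euclidean_space \<Rightarrow> complex"
  assumes \<phi>: "\<phi> \<in> schwartz" "\<phi> \<noteq> (\<lambda>x. 0)" and \<tau>: "0 < \<tau>"
  shows "\<exists>k>0. \<forall>f\<in>schwartz. \<forall>x \<xi>.
    cmod (stft \<phi> (OP_tau \<tau> (dist_of (chirp (1 / \<tau>))) f) x \<xi>) = k * cmod (\<integral>y. f y \<partial>lborel) * cmod (\<phi> (- x))"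
proof -
  obtain \<kappa> where \<kappa>: "\<kappa> \<noteq> 0" "\<forall>f\<in>schwartz. \<forall>g\<in>schwartz. \<forall>c \<tau>.
    dpair (dist_of (chirp c)) (tau_wigner \<tau> g f)
      = \<kappa> * (\<integral>x. cnj (g ((1 - \<tau> * c) *\<^sub>R x)) * f ((1 + (1 - \<tau>) * c) *\<^sub>R x :: 'a) \<partial>lborel)"
    using chirp_tau_wigner[OF \<phi>] by blast
  have "cmod (stft \<phi> (OP_tau \<tau> (dist_of (chirp (1 / \<tau>))) f) x \<xi>)
      = (cmod \<kappa> * \<tau> ^ DIM('a)) * cmod (\<integral>y. f y \<partial>lborel) * cmod (\<phi> (- x))" if f: "f \<in> schwartz" for f x \<xi>
  proof -
    have g: "tf_shift x \<xi> \<phi> \<in> schwartz" by (rule schwartz_tf_shift[OF \<phi>(1)])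
    \<comment> \<open>The dilation of the test function degenerates: it is evaluated at 0 while a
      dilate of \<open>f\<close> is integrated.\<close>
    have e: "1 - \<tau> * (1 / \<tau>) = 0" "1 + (1 - \<tau>) * (1 / \<tau>) = 1 / \<tau>"
      using \<tau> by (simp_all add: field_simps)
    have "stft \<phi> (OP_tau \<tau> (dist_of (chirp (1 / \<tau>))) f) x \<xi>
        = \<kappa> * (\<integral>y. cnj (tf_shift x \<xi> \<phi> (0 *\<^sub>R y)) * f ((1 / \<tau>) *\<^sub>R y) \<partial>lborel)"
      unfolding stft_def dpair_OP_tau[OF g] using \<kappa>(2)[rule_format, OF f g, of "1 / \<tau>" \<tau>] unfolding e .
    also have "\<dots> = \<kappa> * (cnj (tf_shift x \<xi> \<phi> 0) * (of_real (\<tau> ^ DIM('a)) * (\<integral>y. f y \<partial>lborel)))"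
      using integral_scale_divide[OF f \<tau>] by simp
    finally show ?thesis using \<tau> by (simp add: norm_mult norm_power tf_shift_def)
  qed
  moreover have "cmod \<kappa> * \<tau> ^ DIM('a) > 0" using \<kappa>(1) \<tau> by simp
  ultimately show ?thesis by blast
qed

lemma stft_OP_tau_chirp_const:
  fixes \<phi> :: "'a::euclidean_space \<Rightarrow> complex"
  assumes \<phi>: "\<phi> \<in> schwartz" "\<phi> \<noteq> (\<lambda>x. 0)" and \<tau>: "\<tau> < 1"
  shows "\<exists>k>0. \<forall>f\<in>schwartz. \<forall>x \<xi>.
    cmod (stft \<phi> (OP_tau \<tau> (dist_of (chirp (- (1 / (1 - \<tau>))))) f) x \<xi>)
      = k * cmod (f 0) * cmod (fourier \<phi> (- \<xi>))"
proof -
  obtain \<kappa> where \<kappa>: "\<kappa> \<noteq> 0" "\<forall>f\<in>schwartz. \<forall>g\<in>schwartz. \<forall>c \<tau>.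
    dpair (dist_of (chirp c)) (tau_wigner \<tau> g f)
      = \<kappa> * (\<integral>x. cnj (g ((1 - \<tau> * c) *\<^sub>R x)) * f ((1 + (1 - \<tau>) * c) *\<^sub>R x :: 'a) \<partial>lborel)"
    using chirp_tau_wigner[OF \<phi>] by blast
  have "cmod (stft \<phi> (OP_tau \<tau> (dist_of (chirp (- (1 / (1 - \<tau>))))) f) x \<xi>)
      = (cmod \<kappa> * (1 - \<tau>) ^ DIM('a)) * cmod (f 0) * cmod (fourier \<phi> (- \<xi>))" if f: "f \<in> schwartz" for f x \<xi>
  proof -
    have g: "tf_shift x \<xi> \<phi> \<in> schwartz" by (rule schwartz_tf_shift[OF \<phi>(1)])
    \<comment> \<open>Now the dilation of \<open>f\<close> degenerates, and the test function is
      integrated, which gives a value of the Fourier transform of the window.\<close>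
    have e: "1 - \<tau> * (- (1 / (1 - \<tau>))) = 1 / (1 - \<tau>)" "1 + (1 - \<tau>) * (- (1 / (1 - \<tau>))) = 0"
      using \<tau> by (simp_all add: field_simps)
    have "stft \<phi> (OP_tau \<tau> (dist_of (chirp (- (1 / (1 - \<tau>))))) f) x \<xi>
        = \<kappa> * (\<integral>y. cnj (tf_shift x \<xi> \<phi> ((1 / (1 - \<tau>)) *\<^sub>R y)) * f (0 *\<^sub>R y) \<partial>lborel)"
      unfolding stft_def dpair_OP_tau[OF g]
      using \<kappa>(2)[rule_format, OF f g, of "- (1 / (1 - \<tau>))" \<tau>] unfolding e .
    also have "\<dots> = \<kappa> * (of_real ((1 - \<tau>) ^ DIM('a)) * (\<integral>y. cnj (tf_shift x \<xi> \<phi> y) \<partial>lborel) * f 0)"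
      using integral_scale_divide[OF schwartz_cnj[OF g], of "1 - \<tau>"] \<tau> by simp
    also have "(\<integral>y. cnj (tf_shift x \<xi> \<phi> y) \<partial>lborel) = cnj (\<integral>y. tf_shift x \<xi> \<phi> y \<partial>lborel)" by simp
    also have "(\<integral>y. tf_shift x \<xi> \<phi> y \<partial>lborel) = (\<integral>y. tf_shift x \<xi> \<phi> (x + y) \<partial>lborel)"
      by (rule integral_lborel_translate[OF schwartz_measurable[OF g], symmetric])
    also have "\<dots> = (\<integral>y. cis (2 * pi * (x \<bullet> \<xi>)) * (\<phi> y * cis (- 2 * pi * ((- \<xi>) \<bullet> y))) \<partial>lborel)"
    proof (intro Bochner_Integration.integral_cong refl)
      fix y
      have "cis (2 * pi * ((x + y) \<bullet> \<xi>)) = cis (2 * pi * (x \<bullet> \<xi>)) * cis (- 2 * pi * ((- \<xi>) \<bullet> y))"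
        unfolding cis_mult by (rule arg_cong[of _ _ cis]) (simp add: inner_commute algebra_simps)
      then show "tf_shift x \<xi> \<phi> (x + y) = cis (2 * pi * (x \<bullet> \<xi>)) * (\<phi> y * cis (- 2 * pi * ((- \<xi>) \<bullet> y)))"
        by (simp add: tf_shift_def)
    qed
    also have "\<dots> = cis (2 * pi * (x \<bullet> \<xi>)) * fourier \<phi> (- \<xi>)"
      unfolding fourier_def by (rule integral_mult_right_zero)
    finally show ?thesis using \<tau> by (simp add: norm_mult del: of_real_power of_real_diff)
  qed
  moreover have "cmod \<kappa> * (1 - \<tau>) ^ DIM('a) > 0" using \<kappa>(1) \<tau> by simp
  ultimately show ?thesis by blast
qed

lemma fourier_nonzero:
  fixes \<phi> :: "'a::euclidean_space \<Rightarrow> complex"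
  assumes \<phi>: "\<phi> \<in> schwartz" "\<phi> \<noteq> (\<lambda>x. 0)"
  shows "fourier \<phi> \<noteq> (\<lambda>x. 0)"
proof
  obtain \<kappa> where \<kappa>: "\<kappa> \<noteq> 0" "\<forall>h\<in>schwartz. \<forall>t::'a.
      (\<integral>\<xi>. fourier h \<xi> * cis (2 * pi * (\<xi> \<bullet> t)) \<partial>lborel) = \<kappa> * h t"
    using fourier_inversion[OF \<phi>] by blast
  assume "fourier \<phi> = (\<lambda>x. 0)"
  then have "\<phi> t = 0" for t using \<kappa>(2)[rule_format, OF \<phi>(1), of t] \<kappa>(1) by simp
  with \<phi>(2) show False by auto
qed

section \<open>Lebesgue norms of weights\<close>

lemma ennreal_powr_ennreal: "0 \<le> a \<Longrightarrow> ennreal_powr (ennreal a) r = ennreal (a powr r)"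
  by (simp add: ennreal_powr_def)

lemma ennreal_powr_top: "ennreal_powr top r = top"
  by (simp add: ennreal_powr_def)

lemma ennreal_powr_0: "ennreal_powr 0 r = 0"
  by (simp add: ennreal_powr_def)

lemma ennreal_powr_mult: "ennreal_powr (x * y) r = ennreal_powr x r * ennreal_powr y r"
proof (cases x; cases y)
  fix a b assume "0 \<le> a" "x = ennreal a" "0 \<le> b" "y = ennreal b"
  then show ?thesis by (simp add: ennreal_powr_ennreal powr_mult flip: ennreal_mult)
next
  fix a assume "0 \<le> a" "x = ennreal a" "y = top"
  then show ?thesis
    by (cases "a = 0") (auto simp: ennreal_powr_ennreal ennreal_powr_top ennreal_mult_top ennreal_powr_0)
next
  fix b assume "x = top" "0 \<le> b" "y = ennreal b"
  then show ?thesis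
    by (cases "b = 0") (auto simp: ennreal_powr_ennreal ennreal_powr_top ennreal_top_mult ennreal_powr_0)
qed (simp add: ennreal_powr_top)

lemma ennreal_powr_mono: "x \<le> y \<Longrightarrow> 0 \<le> r \<Longrightarrow> ennreal_powr x r \<le> ennreal_powr y r"
  by (cases x; cases y) (auto simp: ennreal_powr_ennreal ennreal_powr_top powr_mono2 top_unique)

lemma ennreal_powr_powr_inverse: "r > 0 \<Longrightarrow> ennreal_powr (ennreal_powr x r) (1 / r) = x"
  by (cases x) (auto simp: ennreal_powr_ennreal ennreal_powr_top powr_powr)

lemma ennreal_powr_inverse_powr: "r > 0 \<Longrightarrow> ennreal_powr (ennreal_powr x (1 / r)) r = x"
  by (cases x) (auto simp: ennreal_powr_ennreal ennreal_powr_top powr_powr)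

lemma ennreal_powr_less_top: "ennreal_powr x r < top \<longleftrightarrow> x < top"
  by (cases x) (auto simp: ennreal_powr_ennreal ennreal_powr_top)

lemma ennreal_powr_eq_0: "ennreal_powr x r = 0 \<longleftrightarrow> x = 0"
  by (cases x) (auto simp: ennreal_powr_ennreal ennreal_powr_top)

lemma measurable_ennreal_powr [measurable]: "(\<lambda>x. ennreal_powr x r) \<in> borel_measurable borel"
  unfolding ennreal_powr_def by measurable

section \<open>Lebesgue norms with extended values\<close>

lemma exponent_cases:
  assumes "1 \<le> (p :: ereal)"
  obtains "p = \<infinity>" | r where "p = ereal r" "1 \<le> r"
  using assms by (cases p) auto

lemma Lp_norm_infinity: "Lp_norm \<infinity> F = esssup lborel F"
  by (simp add: Lp_norm_def)

lemma Lp_norm_ereal: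
  "Lp_norm (ereal r) F = ennreal_powr (\<integral>\<^sup>+x. ennreal_powr (F x) r \<partial>lborel) (1 / r)"
  by (simp add: Lp_norm_def)

lemma esssup_le_iff:
  assumes "F \<in> borel_measurable M"
  shows "esssup M F \<le> (c :: ennreal) \<longleftrightarrow> (AE x in M. F x \<le> c)"
proof
  assume c: "esssup M F \<le> c"
  show "AE x in M. F x \<le> c"
    using esssup_AE[of F M] by eventually_elim (use c in auto)
qed (use assms in \<open>auto intro: esssup_I\<close>)

lemma Lp_norm_mono:
  assumes "1 \<le> p" "F \<in> borel_measurable borel" "\<And>x. F x \<le> G x"
  shows "Lp_norm p F \<le> Lp_norm p G"
  using assms(1)
proof (cases rule: exponent_cases)
  case 1
  then show ?thesis using assms by (simp add: Lp_norm_infinity esssup_mono)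
next
  case (2 r)
  then show ?thesis
    by (auto simp: Lp_norm_ereal intro!: ennreal_powr_mono nn_integral_mono assms(3))
qed

text \<open>For \<open>p = \<infinity>\<close> the lower bound is the upper bound \<open>le\<close>
  applied with the inverse factor. If \<open>c\<close> is top, a finite norm of the product forces
  \<open>F\<close> to vanish almost everywhere. This case is included because in mixed norms the
  inner norm takes the place of \<open>c\<close> and may be infinite.\<close>

lemma Lp_norm_cmult:
  assumes p: "1 \<le> p" and F [measurable]: "F \<in> borel_measurable borel"
  shows "Lp_norm p (\<lambda>x. c * F x) = c * Lp_norm p F"
  using p
proof (cases rule: exponent_cases)
  case 1
  have le: "esssup lborel (\<lambda>x. c * F x) \<le> c * esssup lborel F"
    if [measurable]: "F \<in> borel_measurable borel" for c and F :: "'a \<Rightarrow> ennreal"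
  proof (rule esssup_I)
    show "AE x in lborel. c * F x \<le> c * esssup lborel F"
      using esssup_AE[of F lborel] by eventually_elim (simp add: mult_left_mono)
  qed simp
  have "c * esssup lborel F \<le> esssup lborel (\<lambda>x. c * F x)"
  proof (cases c)
    case (real a)
    show ?thesis
    proof (cases "a = 0")
      case False
      then have inv: "ennreal (1 / a) * (ennreal a * y) = y" "ennreal a * (ennreal (1 / a) * y) = y" for y
        using real by (simp_all add: mult.assoc[symmetric] ennreal_mult[symmetric])
      have "esssup lborel (\<lambda>x. ennreal (1 / a) * (c * F x)) \<le> ennreal (1 / a) * esssup lborel (\<lambda>x. c * F x)"
        by (rule le) simp
      then have "ennreal a * esssup lborel F \<le> ennreal a * (ennreal (1 / a) * esssup lborel (\<lambda>x. c * F x))"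
        by (intro mult_left_mono) (simp_all add: real inv)
      then show ?thesis by (simp add: real inv)
    qed (simp add: real)
  next
    case top
    show ?thesis
    proof (cases "esssup lborel (\<lambda>x. c * F x) = top")
      case False
      have "AE x in lborel. F x \<le> 0"
        using esssup_AE[of "\<lambda>x. c * F x" lborel]
      proof eventually_elim
        case (elim x)
        then show ?case using False top by (auto simp: ennreal_top_mult top_unique split: if_splits)
      qed
      then have "esssup lborel F \<le> 0" by (intro esssup_I) simp_all
      then show ?thesis by simp
    qed simp
  qed
  then show ?thesis using 1 le[OF F] by (simp add: Lp_norm_infinity antisym)
next
  case (2 r)
  then show ?thesis
    by (simp add: Lp_norm_ereal ennreal_powr_mult nn_integral_cmult ennreal_powr_powr_inverse)
qed

text \<open>Outer norms act on inner norms, so these must be measurable in the parameter. For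
  \<open>p = \<infinity>\<close> the essential supremum exceeds \<open>a\<close> exactly where the
  integral of an indicator is nonzero, and parameter integrals are measurable.\<close>

lemma measurable_Lp_norm:
  fixes F :: "'a::euclidean_space \<times> 'b::euclidean_space \<Rightarrow> ennreal"
  assumes p: "1 \<le> p" and F: "F \<in> borel_measurable borel"
  shows "(\<lambda>\<xi>. Lp_norm p (\<lambda>x. F (x, \<xi>))) \<in> borel_measurable borel"
proof -
  have F'[measurable]: "(\<lambda>(\<xi>, x). F (x, \<xi>)) \<in> borel_measurable (lborel \<Otimes>\<^sub>M lborel)"
  proof -
    have "(\<lambda>z :: 'b \<times> 'a. (snd z, fst z)) \<in> borel \<rightarrow>\<^sub>M (borel :: ('a \<times> 'b) measure)"
      by (intro borel_measurable_continuous_onI continuous_intros)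
    from measurable_compose[OF this F] show ?thesis
      by (simp add: lborel_prod case_prod_beta')
  qed
  have sec [measurable]: "(\<lambda>x. F (x, \<xi>)) \<in> borel_measurable borel" for \<xi>
    using measurable_Pair2[OF F', of \<xi>] by simp
  show ?thesis
    using p
  proof (cases rule: exponent_cases)
    case 1
    have "(\<lambda>\<xi>. esssup lborel (\<lambda>x. F (x, \<xi>))) \<in> borel_measurable lborel"
    proof (rule borel_measurableI_greater)
      fix a
      have "a < esssup lborel (\<lambda>x. F (x, \<xi>)) \<longleftrightarrow> (\<integral>\<^sup>+x. indicator {a<..} (F (x, \<xi>)) \<partial>lborel) \<noteq> 0" for \<xi>
      proof -
        have "a < esssup lborel (\<lambda>x. F (x, \<xi>)) \<longleftrightarrow> \<not> (AE x in lborel. F (x, \<xi>) \<le> a)"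
          using esssup_le_iff[of "\<lambda>x. F (x, \<xi>)" lborel a] by (auto simp: not_le[symmetric])
        also have "(AE x in lborel. F (x, \<xi>) \<le> a) \<longleftrightarrow> (\<integral>\<^sup>+x. indicator {a<..} (F (x, \<xi>)) \<partial>lborel) = 0"
          by (subst nn_integral_0_iff_AE) (simp_all add: indicator_def not_le[symmetric])
        finally show ?thesis .
      qed
      then have "{\<xi> \<in> space lborel. a < esssup lborel (\<lambda>x. F (x, \<xi>))}
          = {\<xi> \<in> space lborel. (\<integral>\<^sup>+x. indicator {a<..} (F (x, \<xi>)) \<partial>lborel) \<noteq> 0}" by simp
      also have "\<dots> \<in> sets lborel" by measurable
      finally show "{\<xi> \<in> space lborel. a < esssup lborel (\<lambda>x. F (x, \<xi>))} \<in> sets lborel" .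
    qed
    then show ?thesis using 1 by (simp add: Lp_norm_infinity)
  next
    case (2 r)
    have "(\<lambda>\<xi>. ennreal_powr (\<integral>\<^sup>+x. ennreal_powr (F (x, \<xi>)) r \<partial>lborel) (1 / r)) \<in> borel_measurable lborel"
      by measurable
    then show ?thesis using 2 by (simp add: Lp_norm_ereal)
  qed
qed

lemma AE_continuous_imp:
  fixes f :: "'a::euclidean_space \<Rightarrow> real"
  assumes ae: "AE x in lborel. f x \<le> c" and f: "continuous_on UNIV f"
  shows "f x \<le> c"
proof -
  have op: "open {x. c < f x}" by (intro open_Collect_less f continuous_intros)
  then have "{x. c < f x} \<in> null_sets lborel"
    using ae by (subst (asm) AE_iff_null) (auto simp: not_le)
  then have "negligible {x. c < f x}"
    by (simp add: negligible_iff_null_sets null_sets_completionI)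
  with op have "{x. c < f x} = {}" using open_not_negligible by blast
  then show ?thesis by (auto simp: not_less)
qed

lemma Lp_norm_pos:
  fixes f :: "'a::euclidean_space \<Rightarrow> real"
  assumes p: "1 \<le> p" and f: "continuous_on UNIV f" "0 < f x"
  shows "0 < Lp_norm p (\<lambda>x. ennreal (f x))"
proof (rule ccontr)
  assume "\<not> ?thesis"
  then have z: "Lp_norm p (\<lambda>x. ennreal (f x)) = 0" by simp
  have [measurable]: "f \<in> borel_measurable borel" using f(1) by (rule borel_measurable_continuous_onI)
  have "AE x in lborel. ennreal (f x) = 0"
    using p
  proof (cases rule: exponent_cases)
    case 1
    then show ?thesis using z esssup_AE[of "\<lambda>x. ennreal (f x)" lborel] by (simp add: Lp_norm_infinity)
  next
    case (2 r)
    then show ?thesis using z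
      by (simp add: Lp_norm_ereal ennreal_powr_eq_0 nn_integral_0_iff_AE)
  qed
  then have "AE x in lborel. f x \<le> 0" by eventually_elim (simp add: ennreal_eq_0_iff)
  from AE_continuous_imp[OF this f(1)] f(2) show False by (simp add: not_le[symmetric])
qed

section \<open>Powers of the bracket in Lebesgue spaces\<close>

lemma measurable_jbracket_powr [measurable]:
  "(\<lambda>x::'a::euclidean_space. jbracket x powr s) \<in> borel_measurable borel"
  by measurable

lemma continuous_on_jbracket_powr:
  "continuous_on S f \<Longrightarrow> continuous_on S (\<lambda>x. jbracket (f x) powr s)"
  by (intro continuous_intros) simp_all

lemma jbracket_powr_unbounded:
  assumes "s > 0"
  shows "\<exists>x::'a::euclidean_space. M < jbracket x powr s"
proof -
  define t where "t = (\<bar>M\<bar> + 1) powr (1 / s)"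
  obtain x :: 'a where x: "norm x = t" using vector_choose_size[of t] by (auto simp: t_def)
  have "t powr s \<le> jbracket x powr s"
    using norm_le_jbracket[of x] assms x by (intro powr_mono2) (auto simp: t_def)
  moreover have "t powr s = \<bar>M\<bar> + 1" using assms by (simp add: t_def powr_powr)
  ultimately show ?thesis by (intro exI[of _ x]) linarith
qed

text \<open>For finite \<open>p\<close> this is the integrability threshold of the bracket, divided
  by \<open>p\<close> times the dimension. For \<open>p = \<infinity>\<close> boundedness means
  \<open>s \<le> 0\<close>, of which the strict inequality covers only \<open>s < 0\<close>; the
  extra case is the endpoint. Both target conditions are instances.\<close>

lemma Lp_norm_jbracket_finite_iff:
  assumes p: "1 \<le> p"
  shows "Lp_norm p (\<lambda>x::'a::euclidean_space. ennreal (jbracket x powr s)) < top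
    \<longleftrightarrow> 1 / p + ereal (s / real DIM('a)) < 0 \<or> (p = \<infinity> \<and> s = 0)"
  using p
proof (cases rule: exponent_cases)
  case 1
  have "esssup lborel (\<lambda>x::'a. ennreal (jbracket x powr s)) < top \<longleftrightarrow> s \<le> 0"
  proof
    assume fin: "esssup lborel (\<lambda>x::'a. ennreal (jbracket x powr s)) < top"
    then obtain M where M: "0 \<le> M" "esssup lborel (\<lambda>x::'a. ennreal (jbracket x powr s)) = ennreal M"
      by (cases "esssup lborel (\<lambda>x::'a. ennreal (jbracket x powr s))") auto
    have "AE x in lborel. ennreal (jbracket (x::'a) powr s) \<le> ennreal M"
      unfolding M(2)[symmetric] by (rule esssup_AE)
    then have "AE x in lborel. jbracket (x::'a) powr s \<le> M"
      by eventually_elim (use M(1) in simp)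
    then have "jbracket (x::'a) powr s \<le> M" for x
      by (rule AE_continuous_imp[where f="\<lambda>x. jbracket x powr s"])
         (intro continuous_on_jbracket_powr continuous_on_id)
    then show "s \<le> 0" using jbracket_powr_unbounded[of s M, where 'a='a] by (metis not_le)
  next
    assume s: "s \<le> 0"
    have "jbracket (x::'a) powr s \<le> 1" for x
      using powr_mono[OF s jbracket_ge_1[of x]] by simp
    then have "esssup lborel (\<lambda>x::'a. ennreal (jbracket x powr s)) \<le> 1"
      by (intro esssup_I) simp_all
    then show "esssup lborel (\<lambda>x::'a. ennreal (jbracket x powr s)) < top"
      by (rule le_less_trans) simp
  qed
  moreover have "ereal (s / real DIM('a)) < 0 \<longleftrightarrow> s < 0"
    by (simp add: divide_less_0_iff zero_less_iff_neq_zero)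
  ultimately show ?thesis using 1 by (auto simp: Lp_norm_infinity)
next
  case (2 r)
  have "Lp_norm p (\<lambda>x::'a. ennreal (jbracket x powr s)) < top
      \<longleftrightarrow> (\<integral>\<^sup>+x. ennreal (jbracket (x::'a) powr - (- s * r)) \<partial>lborel) < top"
    using 2 by (simp add: Lp_norm_ereal ennreal_powr_less_top ennreal_powr_ennreal powr_powr)
  also have "\<dots> \<longleftrightarrow> - s * r > real DIM('a)"
    using nn_integral_jbracket_finite[of "- s * r", where 'a='a]
      nn_integral_jbracket_infinite[of "- s * r", where 'a='a]
    by (cases "- s * r > real DIM('a)") auto
  also have "\<dots> \<longleftrightarrow> 1 / p + ereal (s / real DIM('a)) < 0"
  proof -
    have "1 / r + s / real DIM('a) < 0 \<longleftrightarrow> real DIM('a) + s * r < 0"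
    proof -
      have "1 / r + s / real DIM('a) = (real DIM('a) + s * r) / (r * real DIM('a))"
        using 2 by (simp add: field_simps)
      moreover have "r * real DIM('a) > 0" using 2 by simp
      ultimately show ?thesis by (simp add: divide_less_0_iff)
    qed
    then show ?thesis using 2 by (auto simp: one_ereal_def)
  qed
  finally show ?thesis using 2 by simp
qed

text \<open>Replaces Hoelder's inequality below, where constants do not matter.\<close>

lemma young_crude:
  fixes a b r :: real
  assumes "0 \<le> a" "0 < b" "1 < r"
  shows "a * b \<le> a powr r + b powr (r / (r - 1))"
proof (cases "b \<le> a powr (r - 1)")
  case True
  have "a * b \<le> a * a powr (r - 1)" using True assms by (intro mult_left_mono) auto
  also have "\<dots> = a powr r"
    using assms by (cases "a = 0") (simp_all add: powr_mult_base)
  finally show ?thesis by (simp add: add_increasing2)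
next
  case False
  have "a = (a powr (r - 1)) powr (1 / (r - 1))" using assms by (cases "a = 0") (simp_all add: powr_powr)
  also have "\<dots> \<le> b powr (1 / (r - 1))" using False assms by (intro powr_mono2) auto
  finally have "a * b \<le> b powr (1 / (r - 1)) * b" using assms by (intro mult_right_mono) auto
  also have "\<dots> = b powr (1 / (r - 1) + 1)" using assms by (simp add: powr_add)
  also have "1 / (r - 1) + 1 = r / (r - 1)" using assms by (simp add: field_simps)
  finally show ?thesis by (simp add: add_increasing)
qed

text \<open>The condition puts the inverse weight \<open>jbracket x powr - s\<close> into the dual
  Lebesgue space, so this is Hoelder's inequality with a nonoptimal constant. The additive Young
  inequality becomes homogeneous after normalising by the norm \<open>n\<close>, which leads to
  \<open>1 + K\<close>.\<close>

lemma nn_integral_le_Lp_norm: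
  fixes p :: ereal
  assumes p: "1 \<le> p"
    and c: "1 < 1 / p + ereal (s / real DIM('a)) \<or> (p = 1 \<and> s = 0)"
  shows "\<exists>K\<ge>0. \<forall>H \<in> borel_measurable (borel :: 'a::euclidean_space measure).
    (\<integral>\<^sup>+x. H x \<partial>lborel) \<le> ennreal K * Lp_norm p (\<lambda>x. H x * ennreal (jbracket x powr s))"
  using p
proof (cases rule: exponent_cases)
  case 1
  then have s: "s > real DIM('a)" using c by (auto simp: one_ereal_def field_simps)
  define J where "J = (\<integral>\<^sup>+x. ennreal (jbracket (x::'a) powr - s) \<partial>lborel)"
  have "J < \<infinity>" unfolding J_def using s by (rule nn_integral_jbracket_finite)
  then obtain K where K: "0 \<le> K" "J = ennreal K" by (cases J) auto
  have "(\<integral>\<^sup>+x. H x \<partial>lborel) \<le> ennreal K * Lp_norm p (\<lambda>x. H x * ennreal (jbracket x powr s))"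
    if [measurable]: "H \<in> borel_measurable borel" for H :: "'a \<Rightarrow> ennreal"
  proof -
    define E where "E = esssup lborel (\<lambda>x. H x * ennreal (jbracket x powr s))"
    have "AE x in lborel. H x * ennreal (jbracket x powr s) \<le> E" unfolding E_def by (rule esssup_AE)
    then have "AE x in lborel. H x \<le> E * ennreal (jbracket x powr - s)"
    proof eventually_elim
      case (elim x)
      have "H x = H x * ennreal (jbracket x powr s) * ennreal (jbracket x powr - s)"
        by (simp add: mult.assoc ennreal_mult[symmetric] powr_minus)
      also have "\<dots> \<le> E * ennreal (jbracket x powr - s)" by (intro mult_right_mono elim) simp
      finally show ?case .
    qed
    then have "(\<integral>\<^sup>+x. H x \<partial>lborel) \<le> (\<integral>\<^sup>+x. E * ennreal (jbracket (x::'a) powr - s) \<partial>lborel)"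
      by (rule nn_integral_mono_AE)
    also have "\<dots> = E * J" unfolding J_def by (rule nn_integral_cmult) simp
    finally show ?thesis using 1 K by (simp add: Lp_norm_infinity E_def mult.commute)
  qed
  then show ?thesis using K(1) by blast
next
  case (2 r)
  show ?thesis
  proof (cases "r = 1")
    case True
    then have p1: "p = 1" using 2 by (simp add: one_ereal_def)
    have s: "s \<ge> 0" using c p1
      by (auto simp: one_ereal_def zero_less_divide_iff)
    have "(\<integral>\<^sup>+x. H x \<partial>lborel) \<le> ennreal 1 * Lp_norm p (\<lambda>x. H x * ennreal (jbracket x powr s))"
      if "H \<in> borel_measurable borel" for H :: "'a \<Rightarrow> ennreal"
    proof -
      have "H x \<le> H x * ennreal (jbracket x powr s)" for x
      proof -
        have "1 \<le> ennreal (jbracket x powr s)"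
          using ge_one_powr_ge_zero[OF jbracket_ge_1 s] by simp
        from mult_left_mono[OF this, of "H x"] show ?thesis by simp
      qed
      then show ?thesis unfolding p1 Lp_norm_1 by (simp add: nn_integral_mono)
    qed
    then show ?thesis by (intro exI[of _ 1]) auto
  next
    case False
    then have r: "1 < r" using 2 by simp
    define r' where "r' = r / (r - 1)"
    have r': "r' > 0" using r by (simp add: r'_def)
    have s: "s * r' > real DIM('a)"
    proof -
      have "1 < 1 / r + s / real DIM('a)" using c 2 r by (auto simp: one_ereal_def)
      then have "(r - 1) * real DIM('a) < s * r" using r by (simp add: field_simps)
      then show ?thesis using r by (simp add: r'_def field_simps)
    qed
    define J where "J = (\<integral>\<^sup>+x. ennreal (jbracket (x::'a) powr - (s * r')) \<partial>lborel)"
    have "J < \<infinity>" unfolding J_def using s by (rule nn_integral_jbracket_finite)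
    then obtain K where K: "0 \<le> K" "J = ennreal K" by (cases J) auto
    have "(\<integral>\<^sup>+x. H x \<partial>lborel) \<le> ennreal (1 + K) * Lp_norm p (\<lambda>x. H x * ennreal (jbracket x powr s))"
      if [measurable]: "H \<in> borel_measurable borel" for H :: "'a \<Rightarrow> ennreal"
    proof -
      define G where "G = (\<lambda>x. H x * ennreal (jbracket x powr s))"
      have [measurable]: "G \<in> borel_measurable borel" unfolding G_def by measurable
      define I where "I = (\<integral>\<^sup>+x. ennreal_powr (G x) r \<partial>lborel)"
      define N where "N = ennreal_powr I (1 / r)"
      have NL: "N = Lp_norm p G" unfolding N_def I_def 2 Lp_norm_ereal ..
      \<comment> \<open>Normalisation works for positive finite norms only. Norm 0 makes
        \<open>H\<close> vanish almost everywhere, and norm top makes the right side infinite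
        because \<open>1 + K\<close> is positive.\<close>
      consider "N = 0" | "N = top" | n where "0 < n" "N = ennreal n"
        by (cases N) (auto simp: ennreal_eq_0_iff order_le_less)
      then have "(\<integral>\<^sup>+x. H x \<partial>lborel) \<le> ennreal (1 + K) * N"
      proof cases
        case 1
        then have "AE x in lborel. ennreal_powr (G x) r = 0"
          by (simp add: N_def ennreal_powr_eq_0 I_def nn_integral_0_iff_AE)
        then have "AE x in lborel. H x = 0"
          by eventually_elim (simp add: ennreal_powr_eq_0 G_def)
        then have "(\<integral>\<^sup>+x. H x \<partial>lborel) = 0" by (simp add: nn_integral_0_iff_AE)
        then show ?thesis by simp
      next
        case 2
        then show ?thesis using K by (simp add: ennreal_mult_top)
      next
        case (3 n)
        have I: "I = ennreal (n powr r)"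
          using ennreal_powr_inverse_powr[of r I] r 3 by (simp add: N_def ennreal_powr_ennreal)
        have "H x \<le> ennreal n * (ennreal (n powr - r) * ennreal_powr (G x) r + ennreal (jbracket x powr - (s * r')))" for x
        proof (cases "H x")
          case top
          then show ?thesis using 3
            by (simp add: G_def ennreal_top_mult ennreal_powr_top ennreal_mult_top)
        next
          case (real h)
          define w where "w = jbracket x powr s"
          have w: "w > 0" by (simp add: w_def)
          have "(h * w / n) * (1 / w) \<le> (h * w / n) powr r + (1 / w) powr r'"
            unfolding r'_def using real w 3 r by (intro young_crude) auto
          then have "n * ((h * w / n) * (1 / w)) \<le> n * ((h * w / n) powr r + (1 / w) powr r')"
            using 3 by (intro mult_left_mono) auto
          moreover have "n * ((h * w / n) * (1 / w)) = h" using w 3 by simp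
          moreover have "(h * w / n) powr r = n powr - r * (h * w) powr r"
            using real w 3 by (simp add: powr_divide powr_minus field_simps)
          moreover have "(1 / w) powr r' = jbracket x powr - (s * r')"
            by (simp add: w_def powr_divide powr_powr powr_minus_divide)
          ultimately have "h \<le> n * (n powr - r * (h * w) powr r + jbracket x powr - (s * r'))" by simp
          then have "ennreal h \<le> ennreal (n * (n powr - r * (h * w) powr r + jbracket x powr - (s * r')))"
            by (rule ennreal_leI)
          also have "\<dots> = ennreal n * (ennreal (n powr - r) * ennreal_powr (G x) r + ennreal (jbracket x powr - (s * r')))"
          proof -
            have "G x = ennreal (h * w)"
              unfolding G_def real w_def[symmetric] by (rule ennreal_mult[symmetric]) (use real w in auto)
            then have Gx: "ennreal_powr (G x) r = ennreal ((h * w) powr r)"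
              using real w by (simp add: ennreal_powr_ennreal)
            have "0 \<le> n" using 3 by simp
            then show ?thesis unfolding Gx by (simp add: ennreal_mult)
          qed
          finally show ?thesis using real by simp
        qed
        then have "(\<integral>\<^sup>+x. H x \<partial>lborel) \<le> (\<integral>\<^sup>+x. ennreal n
            * (ennreal (n powr - r) * ennreal_powr (G x) r + ennreal (jbracket x powr - (s * r'))) \<partial>lborel)"
          by (intro nn_integral_mono)
        also have "\<dots> = ennreal n * (ennreal (n powr - r) * I + J)"
          unfolding I_def J_def by (subst nn_integral_cmult; simp add: nn_integral_add nn_integral_cmult)
        also have "\<dots> = ennreal n * (1 + J)"
          using 3 by (simp add: I powr_minus flip: ennreal_mult)
        also have "\<dots> = ennreal (1 + K) * N"
          using 3 K by (simp add: mult.commute)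
        finally show ?thesis .
      qed
      then show ?thesis by (simp add: NL G_def)
    qed
    then show ?thesis using K(1) by (intro exI[of _ "1 + K"]) auto
  qed
qed

section \<open>Sufficiency\<close>

lemma modulation_norm_dist_of:
  "\<phi> \<in> schwartz \<Longrightarrow> modulation_norm \<phi> p q (v_weight s t) (dist_of f)
    = Lp_norm q (\<lambda>\<xi>. Lp_norm p (\<lambda>x.
        ennreal (cmod (stft_fun \<phi> f (x, \<xi>)) * (jbracket x powr s * jbracket \<xi> powr t))))"
  by (simp add: modulation_norm_def stft_dist_of v_weight_def)

lemma mixed_norm_measurable:
  fixes F :: "'a::euclidean_space \<times> 'a \<Rightarrow> real"
  assumes "1 \<le> p" "continuous_on UNIV F"
  shows "(\<lambda>x. ennreal (F (x, \<xi>))) \<in> borel_measurable borel"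
    and "(\<lambda>\<xi>. Lp_norm p (\<lambda>x. ennreal (F (x, \<xi>)))) \<in> borel_measurable borel"
proof -
  have "continuous_on UNIV (\<lambda>x. F (x, \<xi>))"
    by (rule continuous_on_compose2[OF assms(2)]) (auto intro!: continuous_intros)
  then have [measurable]: "(\<lambda>x. F (x, \<xi>)) \<in> borel_measurable borel"
    by (rule borel_measurable_continuous_onI)
  show "(\<lambda>x. ennreal (F (x, \<xi>))) \<in> borel_measurable borel" by measurable
  have "(\<lambda>z. ennreal (F z)) \<in> borel_measurable borel"
    using borel_measurable_continuous_onI[OF assms(2)] by measurable
  from measurable_Lp_norm[OF assms(1) this]
  show "(\<lambda>\<xi>. Lp_norm p (\<lambda>x. ennreal (F (x, \<xi>)))) \<in> borel_measurable borel" .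
qed

lemma mixed_norm_mono:
  fixes F G :: "'a::euclidean_space \<times> 'a \<Rightarrow> real"
  assumes "1 \<le> p" "1 \<le> q" "continuous_on UNIV F" "\<And>z. F z \<le> G z"
  shows "Lp_norm q (\<lambda>\<xi>. Lp_norm p (\<lambda>x. ennreal (F (x, \<xi>))))
    \<le> Lp_norm q (\<lambda>\<xi>. Lp_norm p (\<lambda>x. ennreal (G (x, \<xi>))))"
  by (rule Lp_norm_mono[OF assms(2) mixed_norm_measurable(2)[OF assms(1,3)]
        Lp_norm_mono[OF assms(1) mixed_norm_measurable(1)[OF assms(1,3)] ennreal_leI[OF assms(4)]]])

text \<open>Homogeneity is used twice, first for the inner norm at fixed \<open>\<xi>\<close> and
  then for the outer one. Either norm on the right may be infinite, which matters where the identity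
  serves to deduce that they are finite.\<close>

lemma mixed_norm_product:
  fixes A B :: "'a::euclidean_space \<Rightarrow> real"
  assumes p: "1 \<le> p" "1 \<le> q" and a: "0 \<le> a"
    and A: "continuous_on UNIV A" "\<And>x. 0 \<le> A x" and B: "continuous_on UNIV B" "\<And>\<xi>. 0 \<le> B \<xi>"
  shows "Lp_norm q (\<lambda>\<xi>. Lp_norm p (\<lambda>x. ennreal ((a * A x * B \<xi>) * (jbracket x powr s * jbracket \<xi> powr t))))
    = ennreal a * (Lp_norm p (\<lambda>x. ennreal (A x * jbracket x powr s))
      * Lp_norm q (\<lambda>\<xi>. ennreal (B \<xi> * jbracket \<xi> powr t)))"
proof -
  have [measurable]: "A \<in> borel_measurable borel" "B \<in> borel_measurable borel"
    using A B by (auto intro: borel_measurable_continuous_onI)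
  define P where "P = Lp_norm p (\<lambda>x. ennreal (A x * jbracket x powr s))"
  have "Lp_norm p (\<lambda>x. ennreal ((a * A x * B \<xi>) * (jbracket x powr s * jbracket \<xi> powr t)))
      = (ennreal a * P) * ennreal (B \<xi> * jbracket \<xi> powr t)" for \<xi>
  proof -
    have "ennreal ((a * A x * B \<xi>) * (jbracket x powr s * jbracket \<xi> powr t))
        = ennreal (a * (B \<xi> * jbracket \<xi> powr t)) * ennreal (A x * jbracket x powr s)" for x
      using a A B by (subst ennreal_mult[symmetric]) (auto simp: ac_simps)
    then have "Lp_norm p (\<lambda>x. ennreal ((a * A x * B \<xi>) * (jbracket x powr s * jbracket \<xi> powr t)))
        = ennreal (a * (B \<xi> * jbracket \<xi> powr t)) * P"
      unfolding P_def using Lp_norm_cmult[OF p(1), of "\<lambda>x. ennreal (A x * jbracket x powr s)"] by simp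
    also have "\<dots> = (ennreal a * P) * ennreal (B \<xi> * jbracket \<xi> powr t)"
      using a B by (subst ennreal_mult) (auto simp: ac_simps)
    finally show ?thesis .
  qed
  then show ?thesis
    using Lp_norm_cmult[OF p(2), of "\<lambda>\<xi>. ennreal (B \<xi> * jbracket \<xi> powr t)" "ennreal a * P"]
    by (simp add: P_def mult.assoc)
qed

lemma continuous_on_weighted_stft_fun:
  fixes \<phi> f :: "'a::euclidean_space \<Rightarrow> complex"
  assumes "\<phi> \<in> schwartz" "f \<in> schwartz"
  shows "continuous_on UNIV (\<lambda>z. cmod (stft_fun \<phi> f z) * (jbracket (fst z) powr s * jbracket (snd z) powr t))"
  by (intro continuous_intros continuous_on_jbracket_powr
      schwartz_continuous_on[OF stft_fun_schwartz[OF assms]]) simp_all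

text \<open>The weighted Hoelder bound is applied in \<open>x\<close> at fixed \<open>\<xi>\<close>
  and then to the resulting function \<open>H\<close> of \<open>\<xi>\<close>, in the order of the
  mixed norm; the weight in \<open>\<xi>\<close> passes through the inner norm as a constant
  factor.\<close>

lemma stft_fun_L1_le_modulation_norm:
  fixes \<phi> :: "'a::euclidean_space \<Rightarrow> complex"
  assumes \<phi>: "\<phi> \<in> schwartz" and p: "1 \<le> p" "1 \<le> q"
    and cp: "1 < 1 / p + ereal (s / real DIM('a)) \<or> (p = 1 \<and> s = 0)"
    and cq: "1 < 1 / q + ereal (t / real DIM('a)) \<or> (q = 1 \<and> t = 0)"
  shows "\<exists>K\<ge>0. \<forall>f\<in>schwartz. (\<integral>\<^sup>+u. ennreal (cmod (stft_fun \<phi> f u)) \<partial>lborel)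
    \<le> ennreal K * modulation_norm \<phi> p q (v_weight s t) (dist_of f)"
proof -
  obtain K1 where K1: "0 \<le> K1" "\<forall>H \<in> borel_measurable (borel :: 'a measure).
      (\<integral>\<^sup>+x. H x \<partial>lborel) \<le> ennreal K1 * Lp_norm p (\<lambda>x. H x * ennreal (jbracket x powr s))"
    using nn_integral_le_Lp_norm[OF p(1) cp] by blast
  obtain K2 where K2: "0 \<le> K2" "\<forall>H \<in> borel_measurable (borel :: 'a measure).
      (\<integral>\<^sup>+x. H x \<partial>lborel) \<le> ennreal K2 * Lp_norm q (\<lambda>x. H x * ennreal (jbracket x powr t))"
    using nn_integral_le_Lp_norm[OF p(2) cq] by blast
  have "(\<integral>\<^sup>+u. ennreal (cmod (stft_fun \<phi> f u)) \<partial>lborel)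
      \<le> ennreal (K2 * K1) * modulation_norm \<phi> p q (v_weight s t) (dist_of f)" if f: "f \<in> schwartz" for f
  proof -
    define V where "V = stft_fun \<phi> f"
    have V: "V \<in> schwartz" unfolding V_def by (rule stft_fun_schwartz[OF \<phi> f])
    have contV: "continuous_on UNIV (\<lambda>z. cmod (V z))"
      by (intro continuous_intros schwartz_continuous_on[OF V])
    define H where "H \<xi> = (\<integral>\<^sup>+x. ennreal (cmod (V (x, \<xi>))) \<partial>lborel)" for \<xi>
    have H [measurable]: "H \<in> borel_measurable borel"
      using mixed_norm_measurable(2)[of 1, OF _ contV] unfolding H_def Lp_norm_1 by simp
    have V1 [measurable]: "(\<lambda>x. ennreal (cmod (V (x, \<xi>)))) \<in> borel_measurable borel" for \<xi>
      using mixed_norm_measurable(1)[of 1, OF _ contV] by simp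
    define N where "N \<xi> = Lp_norm p (\<lambda>x. ennreal (cmod (V (x, \<xi>)) * (jbracket x powr s * jbracket \<xi> powr t)))" for \<xi>
    have N [measurable]: "N \<in> borel_measurable borel"
      using mixed_norm_measurable(2)[OF p(1) continuous_on_weighted_stft_fun[OF \<phi> f, of s t]]
      unfolding N_def V_def by simp
    have HN: "H \<xi> * ennreal (jbracket \<xi> powr t) \<le> ennreal K1 * N \<xi>" for \<xi>
    proof -
      have "H \<xi> \<le> ennreal K1 * Lp_norm p (\<lambda>x. ennreal (cmod (V (x, \<xi>))) * ennreal (jbracket x powr s))"
        unfolding H_def using K1(2) V1 by blast
      then have "H \<xi> * ennreal (jbracket \<xi> powr t) \<le> ennreal K1
          * (ennreal (jbracket \<xi> powr t) * Lp_norm p (\<lambda>x. ennreal (cmod (V (x, \<xi>))) * ennreal (jbracket x powr s)))"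
        by (metis (no_types, lifting) mult.assoc mult.commute mult_right_mono zero_le)
      also have "ennreal (jbracket \<xi> powr t) * Lp_norm p (\<lambda>x. ennreal (cmod (V (x, \<xi>))) * ennreal (jbracket x powr s))
          = Lp_norm p (\<lambda>x. ennreal (jbracket \<xi> powr t) * (ennreal (cmod (V (x, \<xi>))) * ennreal (jbracket x powr s)))"
        by (rule Lp_norm_cmult[OF p(1), symmetric]) measurable
      also have "\<dots> = N \<xi>"
        unfolding N_def by (simp add: ennreal_mult ac_simps)
      finally show ?thesis .
    qed
    have "(\<integral>\<^sup>+u. ennreal (cmod (V u)) \<partial>lborel) = (\<integral>\<^sup>+\<xi>. H \<xi> \<partial>lborel)"
      unfolding H_def using nn_integral_lborel_Fubini[of "\<lambda>x \<xi>. cmod (V (x, \<xi>))"] contV by simp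
    also have "\<dots> \<le> ennreal K2 * Lp_norm q (\<lambda>\<xi>. H \<xi> * ennreal (jbracket \<xi> powr t))"
      using K2(2) H by blast
    also have "\<dots> \<le> ennreal K2 * Lp_norm q (\<lambda>\<xi>. ennreal K1 * N \<xi>)"
      by (intro mult_left_mono Lp_norm_mono p HN) measurable
    also have "\<dots> = ennreal (K2 * K1) * Lp_norm q N"
      using K1(1) K2(1) by (simp add: Lp_norm_cmult[OF p(2) N] ennreal_mult mult.assoc)
    also have "Lp_norm q N = modulation_norm \<phi> p q (v_weight s t) (dist_of f)"
      unfolding modulation_norm_dist_of[OF \<phi>] N_def V_def ..
    finally show ?thesis by (simp add: V_def)
  qed
  moreover have "0 \<le> K2 * K1" using K1 K2 by simp
  ultimately show ?thesis by blast
qed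

lemma OP_tau_maps_sufficient:
  fixes \<phi> :: "'a::euclidean_space \<Rightarrow> complex" and \<Phi> :: "'a \<times> 'a \<Rightarrow> complex"
  assumes \<phi>: "\<phi> \<in> schwartz" "\<phi> \<noteq> (\<lambda>x. 0)" and \<Phi>: "\<Phi> \<in> schwartz" "\<Phi> \<noteq> (\<lambda>x. 0)"
    and p: "1 \<le> p1" "1 \<le> q1" "1 \<le> p2" "1 \<le> q2" and \<tau>: "\<tau> \<noteq> 1"
    and c1: "1 < 1 / p1 + ereal (s1 / real DIM('a)) \<or> (p1 = 1 \<and> s1 = 0)"
      "1 < 1 / q1 + ereal (t1 / real DIM('a)) \<or> (q1 = 1 \<and> t1 = 0)"
    and c2: "1 / p2 + ereal (s2 / real DIM('a)) < 0 \<or> (p2 = \<infinity> \<and> s2 = 0)"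
      "1 / q2 + ereal (t2 / real DIM('a)) < 0 \<or> (q2 = \<infinity> \<and> t2 = 0)"
  shows "OP_tau_maps \<phi> \<tau> (wiener_amalgam \<Phi> 1 \<infinity>) p1 q1 (v_weight s1 t1) p2 q2 (v_weight s2 t2)"
  unfolding OP_tau_maps_def
proof
  fix \<sigma> assume \<sigma>: "\<sigma> \<in> wiener_amalgam \<Phi> 1 \<infinity>"
  then have \<sigma>t: "\<sigma> \<in> tempered_distributions" by (simp add: wiener_amalgam_def)
  obtain C where C: "0 \<le> C" "\<And>f x \<xi>. f \<in> schwartz \<Longrightarrow> ennreal (cmod (stft \<phi> (OP_tau \<tau> \<sigma> f) x \<xi>))
      \<le> ennreal C * (\<integral>\<^sup>+u. ennreal (cmod (stft_fun \<phi> f u)) \<partial>lborel)"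
    using OP_tau_stft_bound[OF \<phi> \<Phi> \<sigma> \<tau>] by metis
  obtain K where K: "0 \<le> K" "\<forall>f\<in>schwartz. (\<integral>\<^sup>+u. ennreal (cmod (stft_fun \<phi> f u)) \<partial>lborel)
      \<le> ennreal K * modulation_norm \<phi> p1 q1 (v_weight s1 t1) (dist_of f)"
    using stft_fun_L1_le_modulation_norm[OF \<phi>(1) p(1,2) c1] by blast
  have "Lp_norm p2 (\<lambda>x::'a. ennreal (jbracket x powr s2)) < top"
    using Lp_norm_jbracket_finite_iff[OF p(3), where 'a='a] c2(1) by blast
  then obtain P where P: "0 \<le> P" "Lp_norm p2 (\<lambda>x::'a. ennreal (jbracket x powr s2)) = ennreal P"
    by (cases "Lp_norm p2 (\<lambda>x::'a. ennreal (jbracket x powr s2))") auto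
  have "Lp_norm q2 (\<lambda>x::'a. ennreal (jbracket x powr t2)) < top"
    using Lp_norm_jbracket_finite_iff[OF p(4), where 'a='a] c2(2) by blast
  then obtain Q where Q: "0 \<le> Q" "Lp_norm q2 (\<lambda>x::'a. ennreal (jbracket x powr t2)) = ennreal Q"
    by (cases "Lp_norm q2 (\<lambda>x::'a. ennreal (jbracket x powr t2))") auto
  show "\<exists>C::real. \<forall>f\<in>schwartz. modulation_norm \<phi> p2 q2 (v_weight s2 t2) (OP_tau \<tau> \<sigma> f)
      \<le> ennreal C * modulation_norm \<phi> p1 q1 (v_weight s1 t1) (dist_of f)"
  proof (intro exI[of _ "P * Q * C * K"] ballI)
    fix f :: "'a \<Rightarrow> complex" assume f: "f \<in> schwartz"
    define I where "I = (\<integral>\<^sup>+u. ennreal (cmod (stft_fun \<phi> f u)) \<partial>lborel)"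
    \<comment> \<open>Finiteness for each Schwartz \<open>f\<close> turns the bound on the output
      into a real constant, so that its transform can be compared pointwise with a constant
      function, whose mixed norm factorises.\<close>
    have "I < \<infinity>" unfolding I_def by (rule nn_integral_schwartz_finite[OF stft_fun_schwartz[OF \<phi>(1) f]])
    then obtain i where i: "0 \<le> i" "I = ennreal i" by (cases I) auto
    define U where "U = (\<lambda>w. stft \<phi> (OP_tau \<tau> \<sigma> f) (fst w) (snd w))"
    have contU: "continuous_on UNIV U"
      unfolding U_def by (rule OP_tau_stft_continuous[OF \<phi> f \<sigma>t])
    have U: "cmod (U w) \<le> C * i" for w
    proof -
      have "ennreal (cmod (U w)) \<le> ennreal C * I" unfolding U_def I_def by (rule C(2)[OF f])
      also have "\<dots> = ennreal (C * i)" using i C(1) by (simp add: ennreal_mult)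
      finally show ?thesis using i C(1) by (simp add: ennreal_le_iff)
    qed
    have "modulation_norm \<phi> p2 q2 (v_weight s2 t2) (OP_tau \<tau> \<sigma> f) = Lp_norm q2 (\<lambda>\<xi>. Lp_norm p2 (\<lambda>x.
        ennreal (cmod (U (x, \<xi>)) * (jbracket x powr s2 * jbracket \<xi> powr t2))))"
      by (simp add: modulation_norm_def U_def v_weight_def)
    also have "\<dots> \<le> Lp_norm q2 (\<lambda>\<xi>::'a. Lp_norm p2 (\<lambda>x::'a.
        ennreal ((C * i * 1 * 1) * (jbracket x powr s2 * jbracket \<xi> powr t2))))"
    proof -
      have "continuous_on UNIV (\<lambda>z. cmod (U z) * (jbracket (fst z) powr s2 * jbracket (snd z) powr t2))"
        by (intro continuous_intros continuous_on_jbracket_powr contU) simp_all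
      from mixed_norm_mono[OF p(3,4) this,
          of "\<lambda>z. (C * i * 1 * 1) * (jbracket (fst z) powr s2 * jbracket (snd z) powr t2)"] U
      show ?thesis by (simp add: mult_right_mono)
    qed
    also have "\<dots> = ennreal (C * i) * (ennreal P * ennreal Q)"
      using C(1) i mixed_norm_product[OF p(3,4), of "C * i" "\<lambda>x::'a. 1" "\<lambda>x::'a. 1" s2 t2]
      by (simp add: P Q)
    also have "\<dots> = ennreal (P * Q * C) * I"
      using C(1) i P(1) Q(1) by (simp add: ac_simps flip: ennreal_mult)
    also have "\<dots> \<le> ennreal (P * Q * C) * (ennreal K * modulation_norm \<phi> p1 q1 (v_weight s1 t1) (dist_of f))"
      unfolding I_def using K(2) f by (intro mult_left_mono) auto
    also have "\<dots> = ennreal (P * Q * C * K) * modulation_norm \<phi> p1 q1 (v_weight s1 t1) (dist_of f)"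
      using C(1) P(1) Q(1) K(1) by (simp add: mult.assoc ennreal_mult)
    finally show "modulation_norm \<phi> p2 q2 (v_weight s2 t2) (OP_tau \<tau> \<sigma> f)
        \<le> ennreal (P * Q * C * K) * modulation_norm \<phi> p1 q1 (v_weight s1 t1) (dist_of f)" .
  qed
qed

section \<open>Lattice sums\<close>

text \<open>Coordinatewise rounding down. Its range is the integer lattice and its fibres are
  half-open unit cubes; describing the lattice as this range keeps lattice points in the type
  \<open>'a\<close>.\<close>

definition lattice_floor :: "'a::euclidean_space \<Rightarrow> 'a" where
  "lattice_floor x = (\<Sum>b\<in>Basis. of_int \<lfloor>x \<bullet> b\<rfloor> *\<^sub>R b)"

lemma lattice_floor_inner: "b \<in> Basis \<Longrightarrow> lattice_floor x \<bullet> b = of_int \<lfloor>x \<bullet> b\<rfloor>"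
  by (simp add: lattice_floor_def inner_sum_left_Basis)

lemma norm_lattice_floor_le: "norm (x - lattice_floor (x::'a::euclidean_space)) \<le> real DIM('a)"
proof -
  have "norm (x - lattice_floor x) \<le> (\<Sum>b\<in>Basis. \<bar>(x - lattice_floor x) \<bullet> b\<bar>)" by (rule norm_le_l1)
  also have "\<dots> \<le> (\<Sum>b\<in>(Basis :: 'a set). 1)"
  proof (intro sum_mono)
    fix b :: 'a assume "b \<in> Basis"
    then show "\<bar>(x - lattice_floor x) \<bullet> b\<bar> \<le> 1"
      by (simp add: inner_diff_left lattice_floor_inner) linarith
  qed
  finally show ?thesis by simp
qed

lemma measurable_lattice_floor [measurable]:
  "(lattice_floor :: 'a::euclidean_space \<Rightarrow> 'a) \<in> borel_measurable borel"
  unfolding lattice_floor_def by measurable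

definition lattice_cell :: "'a::euclidean_space \<Rightarrow> 'a set" where
  "lattice_cell k = {x. lattice_floor x = k}"

lemma sets_lattice_cell [measurable]: "lattice_cell (k::'a::euclidean_space) \<in> sets borel"
proof -
  have "lattice_floor -` {k} \<inter> space borel \<in> sets (borel :: 'a measure)"
    by (rule measurable_sets[of _ borel borel]) auto
  then show ?thesis by (simp add: lattice_cell_def vimage_def)
qed

lemma emeasure_lattice_cell:
  assumes "k \<in> range lattice_floor"
  shows "emeasure lborel (lattice_cell (k::'a::euclidean_space)) = 1"
proof -
  obtain z where z: "k = lattice_floor z" using assms by auto
  have k: "\<lfloor>k \<bullet> b\<rfloor> = k \<bullet> b" if "b \<in> Basis" for b
    using that by (simp add: z lattice_floor_inner)
  have mem: "x \<in> lattice_cell k \<longleftrightarrow> (\<forall>b\<in>Basis. k \<bullet> b \<le> x \<bullet> b \<and> x \<bullet> b < k \<bullet> b + 1)" for x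
  proof -
    have "x \<in> lattice_cell k \<longleftrightarrow> (\<forall>b\<in>Basis. of_int \<lfloor>x \<bullet> b\<rfloor> = k \<bullet> b)"
      by (auto simp: lattice_cell_def euclidean_eq_iff[of _ k] lattice_floor_inner)
    also have "\<dots> \<longleftrightarrow> (\<forall>b\<in>Basis. k \<bullet> b \<le> x \<bullet> b \<and> x \<bullet> b < k \<bullet> b + 1)"
    proof (intro ball_cong refl)
      fix b :: 'a assume "b \<in> Basis"
      then obtain m :: int where m: "k \<bullet> b = of_int m" using k by metis
      then show "of_int \<lfloor>x \<bullet> b\<rfloor> = k \<bullet> b \<longleftrightarrow> k \<bullet> b \<le> x \<bullet> b \<and> x \<bullet> b < k \<bullet> b + 1"
        unfolding m by (simp add: floor_eq_iff)
    qed
    finally show ?thesis .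
  qed
  have "emeasure lborel (lattice_cell k) \<le> emeasure lborel (cbox k (k + One))"
    by (intro emeasure_mono) (auto simp: mem mem_box inner_add_left less_imp_le)
  also have "\<dots> = 1"
    by (simp add: emeasure_lborel_cbox_eq inner_add_left)
  finally have 1: "emeasure lborel (lattice_cell k) \<le> 1" .
  have "1 = emeasure lborel (box k (k + One))"
    by (simp add: emeasure_lborel_box_eq inner_add_left)
  also have "\<dots> \<le> emeasure lborel (lattice_cell k)"
    by (intro emeasure_mono) (auto simp: mem mem_box inner_add_left less_imp_le)
  finally show ?thesis using 1 by simp
qed

text \<open>Peetre's inequality within a cell, both ways: the distance from a point to its lattice
  point is at most the dimension, so \<open>jbracket (y - k)\<close> is at most
  \<open>1 + real DIM('a)\<close>. This makes lattice sums comparable with integrals.\<close>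

lemma jbracket_lattice_le:
  fixes k x y :: "'a::euclidean_space"
  assumes "y \<in> lattice_cell k"
  shows "jbracket (x - k) powr a \<le> (2 * (1 + real DIM('a))) powr \<bar>a\<bar> * jbracket (x - y) powr a"
    and "jbracket (x - y) powr a \<le> (2 * (1 + real DIM('a))) powr \<bar>a\<bar> * jbracket (x - k) powr a"
proof -
  have "norm (y - k) \<le> real DIM('a)"
    using assms norm_lattice_floor_le[of y] by (simp add: lattice_cell_def)
  then have "jbracket (y - k) \<le> 1 + real DIM('a)"
    using jbracket_le[of "y - k"] by linarith
  then have d: "jbracket (y - k) powr \<bar>a\<bar> \<le> (1 + real DIM('a)) powr \<bar>a\<bar>"
    by (intro powr_mono2) auto
  have eq: "(2 * (1 + real DIM('a))) powr \<bar>a\<bar> = 2 powr \<bar>a\<bar> * (1 + real DIM('a)) powr \<bar>a\<bar>"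
    by (simp only: powr_mult)
  have "jbracket (x - k) powr a \<le> 2 powr \<bar>a\<bar> * jbracket (y - k) powr \<bar>a\<bar> * jbracket (x - y) powr a"
    using jbracket_powr_le[of "x - k" a "x - y"] by simp
  also have "\<dots> \<le> 2 powr \<bar>a\<bar> * (1 + real DIM('a)) powr \<bar>a\<bar> * jbracket (x - y) powr a"
    using d by (intro mult_right_mono mult_left_mono) auto
  finally show "jbracket (x - k) powr a \<le> (2 * (1 + real DIM('a))) powr \<bar>a\<bar> * jbracket (x - y) powr a"
    unfolding eq .
  have "jbracket (x - y) powr a \<le> 2 powr \<bar>a\<bar> * jbracket (k - y) powr \<bar>a\<bar> * jbracket (x - k) powr a"
    using jbracket_powr_le[of "x - y" a "x - k"] by simp
  also have "\<dots> \<le> 2 powr \<bar>a\<bar> * (1 + real DIM('a)) powr \<bar>a\<bar> * jbracket (x - k) powr a"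
    using d jbracket_minus[of "y - k"] by (intro mult_right_mono mult_left_mono) (simp_all del: jbracket_minus)
  finally show "jbracket (x - y) powr a \<le> (2 * (1 + real DIM('a))) powr \<bar>a\<bar> * jbracket (x - k) powr a"
    unfolding eq .
qed

lemma sum_indicator_lattice_cell:
  assumes "finite F"
  shows "(\<Sum>k\<in>F. f k * indicator (lattice_cell k) x) = (if lattice_floor x \<in> F then f (lattice_floor x) else (0::ennreal))"
proof -
  have "(\<Sum>k\<in>F. f k * indicator (lattice_cell k) x) = (\<Sum>k\<in>F. if lattice_floor x = k then f k else 0)"
    by (intro sum.cong refl) (simp add: lattice_cell_def indicator_def)
  then show ?thesis using assms by simp
qed

text \<open>Each term is at most a constant times an integral over its cell, and the cells are
  disjoint with measure 1. Invariance of Lebesgue measure then removes the dependence on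
  \<open>x\<close>.\<close>

lemma lattice_sum_bounded:
  assumes a: "a > real DIM('a)"
  shows "\<exists>R\<ge>0. \<forall>F x. finite F \<longrightarrow> F \<subseteq> range (lattice_floor :: 'a::euclidean_space \<Rightarrow> 'a)
    \<longrightarrow> (\<Sum>k\<in>F. jbracket (x - k) powr - a) \<le> R"
proof -
  define C where "C = (2 * (1 + real DIM('a))) powr \<bar>- a\<bar>"
  have C: "0 \<le> C" by (simp add: C_def)
  define J where "J = (\<integral>\<^sup>+x. ennreal (jbracket (x::'a) powr - a) \<partial>lborel)"
  have "J < \<infinity>" unfolding J_def by (rule nn_integral_jbracket_finite[OF a])
  then obtain j where j: "0 \<le> j" "J = ennreal j" by (cases J) auto
  have "(\<Sum>k\<in>F. jbracket (x - k) powr - a) \<le> C * j"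
    if fin: "finite F" and F: "F \<subseteq> range (lattice_floor :: 'a \<Rightarrow> 'a)" for F x
  proof -
    have "ennreal (\<Sum>k\<in>F. jbracket (x - k) powr - a) = (\<Sum>k\<in>F. ennreal (jbracket (x - k) powr - a) * emeasure lborel (lattice_cell k))"
    proof -
      have "(\<Sum>k\<in>F. ennreal (jbracket (x - k) powr - a) * emeasure lborel (lattice_cell k))
          = (\<Sum>k\<in>F. ennreal (jbracket (x - k) powr - a))"
        using F by (intro sum.cong refl) (auto simp: emeasure_lattice_cell)
      then show ?thesis by (simp add: sum_ennreal)
    qed
    also have "\<dots> = (\<Sum>k\<in>F. \<integral>\<^sup>+y. ennreal (jbracket (x - k) powr - a) * indicator (lattice_cell k) y \<partial>lborel)"
      by (simp add: nn_integral_cmult_indicator)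
    also have "\<dots> \<le> (\<Sum>k\<in>F. \<integral>\<^sup>+y. ennreal (C * jbracket (x - y) powr - a) * indicator (lattice_cell k) y \<partial>lborel)"
    proof (intro sum_mono nn_integral_mono)
      fix k y
      show "ennreal (jbracket (x - k) powr - a) * indicator (lattice_cell k) y
          \<le> ennreal (C * jbracket (x - y) powr - a) * indicator (lattice_cell k) y"
        using jbracket_lattice_le(1)[of y k x "- a"]
        by (cases "y \<in> lattice_cell k") (simp_all add: C_def ennreal_leI)
    qed
    also have "\<dots> = (\<integral>\<^sup>+y. (\<Sum>k\<in>F. ennreal (C * jbracket (x - y) powr - a) * indicator (lattice_cell k) y) \<partial>lborel)"
      by (rule nn_integral_sum[symmetric]) measurable
    also have "\<dots> \<le> (\<integral>\<^sup>+y. ennreal C * ennreal (jbracket (x - y) powr - a) \<partial>lborel)"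
      using C by (intro nn_integral_mono) (simp add: sum_indicator_lattice_cell[OF fin] ennreal_mult)
    also have "\<dots> = ennreal C * (\<integral>\<^sup>+y. ennreal (jbracket (x - y) powr - a) \<partial>lborel)"
      by (rule nn_integral_cmult) measurable
    also have "(\<integral>\<^sup>+y. ennreal (jbracket (x - y) powr - a) \<partial>lborel) = J"
      unfolding J_def by (rule nn_integral_lborel_reflect) measurable
    also have "ennreal C * J = ennreal (C * j)" using C j by (simp add: ennreal_mult)
    finally show ?thesis using C j by (simp add: ennreal_le_iff)
  qed
  moreover have "0 \<le> C * j" using C j by simp
  ultimately show ?thesis by blast
qed

lemma countable_lattice: "countable (range (lattice_floor :: 'a::euclidean_space \<Rightarrow> 'a))"
proof -
  have "range (lattice_floor :: 'a \<Rightarrow> 'a) \<subseteq> (\<lambda>g. \<Sum>b\<in>Basis. of_int (g b) *\<^sub>R b) ` (Pi\<^sub>E Basis (\<lambda>b. UNIV :: int set))"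
  proof
    fix k :: 'a assume "k \<in> range lattice_floor"
    then obtain x :: 'a where "k = lattice_floor x" by auto
    then show "k \<in> (\<lambda>g. \<Sum>b\<in>Basis. of_int (g b) *\<^sub>R b) ` (Pi\<^sub>E Basis (\<lambda>b. UNIV :: int set))"
      by (intro image_eqI[of _ _ "restrict (\<lambda>b. \<lfloor>x \<bullet> b\<rfloor>) Basis"]) (auto simp: lattice_floor_def)
  qed
  moreover have "countable (Pi\<^sub>E (Basis :: 'a set) (\<lambda>b. UNIV :: int set))"
    by (intro countable_PiE) auto
  ultimately show ?thesis by (rule countable_subset[OF _ countable_image])
qed

lemma infinite_lattice: "infinite (range (lattice_floor :: 'a::euclidean_space \<Rightarrow> 'a))"
proof
  let ?L = "range (lattice_floor :: 'a \<Rightarrow> 'a)"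
  assume fin: "finite ?L"
  have "emeasure lborel (UNIV :: 'a set) = emeasure lborel (\<Union>k\<in>?L. lattice_cell k)"
    by (rule arg_cong[of _ _ "emeasure lborel"]) (auto simp: lattice_cell_def)
  also have "\<dots> \<le> (\<Sum>k\<in>?L. emeasure lborel (lattice_cell k))"
    by (rule emeasure_subadditive_finite[OF fin]) auto
  also have "\<dots> = of_nat (card ?L)" by (simp add: emeasure_lattice_cell)
  finally show False by (simp add: top_unique)
qed

text \<open>The reverse comparison: bounded partial sums bound the integral of
  \<open>jbracket x powr - a\<close> cell by cell, while that integral is infinite unless
  \<open>a\<close> exceeds the dimension.\<close>

lemma lattice_sum_bounded_imp:
  assumes bdd: "\<And>F. finite F \<Longrightarrow> F \<subseteq> range (lattice_floor :: 'a::euclidean_space \<Rightarrow> 'a) \<Longrightarrow>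
    (\<Sum>k\<in>F. jbracket k powr - a) \<le> C"
  shows "a > real DIM('a)"
proof (rule ccontr)
  assume na: "\<not> a > real DIM('a)"
  define L where "L = range (lattice_floor :: 'a \<Rightarrow> 'a)"
  \<comment> \<open>An enumeration of the lattice makes the sum over cells a series, which can be
    integrated termwise.\<close>
  define e where "e = from_nat_into L"
  have e: "bij_betw e UNIV L"
    unfolding e_def L_def by (rule bij_betw_from_nat_into[OF countable_lattice infinite_lattice])
  define D where "D = (2 * (1 + real DIM('a))) powr \<bar>- a\<bar>"
  have D: "0 \<le> D" by (simp add: D_def)
  have "(\<integral>\<^sup>+x. ennreal (jbracket (x::'a) powr - a) \<partial>lborel)
      \<le> (\<integral>\<^sup>+x. (\<Sum>n. ennreal (D * jbracket (e n) powr - a) * indicator (lattice_cell (e n)) (x::'a)) \<partial>lborel)"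
  proof (intro nn_integral_mono)
    fix x :: 'a
    have "lattice_floor x \<in> L" by (simp add: L_def)
    then obtain n where n: "lattice_floor x = e n" using e unfolding bij_betw_def by (metis imageE)
    then have x: "x \<in> lattice_cell (e n)" by (simp add: lattice_cell_def)
    have "jbracket (- x) powr - a \<le> D * jbracket (- e n) powr - a"
      using jbracket_lattice_le(2)[OF x, of 0 "- a"] by (simp add: D_def del: jbracket_minus)
    then have "ennreal (jbracket x powr - a)
        \<le> ennreal (D * jbracket (e n) powr - a) * indicator (lattice_cell (e n)) x"
      using x by (simp add: ennreal_leI)
    also have "\<dots> \<le> (\<Sum>n. ennreal (D * jbracket (e n) powr - a) * indicator (lattice_cell (e n)) x)"
    proof -
      have "g n \<le> suminf g" for g :: "nat \<Rightarrow> ennreal"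
        using sum_le_suminf[of g "{n}"] by simp
      then show ?thesis .
    qed
    finally show "ennreal (jbracket x powr - a)
        \<le> (\<Sum>n. ennreal (D * jbracket (e n) powr - a) * indicator (lattice_cell (e n)) x)" .
  qed
  also have "\<dots> = (\<Sum>n. \<integral>\<^sup>+x. ennreal (D * jbracket (e n) powr - a) * indicator (lattice_cell (e n)) (x::'a) \<partial>lborel)"
    by (rule nn_integral_suminf) measurable
  also have "\<dots> = (\<Sum>n. ennreal (D * jbracket (e n) powr - a))"
  proof (intro suminf_cong)
    fix n
    have "e n \<in> range lattice_floor" using e unfolding bij_betw_def L_def by auto
    then show "(\<integral>\<^sup>+x. ennreal (D * jbracket (e n) powr - a) * indicator (lattice_cell (e n)) (x::'a) \<partial>lborel)
        = ennreal (D * jbracket (e n) powr - a)"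
      by (simp add: nn_integral_cmult_indicator emeasure_lattice_cell)
  qed
  also have "\<dots> \<le> ennreal (D * C)"
    unfolding suminf_eq_SUP
  proof (rule SUP_least)
    fix m
    have inj: "inj_on e {..<m}" using e unfolding bij_betw_def by (auto intro: inj_on_subset)
    have "(\<Sum>n<m. ennreal (D * jbracket (e n) powr - a)) = ennreal (D * (\<Sum>n<m. jbracket (e n) powr - a))"
      using D by (simp add: sum_distrib_left sum_ennreal)
    also have "(\<Sum>n<m. jbracket (e n) powr - a) = (\<Sum>k\<in>e ` {..<m}. jbracket k powr - a)"
      by (simp add: sum.reindex[OF inj])
    also have "ennreal (D * (\<Sum>k\<in>e ` {..<m}. jbracket k powr - a)) \<le> ennreal (D * C)"
      using e D by (intro ennreal_leI mult_left_mono bdd) (auto simp: bij_betw_def L_def)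
    finally show "(\<Sum>n<m. ennreal (D * jbracket (e n) powr - a)) \<le> ennreal (D * C)" .
  qed
  finally show False
    using nn_integral_jbracket_infinite[of a, where 'a='a] na by (simp add: top_unique)
qed

section \<open>Necessity\<close>

text \<open>Tested on the optimal coefficients, the bound says that \<open>\<langle>\<cdot>\<rangle>^-s\<close> lies in the dual of \<open>l^p\<close> on the
  lattice.\<close>

lemma exponent_condition_of_lattice_bound:
  fixes s K :: real and N :: nat
  assumes p: "1 \<le> p" and N: "\<bar>s\<bar> + 2 * real DIM('a) + 2 \<le> real N" and K: "0 \<le> K"
    and bound: "\<And>F c. finite F \<Longrightarrow> F \<subseteq> range (lattice_floor :: 'a::euclidean_space \<Rightarrow> 'a) \<Longrightarrow> (\<And>k. 0 \<le> c k) \<Longrightarrow>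
      ennreal (\<Sum>k\<in>F. c k)
        \<le> ennreal K * Lp_norm p (\<lambda>x. ennreal ((\<Sum>k\<in>F. c k * (1 / jbracket (x - k) ^ N)) * jbracket x powr s))"
  shows "1 < 1 / p + ereal (s / real DIM('a)) \<or> (p = 1 \<and> s = 0)"
proof -
  \<comment> \<open>The decay \<open>N\<close> is divided into two shares: \<open>m1\<close> makes
    lattice sums bounded uniformly in \<open>x\<close>, and \<open>m2\<close> stays integrable after
    Peetre's inequality has taken the modulus of \<open>s\<close> from it.\<close>
  define m1 where "m1 = real DIM('a) + 1"
  define m2 where "m2 = real N - m1"
  have m2: "\<bar>s\<bar> + real DIM('a) + 1 \<le> m2" using N by (simp add: m2_def m1_def)
  have split: "1 / jbracket x ^ N = jbracket x powr - m1 * jbracket x powr - m2" for x :: 'a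
  proof -
    have "jbracket x powr - m1 * jbracket x powr - m2 = jbracket x powr - real N"
      by (simp add: m2_def flip: powr_add)
    then show ?thesis by (simp add: powr_minus powr_realpow divide_inverse)
  qed
  obtain R where R: "0 \<le> R" "\<And>F x. finite F \<Longrightarrow> F \<subseteq> range (lattice_floor :: 'a \<Rightarrow> 'a) \<Longrightarrow>
      (\<Sum>k\<in>F. jbracket (x - k) powr - m1) \<le> R"
    using lattice_sum_bounded[of m1, where 'a='a] by (auto simp: m1_def)
  show ?thesis
    using p
  proof (cases rule: exponent_cases)
    case 1
    \<comment> \<open>The coefficients are the inverse weight itself: the weighted superposition
      \<open>h\<close> then stays bounded, and the hypothesis bounds the sums of the inverse
      weight.\<close>
    have "(\<Sum>k\<in>F. jbracket k powr - s) \<le> K * (2 powr \<bar>s\<bar> * R)"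
      if F: "finite F" "F \<subseteq> range (lattice_floor :: 'a \<Rightarrow> 'a)" for F
    proof -
      define h where "h x = (\<Sum>k\<in>F. jbracket k powr - s * (1 / jbracket (x - k) ^ N)) * jbracket x powr s" for x
      have h: "h x \<le> 2 powr \<bar>s\<bar> * R" for x
      proof -
        have "h x = (\<Sum>k\<in>F. jbracket k powr - s * jbracket (x - k) powr - real N * jbracket x powr s)"
          by (simp add: h_def sum_distrib_right powr_minus powr_realpow divide_inverse)
        also have "\<dots> \<le> (\<Sum>k\<in>F. jbracket k powr - s * jbracket (x - k) powr - real N
            * (2 powr \<bar>s\<bar> * jbracket (x - k) powr \<bar>s\<bar> * jbracket k powr s))"
          by (intro sum_mono mult_left_mono jbracket_powr_le) auto
        also have "\<dots> = 2 powr \<bar>s\<bar> * (\<Sum>k\<in>F. jbracket (x - k) powr (\<bar>s\<bar> - real N))"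
          by (simp add: sum_distrib_left powr_minus powr_diff field_simps)
        also have "\<dots> \<le> 2 powr \<bar>s\<bar> * (\<Sum>k\<in>F. jbracket (x - k) powr - m1)"
          using m2 unfolding m2_def by (intro mult_left_mono sum_mono powr_mono jbracket_ge_1) auto
        also have "\<dots> \<le> 2 powr \<bar>s\<bar> * R" by (intro mult_left_mono R F) auto
        finally show ?thesis .
      qed
      have "ennreal (\<Sum>k\<in>F. jbracket k powr - s) \<le> ennreal K * Lp_norm p (\<lambda>x. ennreal (h x))"
        unfolding h_def by (rule bound[OF F]) simp
      also have "\<dots> \<le> ennreal K * ennreal (2 powr \<bar>s\<bar> * R)"
      proof (rule mult_left_mono)
        have "Lp_norm p (\<lambda>x. ennreal (h x)) = esssup lborel (\<lambda>x. ennreal (h x))"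
          unfolding 1 Lp_norm_infinity ..
        also have "\<dots> \<le> ennreal (2 powr \<bar>s\<bar> * R)"
        proof (rule esssup_I)
          show "(\<lambda>x. ennreal (h x)) \<in> borel_measurable lborel" unfolding h_def by measurable
        qed (intro AE_I2 ennreal_leI h)
        finally show "Lp_norm p (\<lambda>x. ennreal (h x)) \<le> ennreal (2 powr \<bar>s\<bar> * R)" .
      qed simp
      also have "\<dots> = ennreal (K * (2 powr \<bar>s\<bar> * R))"
        using K R(1) by (simp add: ennreal_mult)
      finally show ?thesis using K R(1) by (simp add: ennreal_le_iff)
    qed
    then have "s > real DIM('a)" by (rule lattice_sum_bounded_imp)
    then show ?thesis using 1 by (simp add: one_ereal_def field_simps)
  next
    case (2 r)
    define J where "J = (\<integral>\<^sup>+x. ennreal (jbracket (x::'a) powr - ((m2 - \<bar>s\<bar>) * r)) \<partial>lborel)"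
    have "J < \<infinity>" unfolding J_def
    proof (rule nn_integral_jbracket_finite)
      have "real DIM('a) < m2 - \<bar>s\<bar>" using m2 by simp
      also have "\<dots> \<le> (m2 - \<bar>s\<bar>) * r" using m2 2 by (simp add: mult_le_cancel_left1)
      finally show "real DIM('a) < (m2 - \<bar>s\<bar>) * r" .
    qed
    then obtain j where j: "0 \<le> j" "J = ennreal j" by (cases J) auto
    define A where "A = R powr r * 2 powr (\<bar>s\<bar> * r) * j"
    have A: "0 \<le> A" using j by (simp add: A_def)
    define B where "B = K * A powr (1 / r)"
    have B: "0 \<le> B" using K by (simp add: B_def)
    \<comment> \<open>The discrete form of the hypothesis: the norm of the superposition is
      dominated by the weighted \<open>l^r\<close> norm of its coefficients.\<close>
    have test: "(\<Sum>k\<in>F. c k) \<le> B * (\<Sum>k\<in>F. c k powr r * jbracket k powr (s * r)) powr (1 / r)"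
      if F: "finite F" "F \<subseteq> range (lattice_floor :: 'a \<Rightarrow> 'a)" and c: "\<And>k. 0 \<le> c k" for F c
    proof -
      define S where "S = (\<Sum>k\<in>F. c k powr r * jbracket k powr (s * r))"
      have S: "0 \<le> S" unfolding S_def by (intro sum_nonneg) auto
      define h where "h x = (\<Sum>k\<in>F. c k * (1 / jbracket (x - k) ^ N)) * jbracket x powr s" for x
      have h0: "0 \<le> h x" for x unfolding h_def using c by (intro mult_nonneg_nonneg sum_nonneg) auto
      have h: "h x powr r \<le> (\<Sum>k\<in>F. (R powr r * 2 powr (\<bar>s\<bar> * r)) * (c k powr r * jbracket k powr (s * r))
          * jbracket (x - k) powr - ((m2 - \<bar>s\<bar>) * r))" for x
      proof -
        define T where "T = (\<Sum>k\<in>F. (c k * jbracket (x - k) powr - m2) powr r)"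
        have T: "0 \<le> T" unfolding T_def by (intro sum_nonneg) auto
        \<comment> \<open>Every term is bounded by the \<open>l^r\<close> norm of all of them, and
          the remaining factors \<open>jbracket (x - k) powr - m1\<close> have bounded sums. This
          treats \<open>r = 1\<close> together with \<open>r > 1\<close>.\<close>
        have "c k * jbracket (x - k) powr - m2 \<le> T powr (1 / r)" if "k \<in> F" for k
        proof -
          have "(c k * jbracket (x - k) powr - m2) powr r \<le> T"
            unfolding T_def using F that by (intro member_le_sum) auto
          then have "((c k * jbracket (x - k) powr - m2) powr r) powr (1 / r) \<le> T powr (1 / r)"
            using 2 by (intro powr_mono2) auto
          then show ?thesis using 2 c by (simp add: powr_powr)
        qed
        then have "(\<Sum>k\<in>F. jbracket (x - k) powr - m1 * (c k * jbracket (x - k) powr - m2))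
            \<le> (\<Sum>k\<in>F. jbracket (x - k) powr - m1 * T powr (1 / r))"
          by (intro sum_mono mult_left_mono) auto
        also have "\<dots> \<le> R * T powr (1 / r)"
          unfolding sum_distrib_right[symmetric] by (intro mult_right_mono R F) auto
        finally have "h x \<le> R * T powr (1 / r) * jbracket x powr s"
          unfolding h_def split by (intro mult_right_mono) (simp_all add: ac_simps)
        then have "h x powr r \<le> (R * T powr (1 / r) * jbracket x powr s) powr r"
          using h0 2 by (intro powr_mono2) auto
        also have "\<dots> = R powr r * T * jbracket x powr (s * r)"
          using R T 2 by (simp add: powr_mult powr_powr)
        also have "\<dots> = (\<Sum>k\<in>F. R powr r * (c k powr r * jbracket (x - k) powr - (m2 * r)) * jbracket x powr (s * r))"
          using c by (simp add: T_def sum_distrib_left sum_distrib_right powr_mult powr_powr)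
        also have "\<dots> \<le> (\<Sum>k\<in>F. R powr r * (c k powr r * jbracket (x - k) powr - (m2 * r))
            * (2 powr (\<bar>s\<bar> * r) * jbracket (x - k) powr (\<bar>s\<bar> * r) * jbracket k powr (s * r)))"
        proof (intro sum_mono mult_left_mono)
          fix k
          have "\<bar>s * r\<bar> = \<bar>s\<bar> * r" using 2 by (simp add: abs_mult)
          then show "jbracket x powr (s * r)
              \<le> 2 powr (\<bar>s\<bar> * r) * jbracket (x - k) powr (\<bar>s\<bar> * r) * jbracket k powr (s * r)"
            using jbracket_powr_le[of x "s * r" k] by simp
        qed auto
        also have "\<dots> = (\<Sum>k\<in>F. (R powr r * 2 powr (\<bar>s\<bar> * r)) * (c k powr r * jbracket k powr (s * r))
            * jbracket (x - k) powr - ((m2 - \<bar>s\<bar>) * r))"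
        proof (intro sum.cong refl)
          fix k
          have "jbracket (x - k) powr - ((m2 - \<bar>s\<bar>) * r)
              = jbracket (x - k) powr - (m2 * r) * jbracket (x - k) powr (\<bar>s\<bar> * r)"
            by (simp add: left_diff_distrib flip: powr_add)
          then show "R powr r * (c k powr r * jbracket (x - k) powr - (m2 * r))
              * (2 powr (\<bar>s\<bar> * r) * jbracket (x - k) powr (\<bar>s\<bar> * r) * jbracket k powr (s * r))
            = (R powr r * 2 powr (\<bar>s\<bar> * r)) * (c k powr r * jbracket k powr (s * r))
              * jbracket (x - k) powr - ((m2 - \<bar>s\<bar>) * r)"
            by (simp only: ac_simps)
        qed
        finally show ?thesis .
      qed
      have "(\<integral>\<^sup>+x. ennreal_powr (ennreal (h x)) r \<partial>lborel)
          \<le> (\<integral>\<^sup>+x. (\<Sum>k\<in>F. ennreal ((R powr r * 2 powr (\<bar>s\<bar> * r)) * (c k powr r * jbracket k powr (s * r)))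
            * ennreal (jbracket (x - k) powr - ((m2 - \<bar>s\<bar>) * r))) \<partial>lborel)"
      proof (intro nn_integral_mono)
        fix x
        have "ennreal_powr (ennreal (h x)) r = ennreal (h x powr r)"
          using h0 by (rule ennreal_powr_ennreal)
        also have "\<dots> \<le> ennreal (\<Sum>k\<in>F. (R powr r * 2 powr (\<bar>s\<bar> * r)) * (c k powr r * jbracket k powr (s * r))
            * jbracket (x - k) powr - ((m2 - \<bar>s\<bar>) * r))"
          by (rule ennreal_leI[OF h])
        also have "\<dots> = (\<Sum>k\<in>F. ennreal ((R powr r * 2 powr (\<bar>s\<bar> * r)) * (c k powr r * jbracket k powr (s * r)))
            * ennreal (jbracket (x - k) powr - ((m2 - \<bar>s\<bar>) * r)))"
          by (subst sum_ennreal[symmetric]) (simp_all add: ennreal_mult')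
        finally show "ennreal_powr (ennreal (h x)) r \<le> \<dots>" .
      qed
      also have "\<dots> = (\<Sum>k\<in>F. ennreal ((R powr r * 2 powr (\<bar>s\<bar> * r)) * (c k powr r * jbracket k powr (s * r)))
            * (\<integral>\<^sup>+x. ennreal (jbracket (x - k) powr - ((m2 - \<bar>s\<bar>) * r)) \<partial>lborel))"
      proof -
        have [measurable]: "(\<lambda>x. jbracket (x - k) powr - ((m2 - \<bar>s\<bar>) * r)) \<in> borel_measurable borel" for k :: 'a
          by measurable
        show ?thesis by (simp add: nn_integral_sum nn_integral_cmult)
      qed
      also have "\<dots> = (\<Sum>k\<in>F. ennreal ((R powr r * 2 powr (\<bar>s\<bar> * r)) * (c k powr r * jbracket k powr (s * r))) * ennreal j)"
      proof (intro sum.cong refl arg_cong2[where f="(*)"])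
        fix k :: 'a
        have "(\<integral>\<^sup>+x. ennreal (jbracket (x - k) powr - ((m2 - \<bar>s\<bar>) * r)) \<partial>lborel) = J"
          unfolding J_def
          using nn_integral_lborel_translate[of "\<lambda>x. ennreal (jbracket x powr - ((m2 - \<bar>s\<bar>) * r))" "- k"] by simp
        then show "(\<integral>\<^sup>+x. ennreal (jbracket (x - k) powr - ((m2 - \<bar>s\<bar>) * r)) \<partial>lborel) = ennreal j"
          using j by simp
      qed
      also have "\<dots> = ennreal (A * S)"
      proof -
        have "A * S = (\<Sum>k\<in>F. ((R powr r * 2 powr (\<bar>s\<bar> * r)) * (c k powr r * jbracket k powr (s * r))) * j)"
          by (simp add: A_def S_def sum_distrib_left ac_simps)
        then have "ennreal (A * S) = ennreal (\<Sum>k\<in>F. ((R powr r * 2 powr (\<bar>s\<bar> * r)) * (c k powr r * jbracket k powr (s * r))) * j)"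
          by (simp only:)
        also have "\<dots> = (\<Sum>k\<in>F. ennreal (((R powr r * 2 powr (\<bar>s\<bar> * r)) * (c k powr r * jbracket k powr (s * r))) * j))"
          using j(1) by (intro sum_ennreal[symmetric]) auto
        also have "\<dots> = (\<Sum>k\<in>F. ennreal ((R powr r * 2 powr (\<bar>s\<bar> * r)) * (c k powr r * jbracket k powr (s * r))) * ennreal j)"
          using j(1) by (intro sum.cong refl ennreal_mult) auto
        finally show ?thesis by simp
      qed
      finally have "Lp_norm p (\<lambda>x. ennreal (h x)) \<le> ennreal_powr (ennreal (A * S)) (1 / r)"
        unfolding 2 Lp_norm_ereal using 2 by (intro ennreal_powr_mono) auto
      also have "\<dots> = ennreal (A powr (1 / r) * S powr (1 / r))"
        using A S by (simp add: ennreal_powr_ennreal powr_mult)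
      finally have "ennreal K * Lp_norm p (\<lambda>x. ennreal (h x)) \<le> ennreal K * ennreal (A powr (1 / r) * S powr (1 / r))"
        by (rule mult_left_mono) simp
      moreover have "ennreal (\<Sum>k\<in>F. c k) \<le> ennreal K * Lp_norm p (\<lambda>x. ennreal (h x))"
        unfolding h_def by (rule bound[OF F c])
      ultimately have "ennreal (\<Sum>k\<in>F. c k) \<le> ennreal K * ennreal (A powr (1 / r) * S powr (1 / r))"
        by (rule order_trans[rotated])
      also have "\<dots> = ennreal (B * S powr (1 / r))"
        using K by (subst ennreal_mult[symmetric]) (auto simp: B_def ac_simps)
      finally show ?thesis
        using B by (subst (asm) ennreal_le_iff) (auto simp: S_def)
    qed
    show ?thesis
    proof (cases "r = 1")
      case True
      then have p1: "p = 1" using 2 by (simp add: one_ereal_def)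
      have "0 \<le> s"
      proof (rule ccontr)
        assume "\<not> 0 \<le> s"
        then have s: "0 < - s" by simp
        define D where "D = (2 * (1 + real DIM('a))) powr \<bar>s\<bar>"
        have D: "0 < D" by (simp add: D_def)
        have "jbracket (x::'a) powr - s \<le> B * D" for x
        proof -
          define k where "k = lattice_floor x"
          \<comment> \<open>A single coefficient at the lattice point of \<open>x\<close> shows that
            the weight is bounded below, which a negative \<open>s\<close> contradicts.\<close>
          have "1 \<le> B * jbracket k powr s"
            using test[of "{k}" "\<lambda>k. 1"] True by (simp add: k_def)
          also have "\<dots> \<le> B * (D * jbracket x powr s)"
            using jbracket_lattice_le(1)[of x k 0 s] B
            by (intro mult_left_mono) (simp_all add: k_def lattice_cell_def D_def)
          finally show ?thesis by (simp add: powr_minus field_simps)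
        qed
        then show False using jbracket_powr_unbounded[OF s, of "B * D", where 'a='a] by (metis not_le)
      qed
      then show ?thesis using p1 by (cases "s = 0") (simp_all add: one_ereal_def)
    next
      case False
      then have r: "1 < r" using 2 by simp
      define r' where "r' = r / (r - 1)"
      have r': "r' > 0" using r by (simp add: r'_def)
      \<comment> \<open>These coefficients are extremal in Hoelder's inequality: both sides of
        \<open>test\<close> then involve the same finite sum \<open>S\<close>, and
        \<open>S \<le> B * S powr (1 / r)\<close> can be solved for \<open>S\<close>.\<close>
      have "(\<Sum>k\<in>F. jbracket k powr - (s * r')) \<le> B powr r'"
        if F: "finite F" "F \<subseteq> range (lattice_floor :: 'a \<Rightarrow> 'a)" for F
      proof -
        define S where "S = (\<Sum>k\<in>F. jbracket k powr - (s * r'))"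
        have S: "0 \<le> S" unfolding S_def by (intro sum_nonneg) auto
        have "(jbracket k powr - (s * r')) powr r * jbracket k powr (s * r) = jbracket k powr - (s * r')" for k :: 'a
        proof -
          have "- (s * r') * r + s * r = - (s * r')" using r by (simp add: r'_def field_simps)
          then show ?thesis by (simp add: powr_powr flip: powr_add)
        qed
        then have SB: "S \<le> B * S powr (1 / r)"
          using test[OF F, of "\<lambda>k. jbracket k powr - (s * r')"] by (simp add: S_def)
        show ?thesis
        proof (cases "S = 0")
          case False
          then have S': "S > 0" using S by simp
          have "S powr (1 / r') \<le> B"
          proof -
            have "1 / r' = 1 - 1 / r" using r by (simp add: r'_def field_simps)
            then have "S powr (1 / r') = S / S powr (1 / r)" using S' by (simp add: powr_diff)
            also have "\<dots> \<le> B" using SB S' by (simp add: divide_le_eq)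
            finally show ?thesis .
          qed
          then have "(S powr (1 / r')) powr r' \<le> B powr r'" using r' by (intro powr_mono2) auto
          then show ?thesis using S' r' by (simp add: powr_powr S_def)
        qed (simp add: S_def)
      qed
      then have "s * r' > real DIM('a)" by (rule lattice_sum_bounded_imp)
      then have "(r - 1) * real DIM('a) < s * r" using r by (simp add: r'_def field_simps)
      then have "1 < 1 / r + s / real DIM('a)" using r by (simp add: field_simps)
      then show ?thesis using 2 r by (simp add: one_ereal_def)
    qed
  qed
qed

section \<open>Transforms of lattice sums of time-frequency shifts\<close>

lemma stft_fun_tf_shift:
  assumes \<phi>: "\<phi> \<in> schwartz" and g: "g \<in> schwartz"
  shows "cmod (stft_fun \<phi> (tf_shift a b g) (x, \<xi>)) = cmod (stft_fun \<phi> g (x - a, \<xi> - b))"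
proof -
  define K where "K = (\<lambda>t. tf_shift a b g t * cnj (\<phi> (t - x)) * cis (- 2 * pi * (\<xi> \<bullet> t)))"
  have "K \<in> schwartz"
    using schwartz_slice_modulated[OF stft_fun_integrand[OF \<phi> schwartz_tf_shift[OF g]]] by (simp add: K_def)
  then have "stft_fun \<phi> (tf_shift a b g) (x, \<xi>) = (\<integral>t. K (a + t) \<partial>lborel)"
    unfolding stft_fun_eq K_def[symmetric]
    by (intro integral_lborel_translate[symmetric] schwartz_measurable)
  also have "\<dots> = (\<integral>t. cis (- 2 * pi * ((\<xi> - b) \<bullet> a))
      * (g t * cnj (\<phi> (t - (x - a))) * cis (- 2 * pi * ((\<xi> - b) \<bullet> t))) \<partial>lborel)"
  proof (intro Bochner_Integration.integral_cong refl)
    fix t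
    have ph: "cis (2 * pi * ((a + t) \<bullet> b)) * cis (- 2 * pi * (\<xi> \<bullet> (a + t)))
        = cis (- 2 * pi * ((\<xi> - b) \<bullet> a)) * cis (- 2 * pi * ((\<xi> - b) \<bullet> t))"
      unfolding cis_mult by (rule arg_cong[of _ _ cis]) (simp add: inner_commute algebra_simps)
    have e: "a + t - x = t - (x - a)" "a + t - a = t" by simp_all
    have "K (a + t) = (cis (2 * pi * ((a + t) \<bullet> b)) * cis (- 2 * pi * (\<xi> \<bullet> (a + t))))
        * (g t * cnj (\<phi> (t - (x - a))))"
      unfolding K_def tf_shift_def e by (simp only: ac_simps)
    then show "K (a + t) = cis (- 2 * pi * ((\<xi> - b) \<bullet> a))
        * (g t * cnj (\<phi> (t - (x - a))) * cis (- 2 * pi * ((\<xi> - b) \<bullet> t)))"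
      unfolding ph by (simp only: ac_simps)
  qed
  also have "\<dots> = cis (- 2 * pi * ((\<xi> - b) \<bullet> a)) * stft_fun \<phi> g (x - a, \<xi> - b)"
    unfolding stft_fun_eq by (rule integral_mult_right_zero)
  finally show ?thesis by (simp add: norm_mult)
qed

lemma stft_fun_sum:
  assumes \<phi>: "\<phi> \<in> schwartz" and f: "\<And>k. k \<in> F \<Longrightarrow> f k \<in> schwartz"
  shows "stft_fun \<phi> (\<lambda>t. \<Sum>k\<in>F. c k * f k t) (x, \<xi>) = (\<Sum>k\<in>F. c k * stft_fun \<phi> (f k) (x, \<xi>))"
proof -
  have int: "integrable lborel (\<lambda>t. f k t * cnj (\<phi> (t - x)) * cis (- 2 * pi * (\<xi> \<bullet> t)))" if "k \<in> F" for k
    using schwartz_integrable[OF schwartz_slice_modulated[OF stft_fun_integrand[OF \<phi> f[OF that]]], of x \<xi>] by simp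
  have "stft_fun \<phi> (\<lambda>t. \<Sum>k\<in>F. c k * f k t) (x, \<xi>)
      = (\<integral>t. (\<Sum>k\<in>F. c k * (f k t * cnj (\<phi> (t - x)) * cis (- 2 * pi * (\<xi> \<bullet> t)))) \<partial>lborel)"
    unfolding stft_fun_eq by (simp add: sum_distrib_right mult.assoc)
  also have "\<dots> = (\<Sum>k\<in>F. c k * stft_fun \<phi> (f k) (x, \<xi>))"
    unfolding stft_fun_eq using int by (subst Bochner_Integration.integral_sum) auto
  finally show ?thesis .
qed

text \<open>Joint decay of order \<open>N + N\<close> is shared equally between position and
  frequency. The separated form is the one whose mixed norm factorises.\<close>

lemma stft_fun_decay:
  assumes "\<phi> \<in> schwartz" "f \<in> schwartz"
  obtains C where "0 \<le> C" "\<And>x \<xi>. cmod (stft_fun \<phi> f (x, \<xi>)) \<le> C * (1 / jbracket x ^ N) * (1 / jbracket \<xi> ^ N)"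
proof -
  obtain C where C: "0 \<le> C" "\<And>z. cmod (stft_fun \<phi> f z) \<le> C / jbracket z ^ (N + N)"
    using schwartz_bounded[OF stft_fun_schwartz[OF assms]] by blast
  have "C / jbracket (x, \<xi>) ^ (N + N) \<le> C * (1 / jbracket x ^ N) * (1 / jbracket \<xi> ^ N)" for x \<xi>
  proof -
    have "jbracket x ^ N * jbracket \<xi> ^ N \<le> jbracket (x, \<xi>) ^ N * jbracket (x, \<xi>) ^ N"
      using jbracket_fst_le[of "(x, \<xi>)"] jbracket_snd_le[of "(x, \<xi>)"]
      by (intro mult_mono power_mono) auto
    then have "C / jbracket (x, \<xi>) ^ (N + N) \<le> C / (jbracket x ^ N * jbracket \<xi> ^ N)"
      using C(1) by (intro divide_left_mono) (auto simp: power_add)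
    then show ?thesis by simp
  qed
  with C show thesis using that by (meson order_trans)
qed

lemma modulation_norm_le_product:
  fixes A B :: "'a::euclidean_space \<Rightarrow> real"
  assumes \<phi>: "\<phi> \<in> schwartz" and f: "f \<in> schwartz" and p: "1 \<le> p" "1 \<le> q" and a: "0 \<le> a"
    and A: "continuous_on UNIV A" "\<And>x. 0 \<le> A x" and B: "continuous_on UNIV B" "\<And>\<xi>. 0 \<le> B \<xi>"
    and le: "\<And>x \<xi>. cmod (stft_fun \<phi> f (x, \<xi>)) \<le> a * A x * B \<xi>"
  shows "modulation_norm \<phi> p q (v_weight s t) (dist_of f)
    \<le> ennreal a * (Lp_norm p (\<lambda>x. ennreal (A x * jbracket x powr s))
      * Lp_norm q (\<lambda>\<xi>. ennreal (B \<xi> * jbracket \<xi> powr t)))"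
proof -
  have "cmod (stft_fun \<phi> f z) * (jbracket (fst z) powr s * jbracket (snd z) powr t)
      \<le> (a * A (fst z) * B (snd z)) * (jbracket (fst z) powr s * jbracket (snd z) powr t)" for z
    using le[of "fst z" "snd z"] by (intro mult_right_mono) auto
  from mixed_norm_mono[OF p continuous_on_weighted_stft_fun[OF \<phi> f] this]
  show ?thesis
    unfolding modulation_norm_dist_of[OF \<phi>] mixed_norm_product[OF p a A B, symmetric] by simp
qed

lemma continuous_on_inverse_jbracket_power:
  "continuous_on S f \<Longrightarrow> continuous_on S (\<lambda>x. 1 / jbracket (f x) ^ N)"
  by (intro continuous_intros) simp_all

lemma Lp_norm_decay_finite:
  assumes p: "1 \<le> p" and N: "s + real DIM('a) < real N"
  shows "Lp_norm p (\<lambda>x::'a::euclidean_space. ennreal (1 / jbracket x ^ N * jbracket x powr s)) < top"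
proof -
  have eq: "1 / jbracket x ^ N * jbracket x powr s = jbracket x powr (s - real N)" for x :: 'a
    by (simp add: powr_diff powr_realpow)
  have d: "(s - real N) / real DIM('a) < -1" using N by (simp add: divide_less_eq)
  have "1 / p + ereal ((s - real N) / real DIM('a)) < 0"
    using p
  proof (cases rule: exponent_cases)
    case (2 r)
    then have "1 / r \<le> 1" by simp
    with d have "1 / r + (s - real N) / real DIM('a) < 0" by linarith
    then show ?thesis using 2 by (simp add: one_ereal_def)
  qed (use d in simp)
  then show ?thesis unfolding eq using Lp_norm_jbracket_finite_iff[OF p] by blast
qed

text \<open>Separated decay of high order beats both weights. Testing a rank-one estimate on a
  single Schwartz function gives information only because its source norm is finite.\<close>

lemma modulation_norm_finite:
  fixes \<phi> f :: "'a::euclidean_space \<Rightarrow> complex"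
  assumes \<phi>: "\<phi> \<in> schwartz" and f: "f \<in> schwartz" and p: "1 \<le> p" "1 \<le> q"
  shows "modulation_norm \<phi> p q (v_weight s t) (dist_of f) < top"
proof -
  obtain N :: nat where N: "\<bar>s\<bar> + \<bar>t\<bar> + real DIM('a) < real N" using reals_Archimedean2 by blast
  obtain C where C: "0 \<le> C" "\<And>x \<xi>. cmod (stft_fun \<phi> f (x, \<xi>)) \<le> C * (1 / jbracket x ^ N) * (1 / jbracket \<xi> ^ N)"
    using stft_fun_decay[OF \<phi> f] by blast
  have "modulation_norm \<phi> p q (v_weight s t) (dist_of f)
    \<le> ennreal C * (Lp_norm p (\<lambda>x::'a. ennreal (1 / jbracket x ^ N * jbracket x powr s))
      * Lp_norm q (\<lambda>\<xi>::'a. ennreal (1 / jbracket \<xi> ^ N * jbracket \<xi> powr t)))"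
    by (rule modulation_norm_le_product[OF \<phi> f p C(1)])
       (use C in \<open>auto intro: continuous_on_inverse_jbracket_power continuous_on_id\<close>)
  also have "\<dots> < top"
    using Lp_norm_decay_finite[OF p(1), of s N, where 'a='a] Lp_norm_decay_finite[OF p(2), of t N, where 'a='a] N
    by (auto simp: ennreal_mult_less_top)
  finally show ?thesis .
qed

lemma stft_fun_lattice_sum_le:
  assumes \<phi>: "\<phi> \<in> schwartz" and g: "g \<in> schwartz" and c: "\<And>k. 0 \<le> c k"
    and C: "\<And>x \<xi>. cmod (stft_fun \<phi> g (x, \<xi>)) \<le> C * (1 / jbracket x ^ N) * (1 / jbracket \<xi> ^ N)"
  shows "cmod (stft_fun \<phi> (\<lambda>t. \<Sum>k\<in>F. of_real (c k) * tf_shift (a k) (b k) g t) (x, \<xi>))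
    \<le> (\<Sum>k\<in>F. c k * (C * (1 / jbracket (x - a k) ^ N) * (1 / jbracket (\<xi> - b k) ^ N)))"
proof -
  have "cmod (\<Sum>k\<in>F. of_real (c k) * stft_fun \<phi> (tf_shift (a k) (b k) g) (x, \<xi>))
      \<le> (\<Sum>k\<in>F. c k * (C * (1 / jbracket (x - a k) ^ N) * (1 / jbracket (\<xi> - b k) ^ N)))"
    unfolding norm_mult
  proof (intro sum_norm_le)
    fix k
    show "cmod (of_real (c k) * stft_fun \<phi> (tf_shift (a k) (b k) g) (x, \<xi>))
        \<le> c k * (C * (1 / jbracket (x - a k) ^ N) * (1 / jbracket (\<xi> - b k) ^ N))"
      unfolding norm_mult stft_fun_tf_shift[OF \<phi> g] using c[of k] by (intro mult_mono C) simp_all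
  qed
  then show ?thesis by (simp only: stft_fun_sum[OF \<phi> schwartz_tf_shift[OF g]])
qed

text \<open>Test functions: lattice sums of translates detect the first pair of exponents, lattice sums of
  modulates the second one.\<close>

lemma exponent_condition_of_functional:
  fixes l :: "'b \<Rightarrow> complex" and n :: "'b \<Rightarrow> ennreal"
  assumes p: "1 \<le> p" and N: "\<bar>s\<bar> + 2 * real DIM('a) + 2 \<le> real N" and K: "0 \<le> K" "0 \<le> D" "0 < \<gamma>"
    and bound: "\<And>f. f \<in> S \<Longrightarrow> ennreal (cmod (l f)) \<le> ennreal K * n f"
    and test: "\<And>F c. (\<And>k. 0 \<le> c k) \<Longrightarrow> \<exists>f\<in>S. cmod (l f) = \<gamma> * (\<Sum>k\<in>F. c k) \<and> n f
      \<le> ennreal D * Lp_norm p (\<lambda>x::'a::euclidean_space.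
          ennreal ((\<Sum>k\<in>F. c k * (1 / jbracket (x - k) ^ N)) * jbracket x powr s))"
  shows "1 < 1 / p + ereal (s / real DIM('a)) \<or> (p = 1 \<and> s = 0)"
proof (rule exponent_condition_of_lattice_bound[OF p N, of "K * D / \<gamma>"])
  show "0 \<le> K * D / \<gamma>" using K by simp
  fix F :: "'a set" and c :: "'a \<Rightarrow> real"
  assume c: "\<And>k. 0 \<le> c k"
  define L where "L = Lp_norm p (\<lambda>x. ennreal ((\<Sum>k\<in>F. c k * (1 / jbracket (x - k) ^ N)) * jbracket x powr s))"
  obtain f where f: "f \<in> S" "cmod (l f) = \<gamma> * (\<Sum>k\<in>F. c k)" "n f \<le> ennreal D * L"
    using test[of c F] c unfolding L_def by blast
  have "ennreal (\<Sum>k\<in>F. c k) = ennreal (1 / \<gamma>) * ennreal (cmod (l f))"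
    using K c by (simp add: f(2) sum_nonneg flip: ennreal_mult)
  also have "\<dots> \<le> ennreal (1 / \<gamma>) * (ennreal K * (ennreal D * L))"
    by (intro mult_left_mono order_trans[OF bound[OF f(1)]] f(3)) simp_all
  also have "\<dots> = ennreal (K * D / \<gamma>) * L"
    using K by (simp add: mult.assoc[symmetric] flip: ennreal_mult)
  finally show "ennreal (\<Sum>k\<in>F. c k) \<le> ennreal (K * D / \<gamma>)
      * Lp_norm p (\<lambda>x. ennreal ((\<Sum>k\<in>F. c k * (1 / jbracket (x - k) ^ N)) * jbracket x powr s))"
    unfolding L_def .
qed

lemma lattice_test_weight:
  fixes c :: "'a::euclidean_space \<Rightarrow> real"
  assumes "\<And>k. 0 \<le> c k"
  shows "continuous_on UNIV (\<lambda>x. \<Sum>k\<in>F. c k * (1 / jbracket (x - k) ^ N))"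
    and "0 \<le> (\<Sum>k\<in>F. c k * (1 / jbracket (x - k) ^ N))"
    and "continuous_on UNIV (\<lambda>x::'a. 1 / jbracket x ^ N)" and "0 \<le> 1 / jbracket x ^ N"
  using assms
  by (auto intro!: continuous_intros continuous_on_inverse_jbracket_power sum_nonneg simp del: mult_1_right times_divide_eq_right)

text \<open>Translates of the nonnegative function \<open>g\<close> have the same positive integral,
  so the functional sees the plain sum of the coefficients. Their transforms share one bound in
  \<open>\<xi>\<close>, whose norm is the fixed number \<open>Q\<close>, so only the first pair of
  exponents is tested.\<close>

lemma exponents_of_integral_bound:
  fixes \<phi> :: "'a::euclidean_space \<Rightarrow> complex"
  assumes \<phi>: "\<phi> \<in> schwartz" "\<phi> \<noteq> (\<lambda>x. 0)" and p: "1 \<le> p" "1 \<le> q" and K: "0 \<le> K"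
    and bound: "\<And>f. f \<in> schwartz \<Longrightarrow>
      ennreal (cmod (\<integral>x. f x \<partial>lborel)) \<le> ennreal K * modulation_norm \<phi> p q (v_weight s t) (dist_of f)"
  shows "1 < 1 / p + ereal (s / real DIM('a)) \<or> (p = 1 \<and> s = 0)"
proof -
  define g where "g = (\<lambda>x. \<phi> x * cnj (\<phi> x))"
  have g: "g \<in> schwartz" unfolding g_def by (intro schwartz_mult schwartz_cnj \<phi>)
  have \<gamma>: "0 < cmod (\<integral>x. g x \<partial>lborel)" using schwartz_nonzero_integral[OF \<phi>] by (simp add: g_def)
  obtain N :: nat where N: "\<bar>s\<bar> + \<bar>t\<bar> + 2 * real DIM('a) + 2 < real N" using reals_Archimedean2 by blast
  obtain C where C: "0 \<le> C" "\<And>x \<xi>. cmod (stft_fun \<phi> g (x, \<xi>)) \<le> C * (1 / jbracket x ^ N) * (1 / jbracket \<xi> ^ N)"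
    using stft_fun_decay[OF \<phi>(1) g] by blast
  define Q where "Q = Lp_norm q (\<lambda>\<xi>::'a. ennreal (1 / jbracket \<xi> ^ N * jbracket \<xi> powr t))"
  have "Q < top" unfolding Q_def by (rule Lp_norm_decay_finite[OF p(2)]) (use N in linarith)
  then obtain Q' where Q': "0 \<le> Q'" "Q = ennreal Q'" by (cases Q) auto
  show ?thesis
  proof (rule exponent_condition_of_functional[where S=schwartz
        and n="\<lambda>f. modulation_norm \<phi> p q (v_weight s t) (dist_of f)", OF p(1) _ K _ \<gamma> bound])
    show "\<bar>s\<bar> + 2 * real DIM('a) + 2 \<le> real N" using N by linarith
    show "0 \<le> C * Q'" using C(1) Q'(1) by simp
    fix F :: "'a set" and c :: "'a \<Rightarrow> real"
    assume c: "\<And>k. 0 \<le> c k"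
    define f where "f = (\<lambda>t. \<Sum>k\<in>F. of_real (c k) * tf_shift k 0 g t)"
    have f: "f \<in> schwartz" unfolding f_def by (intro schwartz_sum schwartz_cmult schwartz_tf_shift g)
    have "(\<integral>x. tf_shift k 0 g x \<partial>lborel) = (\<integral>x. g x \<partial>lborel)" for k
      using integral_lborel_translate[OF schwartz_measurable[OF g], of "- k"] by (simp add: tf_shift_def)
    then have "(\<integral>x. f x \<partial>lborel) = of_real (\<Sum>k\<in>F. c k) * (\<integral>x. g x \<partial>lborel)"
      unfolding f_def
      by (subst Bochner_Integration.integral_sum)
         (auto simp: sum_distrib_right intro!: schwartz_integrable schwartz_tf_shift g integrable_mult_right)
    then have int: "cmod (\<integral>x. f x \<partial>lborel) = cmod (\<integral>x. g x \<partial>lborel) * (\<Sum>k\<in>F. c k)"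
      using c by (simp add: norm_mult sum_nonneg mult.commute del: of_real_sum)
    have "modulation_norm \<phi> p q (v_weight s t) (dist_of f) \<le> ennreal C
        * (Lp_norm p (\<lambda>x. ennreal ((\<Sum>k\<in>F. c k * (1 / jbracket (x - k) ^ N)) * jbracket x powr s)) * Q)"
      unfolding Q_def
    proof (rule modulation_norm_le_product[OF \<phi>(1) f p C(1) lattice_test_weight[OF c]])
      show "cmod (stft_fun \<phi> f (x, \<xi>))
          \<le> C * (\<Sum>k\<in>F. c k * (1 / jbracket (x - k) ^ N)) * (1 / jbracket \<xi> ^ N)" for x \<xi>
        using stft_fun_lattice_sum_le[OF \<phi>(1) g c C(2), where F=F and a="\<lambda>k. k" and b="\<lambda>k. 0" and x=x and \<xi>=\<xi>]
        by (simp add: f_def sum_distrib_left sum_distrib_right ac_simps)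
    qed
    then show "\<exists>f\<in>schwartz. cmod (\<integral>x. f x \<partial>lborel) = cmod (\<integral>x. g x \<partial>lborel) * (\<Sum>k\<in>F. c k)
        \<and> modulation_norm \<phi> p q (v_weight s t) (dist_of f) \<le> ennreal (C * Q')
          * Lp_norm p (\<lambda>x. ennreal ((\<Sum>k\<in>F. c k * (1 / jbracket (x - k) ^ N)) * jbracket x powr s))"
      using f int C(1) Q' by (intro bexI[of _ f]) (simp_all add: ennreal_mult ac_simps)
  qed
qed

text \<open>The counterpart in frequency: modulations do not change the value at 0, and the
  modulated copies share one bound in \<open>x\<close>, with the fixed norm \<open>P\<close>. The
  function \<open>g\<close> is a translate of the window that does not vanish at 0.\<close>

lemma exponents_of_evaluation_bound:
  fixes \<phi> :: "'a::euclidean_space \<Rightarrow> complex"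
  assumes \<phi>: "\<phi> \<in> schwartz" "\<phi> \<noteq> (\<lambda>x. 0)" and p: "1 \<le> p" "1 \<le> q" and K: "0 \<le> K"
    and bound: "\<And>f. f \<in> schwartz \<Longrightarrow>
      ennreal (cmod (f 0)) \<le> ennreal K * modulation_norm \<phi> p q (v_weight s t) (dist_of f)"
  shows "1 < 1 / q + ereal (t / real DIM('a)) \<or> (q = 1 \<and> t = 0)"
proof -
  obtain a where a: "\<phi> a \<noteq> 0" using \<phi>(2) by auto
  define g where "g = (\<lambda>x. \<phi> (x - (- a)))"
  have g: "g \<in> schwartz" unfolding g_def by (intro schwartz_translate \<phi>)
  have \<gamma>: "0 < cmod (g 0)" using a by (simp add: g_def)
  obtain N :: nat where N: "\<bar>s\<bar> + \<bar>t\<bar> + 2 * real DIM('a) + 2 < real N" using reals_Archimedean2 by blast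
  obtain C where C: "0 \<le> C" "\<And>x \<xi>. cmod (stft_fun \<phi> g (x, \<xi>)) \<le> C * (1 / jbracket x ^ N) * (1 / jbracket \<xi> ^ N)"
    using stft_fun_decay[OF \<phi>(1) g] by blast
  define P where "P = Lp_norm p (\<lambda>x::'a. ennreal (1 / jbracket x ^ N * jbracket x powr s))"
  have "P < top" unfolding P_def by (rule Lp_norm_decay_finite[OF p(1)]) (use N in linarith)
  then obtain P' where P': "0 \<le> P'" "P = ennreal P'" by (cases P) auto
  show ?thesis
  proof (rule exponent_condition_of_functional[where l="\<lambda>f. f 0" and S=schwartz
        and n="\<lambda>f. modulation_norm \<phi> p q (v_weight s t) (dist_of f)", OF p(2) _ K _ \<gamma> bound])
    show "\<bar>t\<bar> + 2 * real DIM('a) + 2 \<le> real N" using N by linarith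
    show "0 \<le> C * P'" using C(1) P'(1) by simp
    fix F :: "'a set" and c :: "'a \<Rightarrow> real"
    assume c: "\<And>k. 0 \<le> c k"
    define f where "f = (\<lambda>t. \<Sum>k\<in>F. of_real (c k) * tf_shift 0 k g t)"
    have f: "f \<in> schwartz" unfolding f_def by (intro schwartz_sum schwartz_cmult schwartz_tf_shift g)
    have "f 0 = of_real (\<Sum>k\<in>F. c k) * g 0"
      by (simp add: f_def tf_shift_def sum_distrib_right)
    then have val: "cmod (f 0) = cmod (g 0) * (\<Sum>k\<in>F. c k)"
      using c by (simp add: norm_mult sum_nonneg mult.commute del: of_real_sum)
    have "modulation_norm \<phi> p q (v_weight s t) (dist_of f) \<le> ennreal C
        * (P * Lp_norm q (\<lambda>\<xi>. ennreal ((\<Sum>k\<in>F. c k * (1 / jbracket (\<xi> - k) ^ N)) * jbracket \<xi> powr t)))"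
      unfolding P_def
    proof (rule modulation_norm_le_product[OF \<phi>(1) f p C(1) lattice_test_weight(3,4)[OF c] lattice_test_weight(1,2)[OF c]])
      show "cmod (stft_fun \<phi> f (x, \<xi>))
          \<le> C * (1 / jbracket x ^ N) * (\<Sum>k\<in>F. c k * (1 / jbracket (\<xi> - k) ^ N))" for x \<xi>
        using stft_fun_lattice_sum_le[OF \<phi>(1) g c C(2), where F=F and a="\<lambda>k. 0" and b="\<lambda>k. k" and x=x and \<xi>=\<xi>]
        by (simp add: f_def sum_distrib_left sum_distrib_right ac_simps)
    qed
    then show "\<exists>f\<in>schwartz. cmod (f 0) = cmod (g 0) * (\<Sum>k\<in>F. c k)
        \<and> modulation_norm \<phi> p q (v_weight s t) (dist_of f) \<le> ennreal (C * P')
          * Lp_norm q (\<lambda>x. ennreal ((\<Sum>k\<in>F. c k * (1 / jbracket (x - k) ^ N)) * jbracket x powr t))"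
      using f val C(1) P' by (intro bexI[of _ f]) (simp_all add: ennreal_mult ac_simps)
  qed
qed

section \<open>Boundedness of rank-one operators\<close>

lemma rank_one_bound:
  fixes l :: "'b \<Rightarrow> real" and E :: ennreal
  assumes E: "0 < E" and le: "\<And>f. f \<in> S \<Longrightarrow> ennreal (l f) * E \<le> ennreal C * n f"
    and g: "g \<in> S" "0 < l g" "n g < top"
  shows "E < top" and "\<exists>K\<ge>0. \<forall>f\<in>S. ennreal (l f) \<le> ennreal K * n f"
proof -
  \<comment> \<open>One \<open>g\<close> of finite norm on which the functional is positive shows
    that the fixed factor \<open>E\<close> is finite; afterwards \<open>E\<close> can be divided out
    for all \<open>f\<close>.\<close>
  have "ennreal (l g) * E < top"
    by (rule le_less_trans[OF le[OF g(1)]]) (use g(3) in \<open>simp add: ennreal_mult_less_top\<close>)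
  then show fin: "E < top" using g(2) by (auto simp: ennreal_mult_less_top)
  then obtain e where e: "0 < e" "E = ennreal e" using E by (cases E) auto
  \<comment> \<open>A negative \<open>C\<close> is sent to 0 by \<open>ennreal\<close>; replacing it
    by \<open>max C 0\<close> keeps the bound and makes the constant nonnegative.\<close>
  have "ennreal (l f) \<le> ennreal (max C 0 / e) * n f" if f: "f \<in> S" for f
  proof -
    have "ennreal (1 / e) * E = 1" using e by (simp flip: ennreal_mult)
    then have "ennreal (l f) = ennreal (1 / e) * (ennreal (l f) * E)"
      by (metis mult.left_commute mult.right_neutral)
    also have "\<dots> \<le> ennreal (1 / e) * (ennreal C * n f)" by (intro mult_left_mono le f) simp
    also have "\<dots> \<le> ennreal (1 / e) * (ennreal (max C 0) * n f)"
      by (intro mult_left_mono mult_right_mono ennreal_leI) auto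
    also have "\<dots> = ennreal (max C 0 / e) * n f"
      using e by (simp add: mult.assoc[symmetric] flip: ennreal_mult)
    finally show ?thesis .
  qed
  moreover have "0 \<le> max C 0 / e" using e by simp
  ultimately show "\<exists>K\<ge>0. \<forall>f\<in>S. ennreal (l f) \<le> ennreal K * n f" by blast
qed

lemma modulation_norm_rank_one:
  fixes A B :: "'a::euclidean_space \<Rightarrow> real"
  assumes p: "1 \<le> p" "1 \<le> q" and a: "0 \<le> a"
    and A: "continuous_on UNIV A" "\<And>x. 0 \<le> A x" and B: "continuous_on UNIV B" "\<And>\<xi>. 0 \<le> B \<xi>"
    and eq: "\<And>x \<xi>. cmod (stft \<phi> u x \<xi>) = a * A x * B \<xi>"
  shows "modulation_norm \<phi> p q (v_weight s t) u
    = ennreal a * (Lp_norm p (\<lambda>x. ennreal (A x * jbracket x powr s))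
      * Lp_norm q (\<lambda>\<xi>. ennreal (B \<xi> * jbracket \<xi> powr t)))"
  unfolding mixed_norm_product[OF p a A B, symmetric]
  by (simp add: modulation_norm_def eq v_weight_def)

lemma OP_tau_maps_rank_one:
  fixes \<phi> :: "'a::euclidean_space \<Rightarrow> complex"
  assumes \<phi>: "\<phi> \<in> schwartz" and p: "1 \<le> p1" "1 \<le> q1" "1 \<le> p2" "1 \<le> q2"
    and maps: "OP_tau_maps \<phi> \<tau> X p1 q1 (v_weight s1 t1) p2 q2 (v_weight s2 t2)" and \<sigma>: "\<sigma> \<in> X"
    and k: "0 < k" "\<And>f x \<xi>. f \<in> schwartz \<Longrightarrow> cmod (stft \<phi> (OP_tau \<tau> \<sigma> f) x \<xi>) = k * cmod (l f) * A x * B \<xi>"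
    and A: "continuous_on UNIV A" "\<And>x. 0 \<le> A x" "0 < A a" and B: "continuous_on UNIV B" "\<And>\<xi>. 0 \<le> B \<xi>" "0 < B b"
    and g: "g \<in> schwartz" "l g \<noteq> 0"
  shows "Lp_norm p2 (\<lambda>x. ennreal (A x * jbracket x powr s2)) < top"
    and "Lp_norm q2 (\<lambda>\<xi>. ennreal (B \<xi> * jbracket \<xi> powr t2)) < top"
    and "\<exists>K\<ge>0. \<forall>f\<in>schwartz. ennreal (cmod (l f)) \<le> ennreal K * modulation_norm \<phi> p1 q1 (v_weight s1 t1) (dist_of f)"
proof -
  obtain C :: real where C: "\<forall>f\<in>schwartz. modulation_norm \<phi> p2 q2 (v_weight s2 t2) (OP_tau \<tau> \<sigma> f)
      \<le> ennreal C * modulation_norm \<phi> p1 q1 (v_weight s1 t1) (dist_of f)"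
    using maps \<sigma> unfolding OP_tau_maps_def by blast
  define P where "P = Lp_norm p2 (\<lambda>x. ennreal (A x * jbracket x powr s2))"
  define Q where "Q = Lp_norm q2 (\<lambda>\<xi>. ennreal (B \<xi> * jbracket \<xi> powr t2))"
  \<comment> \<open>Positivity of both norms is what lets finiteness of the product
    \<open>P * Q\<close> bound each factor separately.\<close>
  have P: "0 < P" unfolding P_def
    by (rule Lp_norm_pos[OF p(3), of _ a])
       (use A in \<open>auto intro!: continuous_on_mult continuous_on_jbracket_powr continuous_on_id\<close>)
  have Q: "0 < Q" unfolding Q_def
    by (rule Lp_norm_pos[OF p(4), of _ b])
       (use B in \<open>auto intro!: continuous_on_mult continuous_on_jbracket_powr continuous_on_id\<close>)
  define E where "E = ennreal k * (P * Q)"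
  have E: "0 < E" using k(1) P Q by (simp add: E_def ennreal_zero_less_mult_iff)
  have bound: "ennreal (cmod (l f)) * E
      \<le> ennreal C * modulation_norm \<phi> p1 q1 (v_weight s1 t1) (dist_of f)" if f: "f \<in> schwartz" for f
  proof -
    have "modulation_norm \<phi> p2 q2 (v_weight s2 t2) (OP_tau \<tau> \<sigma> f) = ennreal (k * cmod (l f)) * (P * Q)"
      unfolding P_def Q_def
      by (rule modulation_norm_rank_one[OF p(3,4) _ A(1,2) B(1,2) k(2)[OF f]]) (use k(1) in simp)
    also have "\<dots> = ennreal (cmod (l f)) * E"
      using k(1) by (simp add: E_def ennreal_mult ac_simps)
    finally show ?thesis using C f by metis
  qed
  have g0: "0 < cmod (l g)" using g(2) by simp
  note R = rank_one_bound[where l="\<lambda>f. cmod (l f)" and S=schwartz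
      and n="\<lambda>f. modulation_norm \<phi> p1 q1 (v_weight s1 t1) (dist_of f)",
      OF E bound g(1) g0 modulation_norm_finite[OF \<phi> g(1) p(1,2)]]
  show "\<exists>K\<ge>0. \<forall>f\<in>schwartz. ennreal (cmod (l f)) \<le> ennreal K * modulation_norm \<phi> p1 q1 (v_weight s1 t1) (dist_of f)"
    by (rule R(2))
  show "Lp_norm p2 (\<lambda>x. ennreal (A x * jbracket x powr s2)) < top"
    "Lp_norm q2 (\<lambda>\<xi>. ennreal (B \<xi> * jbracket \<xi> powr t2)) < top"
    using R(1) P Q k(1) by (auto simp: E_def ennreal_mult_less_top simp flip: P_def Q_def)
qed

text \<open>The modulus of the output transform is \<open>cmod (\<phi> (- x))\<close> times a factor
  constant in \<open>\<xi>\<close>. The \<open>\<xi>\<close> part of the target norm is therefore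
  the norm of the bare weight, while from the \<open>x\<close> part only positivity is used.\<close>

lemma OP_tau_maps_necessary_delta:
  fixes \<phi> :: "'a::euclidean_space \<Rightarrow> complex" and \<Phi> :: "'a \<times> 'a \<Rightarrow> complex"
  assumes \<phi>: "\<phi> \<in> schwartz" "\<phi> \<noteq> (\<lambda>x. 0)" and \<Phi>: "\<Phi> \<in> schwartz"
    and p: "1 \<le> p1" "1 \<le> q1" "1 \<le> p2" "1 \<le> q2" and \<tau>: "0 < \<tau>"
    and maps: "OP_tau_maps \<phi> \<tau> (wiener_amalgam \<Phi> 1 \<infinity>) p1 q1 (v_weight s1 t1) p2 q2 (v_weight s2 t2)"
  shows "1 < 1 / p1 + ereal (s1 / real DIM('a)) \<or> (p1 = 1 \<and> s1 = 0)"
    and "1 / q2 + ereal (t2 / real DIM('a)) < 0 \<or> (q2 = \<infinity> \<and> t2 = 0)"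
proof -
  obtain k where k: "0 < k" "\<forall>f\<in>schwartz. \<forall>x \<xi>. cmod (stft \<phi> (OP_tau \<tau> (dist_of (chirp (1 / \<tau>))) f) x \<xi>)
      = k * cmod (\<integral>y. f y \<partial>lborel) * cmod (\<phi> (- x))"
    using stft_OP_tau_chirp_delta[OF \<phi> \<tau>] by blast
  obtain a where a: "\<phi> a \<noteq> 0" using \<phi>(2) by auto
  have g: "(\<lambda>x. \<phi> x * cnj (\<phi> x)) \<in> schwartz" "(\<integral>x. \<phi> x * cnj (\<phi> x) \<partial>lborel) \<noteq> 0"
    using schwartz_nonzero_integral[OF \<phi>] schwartz_mult[OF \<phi>(1) schwartz_cnj[OF \<phi>(1)]] by auto
  have "continuous_on UNIV (\<lambda>x. cmod (\<phi> (- x)))" "0 < cmod (\<phi> (- (- a)))"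
    using a by (auto intro!: continuous_intros schwartz_continuous_on[OF \<phi>(1)])
  note R = OP_tau_maps_rank_one[OF \<phi>(1) p maps chirp_wiener_amalgam[OF \<Phi>, of "1 / \<tau>"] k(1),
      where l="\<lambda>f. \<integral>y. f y \<partial>lborel" and A="\<lambda>x. cmod (\<phi> (- x))" and B="\<lambda>\<xi>. 1",
      OF _ this(1) norm_ge_zero this(2) continuous_on_const zero_le_one zero_less_one g]
  obtain K where K: "0 \<le> K" "\<forall>f\<in>schwartz. ennreal (cmod (\<integral>y. f y \<partial>lborel))
      \<le> ennreal K * modulation_norm \<phi> p1 q1 (v_weight s1 t1) (dist_of f)"
    using R(3) k(2) by auto
  show "1 < 1 / p1 + ereal (s1 / real DIM('a)) \<or> (p1 = 1 \<and> s1 = 0)"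
    by (rule exponents_of_integral_bound[OF \<phi> p(1,2) K(1)]) (use K(2) in blast)
  show "1 / q2 + ereal (t2 / real DIM('a)) < 0 \<or> (q2 = \<infinity> \<and> t2 = 0)"
    using R(2) k(2) Lp_norm_jbracket_finite_iff[OF p(4), of t2, where 'a='a] by simp
qed

text \<open>Position and frequency exchange roles: the output transform is constant in modulus along
  \<open>x\<close> and follows the Fourier transform of the window in \<open>\<xi>\<close>, which is
  not identically 0 by Fourier inversion.\<close>

lemma OP_tau_maps_necessary_const:
  fixes \<phi> :: "'a::euclidean_space \<Rightarrow> complex" and \<Phi> :: "'a \<times> 'a \<Rightarrow> complex"
  assumes \<phi>: "\<phi> \<in> schwartz" "\<phi> \<noteq> (\<lambda>x. 0)" and \<Phi>: "\<Phi> \<in> schwartz"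
    and p: "1 \<le> p1" "1 \<le> q1" "1 \<le> p2" "1 \<le> q2" and \<tau>: "\<tau> < 1"
    and maps: "OP_tau_maps \<phi> \<tau> (wiener_amalgam \<Phi> 1 \<infinity>) p1 q1 (v_weight s1 t1) p2 q2 (v_weight s2 t2)"
  shows "1 < 1 / q1 + ereal (t1 / real DIM('a)) \<or> (q1 = 1 \<and> t1 = 0)"
    and "1 / p2 + ereal (s2 / real DIM('a)) < 0 \<or> (p2 = \<infinity> \<and> s2 = 0)"
proof -
  obtain k where k: "0 < k" "\<forall>f\<in>schwartz. \<forall>x \<xi>. cmod (stft \<phi> (OP_tau \<tau> (dist_of (chirp (- (1 / (1 - \<tau>))))) f) x \<xi>)
      = k * cmod (f 0) * cmod (fourier \<phi> (- \<xi>))"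
    using stft_OP_tau_chirp_const[OF \<phi> \<tau>] by blast
  obtain a where a: "\<phi> a \<noteq> 0" using \<phi>(2) by auto
  have g: "(\<lambda>x. \<phi> (x - (- a))) \<in> schwartz" "\<phi> (0 - (- a)) \<noteq> 0"
    using a schwartz_translate[OF \<phi>(1), of "- a"] by simp_all
  obtain b where b: "fourier \<phi> b \<noteq> 0" using fourier_nonzero[OF \<phi>] by auto
  have "continuous_on UNIV (\<lambda>\<xi>. cmod (fourier \<phi> (- \<xi>)))" "0 < cmod (fourier \<phi> (- (- b)))"
    using b by (auto intro!: continuous_intros schwartz_continuous_on[OF fourier_schwartz[OF \<phi>(1)]])
  note R = OP_tau_maps_rank_one[OF \<phi>(1) p maps chirp_wiener_amalgam[OF \<Phi>, of "- (1 / (1 - \<tau>))"] k(1),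
      where l="\<lambda>f. f 0" and B="\<lambda>\<xi>. cmod (fourier \<phi> (- \<xi>))" and A="\<lambda>x. 1",
      OF _ continuous_on_const zero_le_one zero_less_one this(1) norm_ge_zero this(2) g]
  obtain K where K: "0 \<le> K" "\<forall>f\<in>schwartz. ennreal (cmod (f 0))
      \<le> ennreal K * modulation_norm \<phi> p1 q1 (v_weight s1 t1) (dist_of f)"
    using R(3) k(2) by auto
  show "1 < 1 / q1 + ereal (t1 / real DIM('a)) \<or> (q1 = 1 \<and> t1 = 0)"
    by (rule exponents_of_evaluation_bound[OF \<phi> p(1,2) K(1)]) (use K(2) in blast)
  show "1 / p2 + ereal (s2 / real DIM('a)) < 0 \<or> (p2 = \<infinity> \<and> s2 = 0)"
    using R(1) k(2) Lp_norm_jbracket_finite_iff[OF p(3), of s2, where 'a='a] by simp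
qed

text \<open>As \<open>1 / p\<close> is at most 1, the strict inequality leaves a positive amount for
  \<open>s / d\<close>. Together with its target counterpart this yields the sign conditions listed
  in the theorem.\<close>

lemma source_exponents_nonneg:
  assumes "1 \<le> p" "1 < 1 / p + ereal (s / d) \<or> (p = 1 \<and> s = 0)" "0 < d"
  shows "0 \<le> s"
  using assms(1)
proof (cases rule: exponent_cases)
  case 1
  then show ?thesis using assms(2,3) by (auto simp: one_ereal_def less_divide_eq)
next
  case (2 r)
  then have "1 < 1 / r + s / d \<or> s = 0" using assms(2) by (auto simp: one_ereal_def)
  moreover have "1 / r \<le> 1" using 2 by simp
  ultimately have "0 < s / d \<or> s = 0" by linarith
  then show ?thesis using assms(3) by (auto simp: zero_less_divide_iff)
qed

lemma target_exponents_nonpos: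
  assumes "1 \<le> p" "1 / p + ereal (s / d) < 0 \<or> (p = \<infinity> \<and> s = 0)" "0 < d"
  shows "s \<le> 0"
  using assms(1)
proof (cases rule: exponent_cases)
  case 1
  then show ?thesis using assms(2,3) by (auto simp: divide_less_0_iff)
next
  case (2 r)
  then have "1 / r + s / d < 0" using assms(2) by (auto simp: one_ereal_def)
  moreover have "0 \<le> 1 / r" using 2 by simp
  ultimately have "s / d < 0" by linarith
  then show ?thesis using assms(3) by (auto simp: divide_less_0_iff)
qed

lemma exponents_unweighted:
  assumes "1 \<le> p"
  shows "1 < 1 / p + ereal (0 / d) \<or> (p = 1 \<and> (0::real) = 0) \<longleftrightarrow> p = 1"
    and "1 / p + ereal (0 / d) < 0 \<or> (p = \<infinity> \<and> (0::real) = 0) \<longleftrightarrow> p = \<infinity>"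
proof -
  show "1 < 1 / p + ereal (0 / d) \<or> (p = 1 \<and> (0::real) = 0) \<longleftrightarrow> p = 1"
    using assms by (cases rule: exponent_cases) (auto simp: one_ereal_def less_divide_eq)
  show "1 / p + ereal (0 / d) < 0 \<or> (p = \<infinity> \<and> (0::real) = 0) \<longleftrightarrow> p = \<infinity>"
    using assms by (cases rule: exponent_cases) (auto simp: one_ereal_def divide_less_0_iff)
qed

theorem theorem6p7:
  fixes \<phi> :: "real ^ 'd \<Rightarrow> complex" and \<Phi> :: "(real ^ 'd) \<times> (real ^ 'd) \<Rightarrow> complex"
    and p1 p2 q1 q2 :: ereal and s1 s2 t1 t2 \<tau> :: real
  assumes "\<phi> \<in> schwartz" "\<phi> \<noteq> (\<lambda>x. 0)" and "\<Phi> \<in> schwartz" "\<Phi> \<noteq> (\<lambda>z. 0)"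
    and "1 \<le> p1" "1 \<le> p2" "1 \<le> q1" "1 \<le> q2"
    and "0 < \<tau>" "\<tau> < 1"
  shows
    "(OP_tau_maps \<phi> \<tau> (wiener_amalgam \<Phi> 1 \<infinity>) p1 q1 (v_weight s1 t1) p2 q2 (v_weight s2 t2)
      \<longleftrightarrow>
        (s2 \<le> 0 \<and> 0 \<le> s1
         \<and> (1 < 1 / p1 + ereal (s1 / real CARD('d)) \<or> (p1, s1) = (1, 0))
         \<and> (1 / p2 + ereal (s2 / real CARD('d)) < 0 \<or> (p2, s2) = (\<infinity>, 0)))
      \<and> (t2 \<le> 0 \<and> 0 \<le> t1
         \<and> (1 < 1 / q1 + ereal (t1 / real CARD('d)) \<or> (q1, t1) = (1, 0))
         \<and> (1 / q2 + ereal (t2 / real CARD('d)) < 0 \<or> (q2, t2) = (\<infinity>, 0))))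
     \<and>
     (s1 = 0 \<and> s2 = 0 \<and> t1 = 0 \<and> t2 = 0 \<longrightarrow>
       (OP_tau_maps \<phi> \<tau> (wiener_amalgam \<Phi> 1 \<infinity>) p1 q1 (v_weight s1 t1) p2 q2 (v_weight s2 t2)
        \<longleftrightarrow> p1 = 1 \<and> q1 = 1 \<and> p2 = \<infinity> \<and> q2 = \<infinity>))"
proof -
  let ?M = "OP_tau_maps \<phi> \<tau> (wiener_amalgam \<Phi> 1 \<infinity>) p1 q1 (v_weight s1 t1) p2 q2 (v_weight s2 t2)"
  let ?d = "real CARD('d)"
  have d: "real DIM(real ^ 'd) = ?d" "0 < ?d" by simp_all
  have iff: "?M \<longleftrightarrow> (1 < 1 / p1 + ereal (s1 / ?d) \<or> (p1 = 1 \<and> s1 = 0))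
      \<and> (1 / p2 + ereal (s2 / ?d) < 0 \<or> (p2 = \<infinity> \<and> s2 = 0))
      \<and> (1 < 1 / q1 + ereal (t1 / ?d) \<or> (q1 = 1 \<and> t1 = 0))
      \<and> (1 / q2 + ereal (t2 / ?d) < 0 \<or> (q2 = \<infinity> \<and> t2 = 0))" (is "_ \<longleftrightarrow> ?R")
  proof
    assume M: ?M
    \<comment> \<open>The auxiliary results take the exponents in the order \<open>p1\<close>,
      \<open>q1\<close>, \<open>p2\<close>, \<open>q2\<close>, hence the permuted
      assumptions.\<close>
    note delta = OP_tau_maps_necessary_delta[OF assms(1-3,5,7,6,8,9) M, unfolded d(1)]
    note const = OP_tau_maps_necessary_const[OF assms(1-3,5,7,6,8,10) M, unfolded d(1)]
    from delta const show ?R by blast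
  next
    assume R: ?R
    have "\<tau> \<noteq> 1" using assms(10) by simp
    then show ?M
      using OP_tau_maps_sufficient[OF assms(1-4,5,7,6,8), unfolded d(1)] R by blast
  qed
  have "?R \<longrightarrow> s2 \<le> 0 \<and> 0 \<le> s1 \<and> t2 \<le> 0 \<and> 0 \<le> t1"
    using source_exponents_nonneg[OF assms(5) _ d(2)] source_exponents_nonneg[OF assms(7) _ d(2)]
      target_exponents_nonpos[OF assms(6) _ d(2)] target_exponents_nonpos[OF assms(8) _ d(2)] by blast
  moreover have "s1 = 0 \<and> s2 = 0 \<and> t1 = 0 \<and> t2 = 0 \<longrightarrow> (?R \<longleftrightarrow> p1 = 1 \<and> q1 = 1 \<and> p2 = \<infinity> \<and> q2 = \<infinity>)"
    using exponents_unweighted(1)[OF assms(5), of ?d] exponents_unweighted(1)[OF assms(7), of ?d]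
      exponents_unweighted(2)[OF assms(6), of ?d] exponents_unweighted(2)[OF assms(8), of ?d] by blast
  ultimately show ?thesis unfolding iff prod.inject by blast
qed

end
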